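(* Let $(\mathbf{G},\boldsymbol{\lambda},\varkappa)$ be a measured groupoid with set of objects $X$. The following conditions are equivalent: (i) $(\mathbf{G},\boldsymbol{\lambda},\varkappa)$ is amenable; (ii) there exists a sequence $(\boldsymbol{\theta}_n)$ of measurable target fibred systems $\boldsymbol{\theta}_n=\{\theta_n^x\}_{x\in X}$ of absolutely continuous probability measures which satisfies the pointwise strong asymptotic invariance condition $$\left\| g\,\theta_n^{\underline g}-\theta_n^{\overline g}\right\|\xrightarrow[n\to\infty]{}0\qquad\text{for }(\boldsymbol{\lambda}\star\varkappa)\text{-a.e. } g\in\mathbf{G},$$ or, in terms of the corresponding equivariant transition operators $P_n$, $$\left\|(\delta_g-\delta_{\overline g})P_n\right\|\xrightarrow[n\to\infty]{}0\qquad\text{for }(\boldsymbol{\lambda}\star\varkappa)\text{-a.e. } g\in\mathbf{G};$$ (iii) the systems $\boldsymbol{\theta}_n$ in condition (ii) can be chosen to be the convolution powers of a single such system, i.e., there exists a single equivariant transition operator $P$ with absolutely continuous transition probabilities such that the convergence in (ii) holds with $P_n=P^n$.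
   Context: Groupoids. A groupoid $\mathbf{G}$ is a small category in which each morphism is an isomorphism; $X$ is its set of objects and $\mathbf{G}$ also denotes its set of morphisms. The source and target of $g\in\mathbf{G}$ are $\underline{g}\in X$ and $\overline{g}\in X$. The product $gg'$ is defined exactly when $\underline{g}=\overline{g'}$ (set $\mathbf{G}^{(2)}$ of composable pairs), and $\underline{gg'}=\underline{g'}$, $\overline{gg'}=\overline{g}$. Objects $x\in X$ are identified with the identity morphisms $\epsilon_x\in\mathbf{G}$. The target fibre over $x$ is $\mathbf{G}^x=\{g\in\mathbf{G}:\overline{g}=x\}$. Left multiplication by $g$ is a bijection $\mathbf{G}^{\underline{g}}\to\mathbf{G}^{\overline{g}}$, and for a measure $\alpha$ on $\mathbf{G}^{\underline g}$, $g\alpha$ denotes its image under this map. Measured groupoids. All measure spaces are Lebesgue–Rokhlin spaces and all measures are finite or $\sigma$-finite. A groupoid is measurable if its set of morphisms carries a $\sigma$-algebra such that all structure maps (source, target, composition, unit inclusion, inversion) are measurable, where $X$ and $\mathbf{G}^{(2)}$ carry the pullback $\sigma$-algebras under $X\hookrightarrow\mathbf{G}$ and $\mathbf{G}^{(2)}\hookrightarrow\mathbf{G}\times\mathbf{G}$. A measurable target fibred system of measures is a family $\{\lambda^x\}_{x\in X}$, $\lambda^x$ a measure on $\mathbf{G}^x$, such that $x\mapsto\langle f,\lambda^x\rangle=\int f\,d\lambda^x$ is measurable for every non-negative measurable $f$ on $\mathbf{G}$. A Haar system is such a system $\boldsymbol{\lambda}=\{\lambda^x\}$ which is left invariant ($g\lambda^{\underline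 g}=\lambda^{\overline g}$ for all $g\in\mathbf{G}$) and proper (there is a non-negative measurable $f$ on $\mathbf{G}$ with $\langle f,\lambda^x\rangle=1$ for all $x\in X$). For a measure $\varkappa$ on $X$, $\boldsymbol{\lambda}\star\varkappa$ is the measure $\int\lambda^x\,d\varkappa(x)$ on $\mathbf{G}$; $\varkappa$ is quasi-invariant if $g\mapsto g^{-1}$ preserves the $(\boldsymbol{\lambda}\star\varkappa)$-negligible sets. A measured groupoid is a triple $(\mathbf{G},\boldsymbol{\lambda},\varkappa)$ with $\mathbf{G}$ a measurable groupoid, $\boldsymbol{\lambda}$ a Haar system and $\varkappa$ a quasi-invariant measure on $X$. A target fibred system $\{\theta^x\}$ of probability measures is absolutely continuous if $\theta^x\prec\lambda^x$ for all $x\in X$. Amenability. $(\mathbf{G},\boldsymbol{\lambda},\varkappa)$ is amenable if there is a sequence of measurable target fibred systems $\boldsymbol{\theta}_n=\{\theta_n^x\}_{x\in X}$ of absolutely continuous probability measures such that $\int\|g\,\theta_n^{\underline g}-\theta_n^{\overline g}\|\,dm(g)\to0$ as $n\to\infty$ for every probability measure $m\prec\boldsymbol{\lambda}\star\varkappa$, where $\|\cdot\|$ is the total variation norm. Equivariant transition operators. A measurable family of transition probabilities $\{\pi^g\}_{g\in\mathbf{G}}$ on $\mathbf{G}$ (i.e. $g\mapsto\langle f,\pi^g\rangle$ is measurable for every measurable $f$ on $\mathbf{G}$ for which this makes sense) is equivariant if $\pi^g(\mathbf{G}^{\overline g})=1$ for all $g\in\mathbf{G}$ and $\pi^{gg'}=g\,\pi^{g'}$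 for all $(g,g')\in\mathbf{G}^{(2)}$. The associated equivariant transition operator $P$ acts by $Pf(g)=\langle f,\pi^g\rangle$ on functions and $\alpha P=\int\pi^g\,d\alpha(g)$ on measures. It has absolutely continuous transition probabilities if $\pi^g\prec\lambda^{\overline g}$ for all $g\in\mathbf{G}$. Equivariant transition operators correspond bijectively to measurable target fibred systems $\{\theta^x\}$ of probability measures by $\theta^x=\pi^{\epsilon_x}$ and $\pi^g=g\,\theta^{\underline g}$, and absolute continuity is preserved by this correspondence. The convolution of target fibred systems of probability measures is the operation corresponding to the product of the associated equivariant transition operators. *)

theory Defs
  imports "HOL-Probability.Probability"
begin

section \<open>Lebesgue--Rokhlin spaces\<close>

definition isomorphic_mod0 :: "'a measure \<Rightarrow> 'b measure \<Rightarrow> bool" where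
  "isomorphic_mod0 M N \<longleftrightarrow>
     (\<exists>A\<in>sets M. \<exists>B\<in>sets N. space M - A \<in> null_sets M \<and> space N - B \<in> null_sets N \<and>
       (\<exists>f\<in>measurable (restrict_space M A) (restrict_space N B).
        \<exists>h\<in>measurable (restrict_space N B) (restrict_space M A).
          (\<forall>x\<in>A. h (f x) = x) \<and> (\<forall>y\<in>B. f (h y) = y) \<and>
          distr (restrict_space M A) (restrict_space N B) f = restrict_space N B))"

text \<open>Lebesgue measure on \<open>I\<close> together with atoms of weight \<open>w n\<close>. For \<open>I \<subseteq> {0..}\<close> the
  atoms, which sit at the negative integers, lie off \<open>I\<close>.\<close>

definition interval_with_atoms :: "real set \<Rightarrow> (nat \<Rightarrow> real) \<Rightarrow> real measure" where
  "interval_with_atoms I w = measure_of UNIV (sets borel)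
     (\<lambda>B. emeasure lborel (B \<inter> I) + (\<Sum>n. ennreal (w n) * indicator B (- 1 - real n)))"

text \<open>Rokhlin's spaces are complete by definition, so the isomorphism is one of completions; this
  covers both complete measures and measures on a Borel structure. As in Rokhlin's definition, a
  sequence of measurable sets separates the points; in particular points are measurable. The
  interval may have infinite length, since the measures are only \<open>\<sigma>\<close>-finite.\<close>

definition lebesgue_rokhlin :: "'a measure \<Rightarrow> bool" where
  "lebesgue_rokhlin M \<longleftrightarrow> sigma_finite_measure M \<and>
     (\<exists>S. countable S \<and> S \<subseteq> sets M \<and>
       (\<forall>x\<in>space M. \<forall>y\<in>space M. x \<noteq> y \<longrightarrow> (\<exists>A\<in>S. (x \<in> A) \<noteq> (y \<in> A)))) \<and>
     (\<exists>I w. is_interval I \<and> I \<subseteq> {0..} \<and>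
       isomorphic_mod0 (completion M) (completion (interval_with_atoms I w)))"

section \<open>Total variation\<close>

text \<open>The total variation norm (total mass of the variation) of the signed measure \<open>\<alpha> - \<beta>\<close>, for
  finite measures \<open>\<alpha>\<close>, \<open>\<beta>\<close> on one \<open>\<sigma>\<close>-algebra.\<close>

definition tv_norm_diff :: "'a measure \<Rightarrow> 'a measure \<Rightarrow> ennreal" where
  "tv_norm_diff \<alpha> \<beta> =
     (SUP P\<in>{P. finite P \<and> P \<subseteq> sets \<alpha> \<and> partition_on (space \<alpha>) P}.
        \<Sum>A\<in>P. ennreal \<bar>measure \<alpha> A - measure \<beta> A\<bar>)"

section \<open>Groupoids\<close>

record ('o, 'g) groupoid_data =
  Obj :: "'o set"
  Mor :: "'g set"
  src :: "'g \<Rightarrow> 'o"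
  tgt :: "'g \<Rightarrow> 'o"
  unit :: "'o \<Rightarrow> 'g"
  mult :: "'g \<Rightarrow> 'g \<Rightarrow> 'g"
  ginv :: "'g \<Rightarrow> 'g"

definition composable :: "('o, 'g) groupoid_data \<Rightarrow> ('g \<times> 'g) set" where
  "composable G = {(g, h). g \<in> Mor G \<and> h \<in> Mor G \<and> src G g = tgt G h}"

definition fibre :: "('o, 'g) groupoid_data \<Rightarrow> 'o \<Rightarrow> 'g set" where
  "fibre G x = {g \<in> Mor G. tgt G g = x}"

locale groupoid =
  fixes G :: "('o, 'g) groupoid_data"
  assumes src_Obj: "g \<in> Mor G \<Longrightarrow> src G g \<in> Obj G"
    and tgt_Obj: "g \<in> Mor G \<Longrightarrow> tgt G g \<in> Obj G"
    and unit_Mor: "x \<in> Obj G \<Longrightarrow> unit G x \<in> Mor G"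
    and src_unit: "x \<in> Obj G \<Longrightarrow> src G (unit G x) = x"
    and tgt_unit: "x \<in> Obj G \<Longrightarrow> tgt G (unit G x) = x"
    and mult_Mor: "(g, h) \<in> composable G \<Longrightarrow> mult G g h \<in> Mor G"
    and src_mult: "(g, h) \<in> composable G \<Longrightarrow> src G (mult G g h) = src G h"
    and tgt_mult: "(g, h) \<in> composable G \<Longrightarrow> tgt G (mult G g h) = tgt G g"
    and mult_assoc: "(g, h) \<in> composable G \<Longrightarrow> (h, k) \<in> composable G \<Longrightarrow>
          mult G (mult G g h) k = mult G g (mult G h k)"
    and mult_unit_left: "g \<in> Mor G \<Longrightarrow> mult G (unit G (tgt G g)) g = g"
    and mult_unit_right: "g \<in> Mor G \<Longrightarrow> mult G g (unit G (src G g)) = g"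
    and ginv_Mor: "g \<in> Mor G \<Longrightarrow> ginv G g \<in> Mor G"
    and src_ginv: "g \<in> Mor G \<Longrightarrow> src G (ginv G g) = tgt G g"
    and tgt_ginv: "g \<in> Mor G \<Longrightarrow> tgt G (ginv G g) = src G g"
    and mult_ginv_left: "g \<in> Mor G \<Longrightarrow> mult G (ginv G g) g = unit G (src G g)"
    and mult_ginv_right: "g \<in> Mor G \<Longrightarrow> mult G g (ginv G g) = unit G (tgt G g)"

text \<open>Below, \<open>M\<close> stands for the \<open>\<sigma>\<close>-algebra on the morphisms; its measure is never used. The
  objects and the composable pairs carry the pullback \<open>\<sigma>\<close>-algebras.\<close>

definition obj_algebra :: "('o, 'g) groupoid_data \<Rightarrow> 'g measure \<Rightarrow> 'o measure" where
  "obj_algebra G M = vimage_algebra (Obj G) (unit G) M"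

locale measurable_groupoid = groupoid G
  for G :: "('o, 'g) groupoid_data" +
  fixes M :: "'g measure"
  assumes space_M: "space M = Mor G"
    and src_measurable: "src G \<in> measurable M (obj_algebra G M)"
    and tgt_measurable: "tgt G \<in> measurable M (obj_algebra G M)"
    and unit_measurable: "unit G \<in> measurable (obj_algebra G M) M"
    and mult_measurable: "(\<lambda>(g, h). mult G g h) \<in>
          measurable (restrict_space (M \<Otimes>\<^sub>M M) (composable G)) M"
    and ginv_measurable: "ginv G \<in> measurable M M"

section \<open>Fibred systems of measures\<close>

text \<open>A measure on the target fibre over \<open>x\<close> is represented by its extension by zero to the whole
  \<open>\<sigma>\<close>-algebra \<open>M\<close>. The translate by \<open>g\<close> restricts to the fibre over \<open>src G g\<close> first, because
  \<open>mult G g\<close> is meaningful only there.\<close>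

definition translate :: "('o, 'g) groupoid_data \<Rightarrow> 'g measure \<Rightarrow> 'g \<Rightarrow> 'g measure \<Rightarrow> 'g measure" where
  "translate G M g \<alpha> = distr (restrict_space \<alpha> (fibre G (src G g))) M (mult G g)"

definition fibred_system :: "('o, 'g) groupoid_data \<Rightarrow> 'g measure \<Rightarrow> ('o \<Rightarrow> 'g measure) \<Rightarrow> bool" where
  "fibred_system G M \<alpha> \<longleftrightarrow>
     (\<forall>x\<in>Obj G. sets (\<alpha> x) = sets M \<and> (AE g in \<alpha> x. g \<in> fibre G x)) \<and>
     (\<forall>f :: 'g \<Rightarrow> ennreal. f \<in> borel_measurable M \<longrightarrow>
        (\<lambda>x. \<integral>\<^sup>+ g. f g \<partial>\<alpha> x) \<in> borel_measurable (obj_algebra G M))"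

definition haar_system :: "('o, 'g) groupoid_data \<Rightarrow> 'g measure \<Rightarrow> ('o \<Rightarrow> 'g measure) \<Rightarrow> bool" where
  "haar_system G M l \<longleftrightarrow> fibred_system G M l \<and>
     (\<forall>g\<in>Mor G. translate G M g (l (src G g)) = l (tgt G g)) \<and>
     (\<exists>f :: 'g \<Rightarrow> ennreal. f \<in> borel_measurable M \<and> (\<forall>x\<in>Obj G. (\<integral>\<^sup>+ g. f g \<partial>l x) = 1))"

definition star_measure :: "'g measure \<Rightarrow> ('o \<Rightarrow> 'g measure) \<Rightarrow> 'o measure \<Rightarrow> 'g measure" where
  "star_measure M l \<kappa> = measure_of (space M) (sets M) (\<lambda>A. \<integral>\<^sup>+ x. emeasure (l x) A \<partial>\<kappa>)"

text \<open>The three \<open>lebesgue_rokhlin\<close> assumptions render the convention that all measure spaces are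
  Lebesgue--Rokhlin spaces and all measures are \<open>\<sigma>\<close>-finite.\<close>

locale measured_groupoid = measurable_groupoid G M
  for G :: "('o, 'g) groupoid_data" and M :: "'g measure" +
  fixes l :: "'o \<Rightarrow> 'g measure" and \<kappa> :: "'o measure"
  assumes haar: "haar_system G M l"
    and sets_\<kappa>: "sets \<kappa> = sets (obj_algebra G M)"
    and rokhlin_l: "x \<in> Obj G \<Longrightarrow> lebesgue_rokhlin (l x)"
    and rokhlin_\<kappa>: "lebesgue_rokhlin \<kappa>"
    and rokhlin_star: "lebesgue_rokhlin (star_measure M l \<kappa>)"
    and quasi_invariant: "A \<in> sets M \<Longrightarrow>
          A \<in> null_sets (star_measure M l \<kappa>) \<longleftrightarrow>
          ginv G -` A \<inter> Mor G \<in> null_sets (star_measure M l \<kappa>)"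

definition ac_prob_system ::
    "('o, 'g) groupoid_data \<Rightarrow> 'g measure \<Rightarrow> ('o \<Rightarrow> 'g measure) \<Rightarrow> ('o \<Rightarrow> 'g measure) \<Rightarrow> bool" where
  "ac_prob_system G M l \<theta> \<longleftrightarrow> fibred_system G M \<theta> \<and>
     (\<forall>x\<in>Obj G. prob_space (\<theta> x) \<and> absolutely_continuous (l x) (\<theta> x))"

section \<open>Amenability\<close>

definition amenable ::
    "('o, 'g) groupoid_data \<Rightarrow> 'g measure \<Rightarrow> ('o \<Rightarrow> 'g measure) \<Rightarrow> 'o measure \<Rightarrow> bool" where
  "amenable G M l \<kappa> \<longleftrightarrow>
     (\<exists>\<theta> :: nat \<Rightarrow> 'o \<Rightarrow> 'g measure. (\<forall>n. ac_prob_system G M l (\<theta> n)) \<and>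
       (\<forall>m. prob_space m \<and> sets m = sets M \<and> absolutely_continuous (star_measure M l \<kappa>) m \<longrightarrow>
         (\<lambda>n. \<integral>\<^sup>+ g. tv_norm_diff (translate G M g (\<theta> n (src G g))) (\<theta> n (tgt G g)) \<partial>m)
           \<longlonglongrightarrow> 0))"

section \<open>Equivariant transition operators\<close>

text \<open>An operator \<open>P\<close> is given by its transition probabilities \<open>\<pi>\<close>, and \<open>\<alpha> P\<close> is
  \<open>bind \<alpha> \<pi>\<close>; hence the transition probabilities of the product \<open>P Q\<close> (\<open>P\<close> acting first on
  measures) are \<open>g \<mapsto> bind (\<pi>\<^sub>P g) \<pi>\<^sub>Q\<close>.\<close>

definition equivariant_operator ::
    "('o, 'g) groupoid_data \<Rightarrow> 'g measure \<Rightarrow> ('g \<Rightarrow> 'g measure) \<Rightarrow> bool" where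
  "equivariant_operator G M \<pi> \<longleftrightarrow> \<pi> \<in> measurable M (prob_algebra M) \<and>
     (\<forall>g\<in>Mor G. emeasure (\<pi> g) (fibre G (tgt G g)) = 1) \<and>
     (\<forall>(g, h)\<in>composable G. \<pi> (mult G g h) = translate G M g (\<pi> h))"

definition ac_operator ::
    "('o, 'g) groupoid_data \<Rightarrow> ('o \<Rightarrow> 'g measure) \<Rightarrow> ('g \<Rightarrow> 'g measure) \<Rightarrow> bool" where
  "ac_operator G l \<pi> \<longleftrightarrow> (\<forall>g\<in>Mor G. absolutely_continuous (l (tgt G g)) (\<pi> g))"

definition operator_of_system ::
    "('o, 'g) groupoid_data \<Rightarrow> 'g measure \<Rightarrow> ('o \<Rightarrow> 'g measure) \<Rightarrow> 'g \<Rightarrow> 'g measure" where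
  "operator_of_system G M \<theta> g = translate G M g (\<theta> (src G g))"

definition system_of_operator ::
    "('o, 'g) groupoid_data \<Rightarrow> ('g \<Rightarrow> 'g measure) \<Rightarrow> 'o \<Rightarrow> 'g measure" where
  "system_of_operator G \<pi> x = \<pi> (unit G x)"

definition operator_prod :: "('g \<Rightarrow> 'g measure) \<Rightarrow> ('g \<Rightarrow> 'g measure) \<Rightarrow> 'g \<Rightarrow> 'g measure" where
  "operator_prod \<pi> \<rho> g = bind (\<pi> g) \<rho>"

primrec operator_power :: "'g measure \<Rightarrow> ('g \<Rightarrow> 'g measure) \<Rightarrow> nat \<Rightarrow> 'g \<Rightarrow> 'g measure" where
  "operator_power M \<pi> 0 = return M"
| "operator_power M \<pi> (Suc n) = operator_prod (operator_power M \<pi> n) \<pi>"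

definition convolution :: "('o, 'g) groupoid_data \<Rightarrow> 'g measure \<Rightarrow>
    ('o \<Rightarrow> 'g measure) \<Rightarrow> ('o \<Rightarrow> 'g measure) \<Rightarrow> 'o \<Rightarrow> 'g measure" where
  "convolution G M \<theta> \<eta> =
     system_of_operator G (operator_prod (operator_of_system G M \<theta>) (operator_of_system G M \<eta>))"

primrec convolution_power :: "('o, 'g) groupoid_data \<Rightarrow> 'g measure \<Rightarrow>
    ('o \<Rightarrow> 'g measure) \<Rightarrow> nat \<Rightarrow> 'o \<Rightarrow> 'g measure" where
  "convolution_power G M \<theta> 0 = (\<lambda>x. return M (unit G x))"
| "convolution_power G M \<theta> (Suc n) = convolution G M (convolution_power G M \<theta> n) \<theta>"

section \<open>Pointwise strong asymptotic invariance\<close>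

definition asymp_invariant_systems :: "('o, 'g) groupoid_data \<Rightarrow> 'g measure \<Rightarrow>
    ('o \<Rightarrow> 'g measure) \<Rightarrow> 'o measure \<Rightarrow> (nat \<Rightarrow> 'o \<Rightarrow> 'g measure) \<Rightarrow> bool" where
  "asymp_invariant_systems G M l \<kappa> \<theta> \<longleftrightarrow>
     (AE g in star_measure M l \<kappa>.
       (\<lambda>n. tv_norm_diff (translate G M g (\<theta> n (src G g))) (\<theta> n (tgt G g))) \<longlonglongrightarrow> 0)"

definition asymp_invariant_operators :: "('o, 'g) groupoid_data \<Rightarrow> 'g measure \<Rightarrow>
    ('o \<Rightarrow> 'g measure) \<Rightarrow> 'o measure \<Rightarrow> (nat \<Rightarrow> 'g \<Rightarrow> 'g measure) \<Rightarrow> bool" where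
  "asymp_invariant_operators G M l \<kappa> P \<longleftrightarrow>
     (AE g in star_measure M l \<kappa>.
       (\<lambda>n. tv_norm_diff (bind (return M g) (P n)) (bind (return M (unit G (tgt G g))) (P n)))
         \<longlonglongrightarrow> 0)"

end

theory Submission
  imports Defs
begin

text \<open>Measurability of the total variation defect is the point at which the Lebesgue--Rokhlin
  hypothesis enters: a countable family of measurable sets that separates points generates a
  countable algebra which is dense for every measure absolutely continuous with respect to some
  \<open>l x\<close>, so the total variation distance is, up to a factor of two, a supremum over that algebra.

  Given an asymptotically invariant sequence, the single operator is a mixture
  \<open>P = (\<Sum>k. 2 ^ (- k - 1) Q\<^sub>k)\<close> of a subsequence. Split it as \<open>P = A + B\<close>, where \<open>A\<close> collects
  the terms with \<open>k < m\<close>. In the expansion of \<open>P ^ n\<close> by the first occurrence of \<open>B\<close>, the term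
  \<open>A ^ n\<close> has small mass for large \<open>n\<close>, while the terms starting with \<open>A ^ i B\<close> are nearly
  invariant as soon as each \<open>Q\<^sub>k\<close> is chosen, depending on \<open>Q\<^sub>j\<close> with \<open>j < k\<close>, so far out that its
  defect is small on average after applying \<open>A ^ i\<close>.\<close>

text \<open>A term starting with \<open>A ^ i B\<close> is nearly invariant because the
  \<open>i\<close> steps of \<open>A\<close> stay in the target fibre of \<open>g\<close>, and for
  \<open>k \<ge> m\<close> the law \<open>Q\<^sub>k h\<close> is close to \<open>Q\<^sub>k\<close>
  at the unit of that fibre, up to the defect at \<open>h\<close>. Whatever follows is a
  contraction, so an estimate for \<open>N\<close> steps holds for every \<open>n \<ge> N\<close> at
  once. The choice of the \<open>Q\<^sub>k\<close> is not circular: \<open>A\<close> has mass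
  \<open>1 - (1/2) ^ m\<close> whichever operators are mixed, so the number of steps that makes
  \<open>A ^ N\<close> small depends on \<open>m\<close> alone, and \<open>A\<close> involves only
  operators with index below \<open>m\<close>. At stage \<open>k\<close> only the finitely many
  \<open>m \<le> k\<close> impose a condition. Two obstacles shape the measure theory. Averaging
  with \<open>A ^ i\<close> calls for a defect that is measurable in \<open>g\<close>, while the
  Rokhlin isomorphisms are given fibre by fibre, with no measurable dependence on the fibre; so one
  countable algebra has to serve all fibres. Furthermore the units may form a null set, so a
  statement for almost every \<open>g\<close> says nothing about units, and convergence at the unit
  is carried along separately.\<close>

section \<open>Approximation by compact sets and by a countable algebra in Lebesgue--Rokhlin
  spaces\<close>

text \<open>Transport \<open>a\<close> to a finite Borel measure on the line and use inner
  regularity there. The isomorphism respects only the completions; absolute continuity makes the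
  exceptional null sets negligible for \<open>a\<close> too. As the image of \<open>C\<close> under
  \<open>h\<close> is not known to be measurable, the part of \<open>E\<close> that it misses is
  enclosed in a measurable set \<open>Z\<close>. One pair \<open>B\<close>, \<open>h\<close> serves
  all \<open>E\<close> and \<open>e\<close>, so that countably many approximations can be
  intersected in the model.\<close>

lemma lebesgue_rokhlin_compact_approx:
  fixes N :: "'a measure"
  assumes N: "lebesgue_rokhlin N" and fin: "finite_measure a"
    and sets_a: "sets a = sets N" and ac: "absolutely_continuous N a"
  obtains B :: "real set" and h :: "real \<Rightarrow> 'a" where "h ` B \<subseteq> space N" "inj_on h B"
    "\<And>E e. E \<in> sets N \<Longrightarrow> e > 0 \<Longrightarrow>
       \<exists>C Z. compact C \<and> C \<subseteq> {y\<in>B. h y \<in> E} \<and> Z \<in> sets a \<and> measure a Z < e \<and> E - h ` C \<subseteq> Z"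
proof -
  interpret finite_measure a by fact
  obtain I w where iso: "isomorphic_mod0 (completion N) (completion (interval_with_atoms I w))"
    using N unfolding lebesgue_rokhlin_def by (elim conjE exE) (rule that)
  define V where "V = interval_with_atoms I w"
  have sets_V: "sets V = sets borel"
    unfolding V_def interval_with_atoms_def using sets.sigma_sets_eq[of "borel::real measure"] by simp
  obtain A B f h where A: "A \<in> sets (completion N)" and B: "B \<in> sets (completion V)"
    and nullA: "space N - A \<in> null_sets (completion N)"
    and f: "f \<in> measurable (restrict_space (completion N) A) (restrict_space (completion V) B)"
    and h: "h \<in> measurable (restrict_space (completion V) B) (restrict_space (completion N) A)"
    and hf: "\<And>x. x \<in> A \<Longrightarrow> h (f x) = x" and fh: "\<And>y. y \<in> B \<Longrightarrow> f (h y) = y"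
    and distr: "distr (restrict_space (completion N) A) (restrict_space (completion V) B) f
                  = restrict_space (completion V) B"
    using iso unfolding isomorphic_mod0_def V_def[symmetric] by auto
  have [simp]: "space V = UNIV" using sets_eq_imp_space_eq[OF sets_V] by simp
  have space_a: "space a = space N" using sets_eq_imp_space_eq[OF sets_a] .
  have A_sub: "A \<subseteq> space N" using sets.sets_into_space[OF A] by simp
  have f_B: "f x \<in> B" if "x \<in> A" for x
    using measurable_space[OF f, of x] that A_sub by (auto simp: space_restrict_space)
  have h_A: "h y \<in> A" if "y \<in> B" for y
    using measurable_space[OF h, of y] that by (auto simp: space_restrict_space)
  have null_a: "X \<in> null_sets (completion a)" if "X \<in> null_sets (completion N)" for X
    using that ac null_sets_completion_iff2[of X N] null_sets_completion_iff2[of X a]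
    unfolding absolutely_continuous_def by blast
  have sets_ca: "X \<in> sets (completion a)" if "X \<in> sets (completion N)" for X
  proof -
    from that obtain S N1 N2 where "X = S \<union> N1" "N1 \<subseteq> N2" "N2 \<in> null_sets N" "S \<in> sets N"
      by (rule sets_completionE)
    then show ?thesis using ac sets_a unfolding absolutely_continuous_def
      by (intro sets_completionI[of X S N1 N2]) auto
  qed
  have f_pre: "{x\<in>A. f x \<in> E} \<in> sets (completion N)" if "E \<in> sets (completion V)" for E
  proof -
    have "B \<inter> E \<in> sets (restrict_space (completion V) B)"
      using that B by (auto simp: sets_restrict_space)
    from measurable_sets[OF f this] have "f -` (B \<inter> E) \<inter> A \<in> sets (restrict_space (completion N) A)"
      using A_sub by (simp add: space_restrict_space Int_absorb2)
    moreover have "f -` (B \<inter> E) \<inter> A = {x\<in>A. f x \<in> E}" using f_B by auto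
    moreover have "A \<inter> space (completion N) \<in> sets (completion N)" using A A_sub by (simp add: Int_absorb2)
    ultimately show ?thesis by (simp add: sets_restrict_space_iff)
  qed
  \<comment> \<open>\<open>f\<close> carries the measure of \<open>N\<close> to that of the model,
    so the preimage of a null set of the model is null for \<open>N\<close>, and hence for
    \<open>a\<close>.\<close>
  have fV: "{x\<in>A. f x \<in> Z} \<in> null_sets (completion N)" if Z: "Z \<in> null_sets V" for Z
  proof -
    have ZB: "B \<inter> Z \<in> sets (restrict_space (completion V) B)"
      using Z B by (auto simp: sets_restrict_space)
    have ZV: "Z \<in> null_sets (completion V)" using Z by (rule null_sets_completionI)
    have "emeasure (restrict_space (completion V) B) (B \<inter> Z) = 0"
      using ZV B by (simp add: emeasure_restrict_space)
        (metis emeasure_eq_0 inf_le2 null_setsD1 null_setsD2)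
    then have "emeasure (restrict_space (completion N) A) (f -` (B \<inter> Z) \<inter> A) = 0"
      using emeasure_distr[OF f ZB] distr A_sub by (simp add: space_restrict_space Int_absorb2)
    moreover have "f -` (B \<inter> Z) \<inter> A = {x\<in>A. f x \<in> Z}" using f_B by auto
    ultimately have "emeasure (completion N) {x\<in>A. f x \<in> Z} = 0"
      using A by (subst (asm) emeasure_restrict_space) auto
    then show ?thesis using f_pre[of Z] ZV by (auto simp: null_sets_def)
  qed
  define a' where "a' = distr (restrict_space (completion a) A) borel f"
  have Aa: "A \<in> sets (completion a)" using A by (rule sets_ca)
  have f_borel: "f \<in> borel_measurable (restrict_space (completion a) A)"
  proof (rule measurableI)
    fix X :: "real set" assume "X \<in> sets borel"
    then have "X \<in> sets (completion V)" using sets_V by (simp add: sets_completionI_sets)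
    from sets_ca[OF f_pre[OF this]]
    show "f -` X \<inter> space (restrict_space (completion a) A) \<in> sets (restrict_space (completion a) A)"
      using Aa A_sub space_a by (simp add: space_restrict_space sets_restrict_space_iff Int_absorb2)
        (simp add: vimage_def Int_def conj_commute)
  qed auto
  have a'_eq: "emeasure a' X = emeasure (completion a) {x\<in>A. f x \<in> X}" if "X \<in> sets borel" for X
  proof -
    have "emeasure a' X = emeasure (restrict_space (completion a) A) (f -` X \<inter> A)"
      unfolding a'_def using that f_borel A_sub space_a
      by (subst emeasure_distr) (auto simp: space_restrict_space Int_absorb2)
    also have "\<dots> = emeasure (completion a) (f -` X \<inter> A)"
      using Aa by (intro emeasure_restrict_space) auto
    finally show ?thesis by (simp add: vimage_def Int_def conj_commute)
  qed
  interpret a': finite_measure a'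
  proof
    have "emeasure a' UNIV \<le> emeasure (completion a) (space (completion a))"
      by (subst a'_eq) (simp, rule emeasure_space)
    then show "emeasure a' (space a') \<noteq> \<infinity>" by (auto simp: a'_def top_unique)
  qed
  have sets_a': "sets a' = sets borel" by (simp add: a'_def)
  have approx: "\<exists>C Z. compact C \<and> C \<subseteq> {y\<in>B. h y \<in> E} \<and> Z \<in> sets a \<and> measure a Z < e \<and> E - h ` C \<subseteq> Z"
    if E: "E \<in> sets N" and e: "e > 0" for E and e :: real
  proof -
    have "A \<inter> E \<in> sets (restrict_space (completion N) A)"
      using E A by (auto simp: sets_restrict_space)
    from measurable_sets[OF h this] have "h -` (A \<inter> E) \<inter> B \<in> sets (restrict_space (completion V) B)"
      by (simp add: space_restrict_space)
    moreover have "h -` (A \<inter> E) \<inter> B = {y\<in>B. h y \<in> E}" using h_A by auto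
    ultimately have "{y\<in>B. h y \<in> E} \<in> sets (completion V)" using B by (simp add: sets_restrict_space_iff)
    \<comment> \<open>The part of the model over \<open>E\<close> is measurable only for the
      completion. Inner regularity is applied to its Borel kernel \<open>S\<close>; the rest lies in
      the null set \<open>N2\<close>.\<close>
    then obtain S N1 N2 where S: "{y\<in>B. h y \<in> E} = S \<union> N1" "N1 \<subseteq> N2" "N2 \<in> null_sets V" "S \<in> sets V"
      by (rule sets_completionE)
    have Sb: "S \<in> sets borel" using S sets_V by simp
    have inner: "emeasure a' S = (SUP K\<in>{K. K \<subseteq> S \<and> compact K}. emeasure a' K)"
      by (rule inner_regular) (use sets_a' Sb in \<open>auto simp: a'.emeasure_finite\<close>)
    have "\<exists>C. C \<subseteq> S \<and> compact C \<and> emeasure a' S < emeasure a' C + ennreal e"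
    proof (rule ccontr)
      assume "\<not> ?thesis"
      then have le: "emeasure a' C + ennreal e \<le> emeasure a' S" if "C \<subseteq> S" "compact C" for C
        using that by (auto simp: not_less)
      have "(SUP K\<in>{K. K \<subseteq> S \<and> compact K}. emeasure a' K) + ennreal e
          = (SUP K\<in>{K. K \<subseteq> S \<and> compact K}. emeasure a' K + ennreal e)"
        by (rule ennreal_SUP_add_left[symmetric]) auto
      also have "\<dots> \<le> emeasure a' S" by (intro SUP_least) (use le in auto)
      finally have "emeasure a' S + ennreal e \<le> emeasure a' S" using inner by simp
      then show False using e a'.emeasure_finite[of S]
        by (simp add: a'.emeasure_eq_measure flip: ennreal_plus)
    qed
    then obtain C where C: "C \<subseteq> S" "compact C" "emeasure a' S < emeasure a' C + ennreal e" by blast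
    have Cb: "C \<in> sets borel" using C(2) by (simp add: borel_compact)
    have SC: "measure a' (S - C) < e"
      using C Cb Sb e by (simp add: a'.finite_measure_Diff sets_a' a'.emeasure_eq_measure ennreal_less_iff flip: ennreal_plus)
    \<comment> \<open>A point of \<open>E\<close> can escape the image of \<open>C\<close> in three
      ways: outside the domain \<open>A\<close>, over \<open>S - C\<close>, or over the null set
      \<open>N2\<close>. Only the second set can have positive measure.\<close>
    define W where "W = (space N - A) \<union> {x\<in>A. f x \<in> S - C} \<union> {x\<in>A. f x \<in> N2}"
    have n1: "space N - A \<in> null_sets (completion a)" and n2: "{x\<in>A. f x \<in> N2} \<in> null_sets (completion a)"
      using nullA fV[OF S(3)] by (auto intro: null_a)
    have sSC: "{x\<in>A. f x \<in> S - C} \<in> sets (completion a)"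
      using Sb Cb sets_V by (intro sets_ca f_pre) (auto intro: sets_completionI_sets)
    have W: "W \<in> sets (completion a)" unfolding W_def using n1 n2 sSC by auto
    have "emeasure (completion a) W = emeasure (completion a) {x\<in>A. f x \<in> S - C}"
    proof -
      have "emeasure (completion a) W = emeasure (completion a) ({x\<in>A. f x \<in> S - C} \<union> ((space N - A) \<union> {x\<in>A. f x \<in> N2}))"
        unfolding W_def by (simp add: Un_ac)
      also have "\<dots> = emeasure (completion a) {x\<in>A. f x \<in> S - C}"
        using n1 n2 sSC by (intro emeasure_Un_null_set) auto
      finally show ?thesis .
    qed
    also have "\<dots> = emeasure a' (S - C)" using Sb Cb by (subst a'_eq) auto
    also have "\<dots> < ennreal e" using SC e by (simp add: a'.emeasure_eq_measure ennreal_less_iff)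
    finally have Wlt: "emeasure (completion a) W < ennreal e" .
    obtain Z where Z: "Z \<in> sets a" "W \<subseteq> Z" "emeasure (completion a) W = emeasure a Z"
      by (rule completion_upper[OF W]) (rule that)
    have "emeasure a Z < ennreal e" using Wlt unfolding Z(3) .
    then have "measure a Z < e" unfolding emeasure_eq_measure[of Z] by (simp only: ennreal_less_iff measure_nonneg)
    moreover have "E - h ` C \<subseteq> Z"
    proof
      fix x assume x: "x \<in> E - h ` C"
      show "x \<in> Z"
      proof (cases "x \<in> A")
        case True
        then have "f x \<in> {y\<in>B. h y \<in> E}" using f_B hf x by auto
        moreover have "f x \<notin> C" using x hf[OF True] by force
        ultimately have "x \<in> W" using S True unfolding W_def by auto
        then show ?thesis using Z by auto
      next
        case False
        then have "x \<in> W" using x sets.sets_into_space[OF E] unfolding W_def by auto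
        then show ?thesis using Z by auto
      qed
    qed
    moreover have "C \<subseteq> {y\<in>B. h y \<in> E}" using C(1) S(1) by auto
    ultimately show ?thesis using C(2) Z(1) by (intro exI[of _ C] exI[of _ Z] conjI)
  qed
  have "h ` B \<subseteq> space N" using h_A A_sub by auto
  moreover have "inj_on h B" using fh by (rule inj_on_inverseI)
  ultimately show thesis using approx by (rule that)
qed

text \<open>For a family of subsets of \<open>\<Omega>\<close> this is the generated algebra in
  disjunctive normal form, which makes countability immediate. The factor \<open>\<Omega>\<close>
  takes care of the empty \<open>F\<close>, whose intersection is the whole type.\<close>

definition boolean_combinations :: "'a set \<Rightarrow> 'a set set \<Rightarrow> 'a set set" where
  "boolean_combinations \<Omega> S =
     {\<Union>((\<lambda>F. \<Omega> \<inter> \<Inter>F) ` \<F>) |\<F>. finite \<F> \<and> \<F> \<subseteq> {F. finite F \<and> F \<subseteq> S \<union> (\<lambda>A. \<Omega> - A) ` S}}"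

lemma countable_boolean_combinations:
  assumes "countable S" shows "countable (boolean_combinations \<Omega> S)"
proof -
  have "countable {F. finite F \<and> F \<subseteq> S \<union> (\<lambda>A. \<Omega> - A) ` S}"
    using assms by (intro countable_Collect_finite_subset) auto
  then have "countable {\<F>. finite \<F> \<and> \<F> \<subseteq> {F. finite F \<and> F \<subseteq> S \<union> (\<lambda>A. \<Omega> - A) ` S}}"
    by (rule countable_Collect_finite_subset)
  then show ?thesis unfolding boolean_combinations_def
    by (simp add: setcompr_eq_image)
qed

lemma boolean_combinations_sets:
  assumes "S \<subseteq> sets M" shows "boolean_combinations (space M) S \<subseteq> sets M"
proof -
  have "space M \<inter> \<Inter>F \<in> sets M" if "finite F" "F \<subseteq> S \<union> (\<lambda>A. space M - A) ` S" for F
  proof (cases "F = {}")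
    case False
    then have "(\<Inter>A\<in>F. A) \<in> sets M" using that assms by (intro sets.finite_INT) auto
    then show ?thesis by auto
  qed auto
  then have "(\<Union>F\<in>\<F>. space M \<inter> \<Inter>F) \<in> sets M"
    if "finite \<F>" "\<F> \<subseteq> {F. finite F \<and> F \<subseteq> S \<union> (\<lambda>A. space M - A) ` S}" for \<F>
    using that by (intro sets.finite_UN) auto
  then show ?thesis unfolding boolean_combinations_def by auto
qed

lemma empty_boolean_combinations: "{} \<in> boolean_combinations \<Omega> S"
  unfolding boolean_combinations_def by (force intro: exI[of _ "{}"])

text \<open>Compactness is used twice, as in the proof that disjoint compact sets of a Hausdorff
  space have disjoint neighbourhoods. Members of \<open>S\<close> are clopen on \<open>K\<close>, so
  for a point \<open>p\<close> of \<open>C\<close> finitely many sets around \<open>h p\<close>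
  exclude the image of \<open>C'\<close>, and finitely many of the resulting neighbourhoods cover
  \<open>C\<close>.\<close>

lemma separate_compacts_boolean_combination:
  fixes K :: "'t::t2_space set"
  assumes h: "h ` K \<subseteq> \<Omega>" and inj: "inj_on h K"
    and clopen: "\<And>A. A \<in> S \<Longrightarrow> compact {y\<in>K. h y \<in> A} \<and> compact {y\<in>K. h y \<in> \<Omega> - A}"
    and sep: "\<And>x y. x \<in> \<Omega> \<Longrightarrow> y \<in> \<Omega> \<Longrightarrow> x \<noteq> y \<Longrightarrow> \<exists>A\<in>S. (x \<in> A) \<noteq> (y \<in> A)"
    and C: "compact C" "C \<subseteq> K" and C': "compact C'" "C' \<subseteq> K" and disj: "C \<inter> C' = {}"
  obtains B where "B \<in> boolean_combinations \<Omega> S" "h ` C \<subseteq> B" "h ` C' \<inter> B = {}"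
proof -
  define S' where "S' = S \<union> (\<lambda>A. \<Omega> - A) ` S"
  have compact_S': "compact {y\<in>K. h y \<in> A} \<and> compact {y\<in>K. h y \<in> \<Omega> - A}" if "A \<in> S'" for A
    using that unfolding S'_def
  proof
    assume "A \<in> (\<lambda>A. \<Omega> - A) ` S"
    then obtain D where D: "A = \<Omega> - D" "D \<in> S" by auto
    have "{y\<in>K. h y \<in> \<Omega> - A} = {y\<in>K. h y \<in> D}" using D h by auto
    then show ?thesis using clopen[OF D(2)] D by simp
  qed (rule clopen)
  have "\<exists>F. finite F \<and> F \<subseteq> S' \<and> p \<in> C \<and> (\<forall>A\<in>F. h p \<in> A) \<and> h ` C' \<inter> (\<Omega> \<inter> \<Inter>F) = {}" if p: "p \<in> C" for p
  proof -
    define \<A> where "\<A> = {A\<in>S'. h p \<in> A}"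
    have 1: "C' \<subseteq> (\<Union>A\<in>\<A>. - {y\<in>K. h y \<in> A})"
    proof
      fix q assume q: "q \<in> C'"
      then have "p \<noteq> q" "p \<in> K" "q \<in> K" using p disj C C' by auto
      then have "h p \<noteq> h q" "h p \<in> \<Omega>" "h q \<in> \<Omega>" using inj h by (auto dest: inj_onD)
      then obtain A where "A \<in> S" "(h p \<in> A) \<noteq> (h q \<in> A)" using sep by blast
      then have "\<exists>A\<in>S'. h p \<in> A \<and> h q \<notin> A" using \<open>h p \<in> \<Omega>\<close> unfolding S'_def by auto
      then show "q \<in> (\<Union>A\<in>\<A>. - {y\<in>K. h y \<in> A})" by (auto simp: \<A>_def)
    qed
    obtain F where "F \<subseteq> \<A>" "finite F" "C' \<subseteq> (\<Union>A\<in>F. - {y\<in>K. h y \<in> A})"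
      by (rule compactE_image[OF C'(1) _ 1]) (auto simp: \<A>_def intro!: open_Compl compact_imp_closed dest: compact_S')
    then show ?thesis using p C'(2) unfolding \<A>_def by (intro exI[of _ F]) blast
  qed
  then obtain F where F: "\<And>p. p \<in> C \<Longrightarrow> finite (F p) \<and> F p \<subseteq> S' \<and> (\<forall>A\<in>F p. h p \<in> A) \<and> h ` C' \<inter> (\<Omega> \<inter> \<Inter>(F p)) = {}"
    by metis
  \<comment> \<open>Open in the whole space, and on \<open>K\<close> exactly the set of points that
    \<open>h\<close> sends into all members of \<open>F p\<close>.\<close>
  define U where "U p = - (\<Union>A\<in>F p. {y\<in>K. h y \<in> \<Omega> - A})" for p
  have 1: "C \<subseteq> (\<Union>p\<in>C. U p)" unfolding U_def using F by fastforce
  have 2: "open (U p)" if "p \<in> C" for p unfolding U_def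
    using F[OF that] compact_S' by (intro open_Compl closed_UN) (auto intro!: compact_imp_closed)
  obtain D where D: "D \<subseteq> C" "finite D" "C \<subseteq> (\<Union>p\<in>D. U p)"
    by (rule compactE_image[OF C(1) 2 1])
  define B where "B = \<Union>((\<lambda>F. \<Omega> \<inter> \<Inter>F) ` (F ` D))"
  have "F p \<subseteq> S'" "finite (F p)" if "p \<in> D" for p using F D that by blast+
  then have "B \<in> boolean_combinations \<Omega> S"
    unfolding B_def boolean_combinations_def S'_def[symmetric]
    using D(2) by (intro CollectI exI[of _ "F ` D"] conjI refl) auto
  moreover have "h ` C \<subseteq> B"
  proof
    fix x assume "x \<in> h ` C"
    then obtain y where y: "y \<in> C" "x = h y" by auto
    then obtain p where "p \<in> D" "y \<in> U p" using D by auto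
    moreover have "y \<in> K" "h y \<in> \<Omega>" using y C h by auto
    ultimately show "x \<in> B" using y unfolding U_def B_def by auto
  qed
  moreover have "h ` C' \<inter> B = {}" unfolding B_def using F D by blast
  ultimately show thesis using that by blast
qed

text \<open>Lusin's theorem replaces the Lusin--Souslin theorem here: off a set of small measure the
  model is a compact set on which all members of \<open>S\<close> are clopen.\<close>

lemma lebesgue_rokhlin_separating_approx:
  fixes N :: "'a measure"
  assumes N: "lebesgue_rokhlin N" and fin: "finite_measure a"
    and sets_a: "sets a = sets N" and ac: "absolutely_continuous N a"
    and S: "countable S" "S \<subseteq> sets N"
    and sep: "\<And>x y. x \<in> space N \<Longrightarrow> y \<in> space N \<Longrightarrow> x \<noteq> y \<Longrightarrow> \<exists>A\<in>S. (x \<in> A) \<noteq> (y \<in> A)"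
    and E: "E \<in> sets N" and e: "e > 0"
  obtains B where "B \<in> boolean_combinations (space N) S" "measure a ((E - B) \<union> (B - E)) < e"
proof -
  interpret finite_measure a by fact
  obtain T :: "real set" and h where h: "h ` T \<subseteq> space N" and inj: "inj_on h T"
    and approx: "\<And>E e. E \<in> sets N \<Longrightarrow> e > 0 \<Longrightarrow>
       \<exists>C Z. compact C \<and> C \<subseteq> {y\<in>T. h y \<in> E} \<and> Z \<in> sets a \<and> measure a Z < e \<and> E - h ` C \<subseteq> Z"
    by (rule lebesgue_rokhlin_compact_approx[OF N fin sets_a ac]) (rule that)
  \<comment> \<open>\<open>space N\<close> is added so that the enumeration has the right range even
    for empty \<open>S\<close>.\<close>
  define s where "s = from_nat_into (insert (space N) S)"
  have range_s: "range s = insert (space N) S" unfolding s_def using S by (intro range_from_nat_into) auto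
  have s_sets: "s n \<in> sets N" for n using range_s S(2) by (metis insert_iff rangeI sets.top subset_eq)
  \<comment> \<open>Each \<open>s n\<close> costs two exceptional sets of measure below
    \<open>r n\<close>. These sum to at most \<open>e / 2\<close>, and \<open>E\<close> and its
    complement add less than \<open>e / 8\<close> each.\<close>
  define r where "r n = e / 8 * (1 / 2) ^ n" for n :: nat
  have r: "r n > 0" for n using e by (simp add: r_def)
  define Ap where "Ap E e C Z \<longleftrightarrow>
    compact C \<and> C \<subseteq> {y\<in>T. h y \<in> E} \<and> Z \<in> sets a \<and> measure a Z < e \<and> E - h ` C \<subseteq> Z" for E e C Z
  have "\<forall>n. \<exists>C Z. Ap (s n) (r n) C Z"
    unfolding Ap_def using approx[OF s_sets r] by blast
  then obtain C1 Z1 where Ap1: "\<And>n. Ap (s n) (r n) (C1 n) (Z1 n)" by metis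
  have "\<forall>n. \<exists>C Z. Ap (space N - s n) (r n) C Z"
    unfolding Ap_def using s_sets by (intro allI approx r) auto
  then obtain C2 Z2 where Ap2: "\<And>n. Ap (space N - s n) (r n) (C2 n) (Z2 n)" by metis
  note C1 = Ap1[unfolded Ap_def] and C2 = Ap2[unfolded Ap_def]
  have compact_C: "compact (C1 n)" "compact (C2 n)" for n using C1[of n] C2[of n] by simp_all
  have C_T: "C1 n \<subseteq> T" "C2 n \<subseteq> T" for n using C1[of n] C2[of n] by blast+
  have h_C: "y \<in> C1 n \<Longrightarrow> h y \<in> s n" "y \<in> C2 n \<Longrightarrow> h y \<in> space N - s n" for y n
    using C1[of n] C2[of n] by blast+
  have sets_Z: "Z1 n \<in> sets a" "Z2 n \<in> sets a" for n using C1[of n] C2[of n] by simp_all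
  have small_Z: "measure a (Z1 n) < r n" "measure a (Z2 n) < r n" for n using C1[of n] C2[of n] by simp_all
  have cover_Z: "s n - h ` C1 n \<subseteq> Z1 n" "(space N - s n) - h ` C2 n \<subseteq> Z2 n" for n
    using C1[of n] C2[of n] by simp_all
  \<comment> \<open>On \<open>K\<close> all sets \<open>s n\<close> are clopen: \<open>C1 n\<close>
    lies over \<open>s n\<close>, \<open>C2 n\<close> lies over its complement, both are compact,
    and together they cover \<open>K\<close>.\<close>
  define K where "K = (\<Inter>n. C1 n \<union> C2 n)"
  have closedK: "closed K" unfolding K_def by (intro closed_INT ballI closed_Un compact_imp_closed compact_C)
  have compactK: "compact K"
  proof -
    have "K = (C1 0 \<union> C2 0) \<inter> K" unfolding K_def by auto
    moreover have "compact (C1 0 \<union> C2 0)" by (intro compact_Un compact_C)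
    ultimately show ?thesis using closedK compact_Int_closed by metis
  qed
  have "K \<subseteq> C1 0 \<union> C2 0" unfolding K_def by blast
  then have KT: "K \<subseteq> T" using C_T by blast
  have clopen: "compact {y\<in>K. h y \<in> A} \<and> compact {y\<in>K. h y \<in> space N - A}" if "A \<in> S" for A
  proof -
    have "A \<in> range s" using that range_s by simp
    then obtain n where n: "A = s n" by (rule rangeE)
    have "y \<in> C1 n \<or> y \<in> C2 n" if "y \<in> K" for y using that unfolding K_def by auto
    moreover note h_C[of _ n]
    ultimately have "{y\<in>K. h y \<in> A} = C1 n \<inter> K" "{y\<in>K. h y \<in> space N - A} = C2 n \<inter> K"
      unfolding n by blast+
    then show ?thesis using compact_C[of n] closedK by (simp add: compact_Int_closed)
  qed
  have e8: "e / 8 > 0" and cE: "space N - E \<in> sets N" using e E by auto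
  have "\<exists>C Z. Ap E (e / 8) C Z" unfolding Ap_def by (rule approx[OF E e8])
  then obtain C Z where "Ap E (e / 8) C Z" by blast
  then have C: "compact C" "C \<subseteq> {y\<in>T. h y \<in> E}" "Z \<in> sets a" "measure a Z < e / 8" "E - h ` C \<subseteq> Z"
    unfolding Ap_def by blast+
  have "\<exists>C Z. Ap (space N - E) (e / 8) C Z" unfolding Ap_def by (rule approx[OF cE e8])
  then obtain C' Z' where "Ap (space N - E) (e / 8) C' Z'" by blast
  then have C': "compact C'" "C' \<subseteq> {y\<in>T. h y \<in> space N - E}" "Z' \<in> sets a" "measure a Z' < e / 8"
      "(space N - E) - h ` C' \<subseteq> Z'"
    unfolding Ap_def by blast+
  obtain B where B: "B \<in> boolean_combinations (space N) S" "h ` (C \<inter> K) \<subseteq> B" "h ` (C' \<inter> K) \<inter> B = {}"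
  proof (rule separate_compacts_boolean_combination[of h K "space N" S "C \<inter> K" "C' \<inter> K"])
    show "h ` K \<subseteq> space N" using h KT by auto
    show "inj_on h K" using inj KT by (rule inj_on_subset)
    show "C \<inter> K \<inter> (C' \<inter> K) = {}" using C(2) C'(2) by auto
  qed (use clopen sep C(1) C'(1) closedK in \<open>auto simp: compact_Int_closed\<close>)
  have BN: "B \<in> sets N" using B(1) boolean_combinations_sets[OF S(2)] by auto
  define Y where "Y = (\<Union>n. Z1 n \<union> Z2 n)"
  \<comment> \<open>By injectivity of \<open>h\<close>, a point \<open>y\<close> outside
    \<open>C1 n\<close> and \<open>C2 n\<close> has its image outside theirs; hence it falls into
    \<open>Z1 n\<close> or \<open>Z2 n\<close>.\<close>
  have not_K: "x \<in> Y" if y: "y \<in> T" "y \<notin> K" "x = h y" for x y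
  proof -
    obtain n where n: "y \<notin> C1 n" "y \<notin> C2 n" using y unfolding K_def by auto
    have "x \<notin> h ` C1 n" "x \<notin> h ` C2 n" using n y C_T[of n] inj by (auto dest: inj_onD)
    moreover have "x \<in> space N" using y h by auto
    ultimately show ?thesis using cover_Z[of n] unfolding Y_def by blast
  qed
  have "(E - B) \<union> (B - E) \<subseteq> Z \<union> Z' \<union> Y"
  proof
    fix x assume x: "x \<in> (E - B) \<union> (B - E)"
    show "x \<in> Z \<union> Z' \<union> Y"
    proof (cases "x \<in> E")
      case True
      then have xB: "x \<notin> B" using x by auto
      show ?thesis
      proof (cases "x \<in> h ` C")
        case True
        then obtain y where y: "y \<in> C" "x = h y" by auto
        then have "y \<notin> K" using B(2) xB by auto
        then show ?thesis using not_K[of y x] y C(2) by auto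
      qed (use C(5) True in auto)
    next
      case False
      then have xB: "x \<in> B" using x by auto
      have xN: "x \<in> space N" using xB BN sets.sets_into_space by blast
      show ?thesis
      proof (cases "x \<in> h ` C'")
        case True
        then obtain y where y: "y \<in> C'" "x = h y" by auto
        then have "y \<notin> K" using B(3) xB by auto
        then show ?thesis using not_K[of y x] y C'(2) by auto
      qed (use C'(5) False xN in auto)
    qed
  qed
  moreover have Ys: "Y \<in> sets a" unfolding Y_def using sets_Z by auto
  ultimately have "measure a ((E - B) \<union> (B - E)) \<le> measure a (Z \<union> Z' \<union> Y)"
    using C(3) C'(3) by (intro finite_measure_mono) auto
  also have "\<dots> \<le> measure a (Z \<union> Z') + measure a Y"
    using Ys C(3) C'(3) by (intro measure_subadditive) (auto simp: emeasure_eq_measure)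
  also have "measure a (Z \<union> Z') \<le> measure a Z + measure a Z'"
    using C(3) C'(3) by (intro measure_subadditive) (auto simp: emeasure_eq_measure)
  also have "measure a Y \<le> e / 2"
  proof -
    have le: "measure a (Z1 n \<union> Z2 n) \<le> e / 4 * (1 / 2) ^ n" for n
    proof -
      have "measure a (Z1 n \<union> Z2 n) \<le> measure a (Z1 n) + measure a (Z2 n)"
        using sets_Z[of n] by (intro measure_subadditive) (auto simp: emeasure_eq_measure)
      also have "\<dots> \<le> r n + r n" using small_Z[of n] by (intro add_mono) auto
      finally show ?thesis by (simp add: r_def)
    qed
    have sums: "(\<lambda>n. e / 4 * (1 / 2) ^ n) sums (e / 4 * (1 / (1 - 1 / 2)))"
      by (intro sums_mult geometric_sums) auto
    have summ: "summable (\<lambda>n. measure a (Z1 n \<union> Z2 n))"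
      by (rule summable_comparison_test'[OF sums_summable[OF sums]]) (use le in auto)
    have "measure a Y \<le> (\<Sum>n. measure a (Z1 n \<union> Z2 n))"
      unfolding Y_def using sets_Z by (intro finite_measure_subadditive_countably summ) auto
    also have "\<dots> \<le> (\<Sum>n. e / 4 * (1 / 2) ^ n)"
      by (intro suminf_le le summ sums_summable[OF sums])
    also have "\<dots> = e / 2" using sums by (simp add: sums_iff)
    finally show ?thesis .
  qed
  finally have "measure a ((E - B) \<union> (B - E)) < e" using C(4) C'(4) e by simp
  then show thesis using that B(1) by blast
qed

text \<open>The sum lets a single set approximate well for two measures at once.\<close>

lemma finite_measure_add:
  assumes "finite_measure a" "finite_measure b" "sets b = sets a"
  obtains c where "finite_measure c" "sets c = sets a"
    "\<And>A. A \<in> sets a \<Longrightarrow> emeasure c A = emeasure a A + emeasure b A"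
proof -
  define c where "c = measure_of (space a) (sets a) (\<lambda>A. emeasure a A + emeasure b A)"
  have sets_c: "sets c = sets a" unfolding c_def by simp
  have c: "emeasure c A = emeasure a A + emeasure b A" if "A \<in> sets a" for A
  proof (rule emeasure_measure_of[OF c_def])
    show "countably_additive (sets c) (\<lambda>A. emeasure a A + emeasure b A)"
      unfolding sets_c
    proof (rule countably_additiveI)
      fix F :: "nat \<Rightarrow> 'a set"
      assume "range F \<subseteq> sets a" "disjoint_family F" "\<Union>(range F) \<in> sets a"
      then show "(\<Sum>i. emeasure a (F i) + emeasure b (F i)) = emeasure a (\<Union>(range F)) + emeasure b (\<Union>(range F))"
        using assms(3) by (simp add: suminf_add[symmetric] suminf_emeasure)
    qed
  qed (use that sets_c sets.sets_into_space in \<open>auto simp: positive_def\<close>)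
  have "finite_measure c"
  proof
    have "space c = space a" "space b = space a"
      using sets_eq_imp_space_eq[OF sets_c] sets_eq_imp_space_eq[OF assms(3)] by simp_all
    then have "emeasure c (space c) = emeasure a (space a) + emeasure b (space b)" using c by simp
    then show "emeasure c (space c) \<noteq> \<infinity>"
      using finite_measure.emeasure_finite[OF assms(1)] finite_measure.emeasure_finite[OF assms(2)] by simp
  qed
  then show thesis using that sets_c c by blast
qed

section \<open>Total variation\<close>

lemma tv_norm_diff_ge:
  assumes "A \<in> sets \<alpha>"
  shows "ennreal \<bar>measure \<alpha> A - measure \<beta> A\<bar> \<le> tv_norm_diff \<alpha> \<beta>"
proof (cases "A = {}")
  case False
  \<comment> \<open>\<open>partition_on\<close> admits no empty block, and the complement of
    \<open>A\<close> may be empty.\<close>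
  define P where "P = {A, space \<alpha> - A} - {{}}"
  have "partition_on (space \<alpha>) P"
    using sets.sets_into_space[OF assms] unfolding P_def
    by (intro partition_onI) (auto simp: disjnt_def)
  moreover have "finite P" "P \<subseteq> sets \<alpha>" using assms by (auto simp: P_def)
  moreover have "ennreal \<bar>measure \<alpha> A - measure \<beta> A\<bar> \<le> (\<Sum>A\<in>P. ennreal \<bar>measure \<alpha> A - measure \<beta> A\<bar>)"
    using False \<open>finite P\<close> unfolding P_def by (intro member_le_sum) auto
  ultimately show ?thesis unfolding tv_norm_diff_def by (intro SUP_upper2[of P]) auto
qed simp

text \<open>A finite Hahn decomposition: the blocks of a partition on which \<open>\<alpha>\<close>
  dominates and the remaining ones form two measurable sets, each contributing at most
  \<open>c\<close>. This is the origin of the factor two between the norm and a supremum over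
  sets.\<close>

lemma tv_norm_diff_le:
  assumes fin: "finite_measure \<alpha>" "finite_measure \<beta>" and sets: "sets \<beta> = sets \<alpha>"
    and c: "\<And>A. A \<in> sets \<alpha> \<Longrightarrow> \<bar>measure \<alpha> A - measure \<beta> A\<bar> \<le> c"
  shows "tv_norm_diff \<alpha> \<beta> \<le> ennreal (2 * c)"
  unfolding tv_norm_diff_def
proof (rule SUP_least, clarify)
  fix P assume P: "finite P" "P \<subseteq> sets \<alpha>" "partition_on (space \<alpha>) P"
  interpret \<alpha>: finite_measure \<alpha> by fact
  interpret \<beta>: finite_measure \<beta> by fact
  define P1 where "P1 = {A\<in>P. measure \<beta> A \<le> measure \<alpha> A}"
  have un: "measure \<alpha> (\<Union>Q) = (\<Sum>A\<in>Q. measure \<alpha> A) \<and> measure \<beta> (\<Union>Q) = (\<Sum>A\<in>Q. measure \<beta> A) \<and> \<Union>Q \<in> sets \<alpha>"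
    if "Q \<subseteq> P" for Q
  proof -
    have "disjoint_family_on (\<lambda>A. A) Q"
      using partition_onD2[OF P(3)] that by (auto simp: disjoint_family_on_def disjoint_def)
    moreover have "finite Q" using that P(1) by (rule finite_subset)
    moreover have "\<Union>Q \<in> sets \<alpha>" using \<open>finite Q\<close> that P(2) by (intro sets.finite_Union) auto
    ultimately show ?thesis
      using \<alpha>.finite_measure_finite_Union[of Q "\<lambda>A. A"] \<beta>.finite_measure_finite_Union[of Q "\<lambda>A. A"] that P(2) sets
      by auto
  qed
  have "(\<Sum>A\<in>P. \<bar>measure \<alpha> A - measure \<beta> A\<bar>)
      = (\<Sum>A\<in>P1. \<bar>measure \<alpha> A - measure \<beta> A\<bar>) + (\<Sum>A\<in>P - P1. \<bar>measure \<alpha> A - measure \<beta> A\<bar>)"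
    using sum.subset_diff[of P1 P "\<lambda>A. \<bar>measure \<alpha> A - measure \<beta> A\<bar>"] P(1) unfolding P1_def by simp
  also have "(\<Sum>A\<in>P1. \<bar>measure \<alpha> A - measure \<beta> A\<bar>) = measure \<alpha> (\<Union>P1) - measure \<beta> (\<Union>P1)"
    using un[of P1] by (simp add: P1_def sum_subtractf[symmetric])
  also have "(\<Sum>A\<in>P - P1. \<bar>measure \<alpha> A - measure \<beta> A\<bar>) = (\<Sum>A\<in>P - P1. measure \<beta> A - measure \<alpha> A)"
    by (intro sum.cong) (auto simp: P1_def)
  also have "\<dots> = measure \<beta> (\<Union>(P - P1)) - measure \<alpha> (\<Union>(P - P1))"
    using un[of "P - P1"] by (simp add: sum_subtractf)
  also have "(measure \<alpha> (\<Union>P1) - measure \<beta> (\<Union>P1)) + (measure \<beta> (\<Union>(P - P1)) - measure \<alpha> (\<Union>(P - P1))) \<le> 2 * c"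
    using c[of "\<Union>P1"] c[of "\<Union>(P - P1)"] un[of P1] un[of "P - P1"] by (auto simp: P1_def)
  finally show "(\<Sum>A\<in>P. ennreal \<bar>measure \<alpha> A - measure \<beta> A\<bar>) \<le> ennreal (2 * c)"
    by (simp add: sum_ennreal ennreal_leI)
qed

lemma tv_norm_diff_commute:
  assumes "sets \<beta> = sets \<alpha>" shows "tv_norm_diff \<alpha> \<beta> = tv_norm_diff \<beta> \<alpha>"
  unfolding tv_norm_diff_def using sets_eq_imp_space_eq[OF assms] assms
  by (simp add: abs_minus_commute)

text \<open>The level sets of a simple function below \<open>u\<close> form a finite partition, so
  on them the two measures differ in total by at most the norm, and the weights are at most 1. This
  turns the norm into estimates against test functions, the form in which Markov operators can be
  iterated.\<close>

lemma nn_integral_le_tv_norm_diff: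
  assumes fin: "finite_measure \<alpha>" "finite_measure \<beta>" and sets: "sets \<beta> = sets \<alpha>"
    and u: "\<And>x. x \<in> space \<alpha> \<Longrightarrow> u x \<le> 1"
  shows "(\<integral>\<^sup>+x. u x \<partial>\<alpha>) \<le> (\<integral>\<^sup>+x. u x \<partial>\<beta>) + tv_norm_diff \<alpha> \<beta>"
  unfolding nn_integral_def[of \<alpha>]
proof (rule SUP_least, clarify)
  interpret \<alpha>: finite_measure \<alpha> by fact
  interpret \<beta>: finite_measure \<beta> by fact
  fix s assume s: "simple_function \<alpha> s" "s \<le> (\<lambda>x. u x)"
  have sp: "space \<beta> = space \<alpha>" using sets_eq_imp_space_eq[OF sets] .
  have s': "simple_function \<beta> s" using simple_function_cong_algebra[OF sets sp, THEN iffD1, OF s(1)] .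
  define V where "V y = s -` {y} \<inter> space \<alpha>" for y
  have V: "V y \<in> sets \<alpha>" for y unfolding V_def using s(1) by (rule simple_functionD)
  have fin_s: "finite (s ` space \<alpha>)" using s(1) by (rule simple_functionD)
  have le: "y * emeasure \<alpha> (V y) \<le> y * emeasure \<beta> (V y) + ennreal \<bar>measure \<alpha> (V y) - measure \<beta> (V y)\<bar>"
    if y: "y \<in> s ` space \<alpha>" for y
  proof -
    have y1: "y \<le> 1" using y u s(2) by (auto simp: le_fun_def intro: order_trans)
    have "emeasure \<alpha> (V y) \<le> emeasure \<beta> (V y) + ennreal \<bar>measure \<alpha> (V y) - measure \<beta> (V y)\<bar>"
      by (simp add: \<alpha>.emeasure_eq_measure \<beta>.emeasure_eq_measure ennreal_plus[symmetric] ennreal_leI del: ennreal_plus)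
    then have "y * emeasure \<alpha> (V y) \<le> y * emeasure \<beta> (V y) + y * ennreal \<bar>measure \<alpha> (V y) - measure \<beta> (V y)\<bar>"
      by (simp add: distrib_left[symmetric] mult_left_mono)
    also have "y * ennreal \<bar>measure \<alpha> (V y) - measure \<beta> (V y)\<bar> \<le> 1 * ennreal \<bar>measure \<alpha> (V y) - measure \<beta> (V y)\<bar>"
      using y1 by (intro mult_right_mono) auto
    finally show ?thesis by (simp add: add_left_mono)
  qed
  have "integral\<^sup>S \<alpha> s = (\<Sum>y\<in>s ` space \<alpha>. y * emeasure \<alpha> (V y))"
    by (simp add: simple_integral_def V_def)
  also have "\<dots> \<le> (\<Sum>y\<in>s ` space \<alpha>. y * emeasure \<beta> (V y)) + (\<Sum>y\<in>s ` space \<alpha>. ennreal \<bar>measure \<alpha> (V y) - measure \<beta> (V y)\<bar>)"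
    unfolding sum.distrib[symmetric] by (intro sum_mono le)
  also have "(\<Sum>y\<in>s ` space \<alpha>. y * emeasure \<beta> (V y)) = integral\<^sup>S \<beta> s"
    by (simp add: simple_integral_def V_def sp)
  also have "\<dots> = (\<integral>\<^sup>+x. s x \<partial>\<beta>)" using s' by (rule nn_integral_eq_simple_integral[symmetric])
  also have "\<dots> \<le> (\<integral>\<^sup>+x. u x \<partial>\<beta>)" using s(2) by (intro nn_integral_mono) (auto simp: le_fun_def)
  also have "(\<Sum>y\<in>s ` space \<alpha>. ennreal \<bar>measure \<alpha> (V y) - measure \<beta> (V y)\<bar>) \<le> tv_norm_diff \<alpha> \<beta>"
  proof -
    have "inj_on V (s ` space \<alpha>)" unfolding V_def by (rule inj_onI) blast
    then have "(\<Sum>y\<in>s ` space \<alpha>. ennreal \<bar>measure \<alpha> (V y) - measure \<beta> (V y)\<bar>)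
        = (\<Sum>A\<in>V ` s ` space \<alpha>. ennreal \<bar>measure \<alpha> A - measure \<beta> A\<bar>)"
      by (simp add: sum.reindex)
    also have "partition_on (space \<alpha>) (V ` s ` space \<alpha>)"
      by (rule partition_onI) (auto simp: V_def disjnt_def)
    then have "(\<Sum>A\<in>V ` s ` space \<alpha>. ennreal \<bar>measure \<alpha> A - measure \<beta> A\<bar>) \<le> tv_norm_diff \<alpha> \<beta>"
      unfolding tv_norm_diff_def using fin_s V by (intro SUP_upper) auto
    finally show ?thesis .
  qed
  finally show "integral\<^sup>S \<alpha> s \<le> (\<integral>\<^sup>+x. u x \<partial>\<beta>) + tv_norm_diff \<alpha> \<beta>"
    by (simp add: add_mono)
qed

text \<open>Each measurable set is approximated by a Boolean combination for
  \<open>\<alpha> + \<beta>\<close>, hence by the same one for both measures. The supremum over the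
  countable algebra therefore bounds the difference on all measurable sets.\<close>

lemma tv_norm_diff_le_boolean_combinations:
  fixes N :: "'a measure"
  assumes N: "lebesgue_rokhlin N" and prob: "prob_space \<alpha>" "prob_space \<beta>"
    and sets: "sets \<alpha> = sets N" "sets \<beta> = sets N"
    and ac: "absolutely_continuous N \<alpha>" "absolutely_continuous N \<beta>"
    and S: "countable S" "S \<subseteq> sets N"
    and sep: "\<And>x y. x \<in> space N \<Longrightarrow> y \<in> space N \<Longrightarrow> x \<noteq> y \<Longrightarrow> \<exists>A\<in>S. (x \<in> A) \<noteq> (y \<in> A)"
  shows "tv_norm_diff \<alpha> \<beta> \<le> 2 * (SUP A\<in>boolean_combinations (space N) S. ennreal \<bar>measure \<alpha> A - measure \<beta> A\<bar>)"
proof -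
  interpret \<alpha>: prob_space \<alpha> by fact
  interpret \<beta>: prob_space \<beta> by fact
  let ?s = "SUP A\<in>boolean_combinations (space N) S. ennreal \<bar>measure \<alpha> A - measure \<beta> A\<bar>"
  have "?s \<le> ennreal 1"
  proof (rule SUP_least, rule ennreal_leI)
    fix A show "\<bar>measure \<alpha> A - measure \<beta> A\<bar> \<le> 1"
      using \<alpha>.prob_le_1[of A] \<beta>.prob_le_1[of A] measure_nonneg[of \<alpha> A] measure_nonneg[of \<beta> A] by linarith
  qed
  then obtain c where c: "?s = ennreal c" "c \<ge> 0" by (cases ?s) (auto simp: top_unique)
  obtain \<gamma> where \<gamma>: "finite_measure \<gamma>" "sets \<gamma> = sets \<alpha>"
      "\<And>A. A \<in> sets \<alpha> \<Longrightarrow> emeasure \<gamma> A = emeasure \<alpha> A + emeasure \<beta> A"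
    by (rule finite_measure_add[of \<alpha> \<beta>]) (use sets \<alpha>.finite_measure_axioms \<beta>.finite_measure_axioms in auto)
  interpret \<gamma>: finite_measure \<gamma> by fact
  have m\<gamma>: "measure \<gamma> A = measure \<alpha> A + measure \<beta> A" if "A \<in> sets N" for A
    using \<gamma>(3)[of A] that sets
    by (simp add: \<alpha>.emeasure_eq_measure \<beta>.emeasure_eq_measure \<gamma>.emeasure_eq_measure ennreal_plus[symmetric] del: ennreal_plus)
  have ac\<gamma>: "absolutely_continuous N \<gamma>"
    unfolding absolutely_continuous_def
  proof
    fix A assume "A \<in> null_sets N"
    then have "A \<in> null_sets \<alpha>" "A \<in> null_sets \<beta>" using ac unfolding absolutely_continuous_def by auto
    then show "A \<in> null_sets \<gamma>" using \<gamma> by (auto simp: null_sets_def)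
  qed
  have "\<bar>measure \<alpha> E - measure \<beta> E\<bar> \<le> c + e" if E: "E \<in> sets N" and e: "e > 0" for E e
  proof -
    obtain B where B: "B \<in> boolean_combinations (space N) S" "measure \<gamma> ((E - B) \<union> (B - E)) < e"
      using lebesgue_rokhlin_separating_approx[OF N \<gamma>(1) _ ac\<gamma> S sep E e] \<gamma>(2) sets by metis
    have BN: "B \<in> sets N" using B(1) boolean_combinations_sets[OF S(2)] by auto
    have "ennreal \<bar>measure \<alpha> B - measure \<beta> B\<bar> \<le> ?s" using B(1) by (rule SUP_upper)
    then have Bc: "\<bar>measure \<alpha> B - measure \<beta> B\<bar> \<le> c" using c by simp
    have diff: "\<bar>measure \<nu> E - measure \<nu> B\<bar> \<le> measure \<nu> ((E - B) \<union> (B - E))"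
      if "finite_measure \<nu>" "sets \<nu> = sets N" for \<nu> :: "'a measure"
    proof -
      interpret \<nu>: finite_measure \<nu> by fact
      have 1: "measure \<nu> E \<le> measure \<nu> B + measure \<nu> ((E - B) \<union> (B - E))"
        using that BN E by (intro order_trans[OF \<nu>.finite_measure_mono measure_Un_le]) auto
      have 2: "measure \<nu> B \<le> measure \<nu> E + measure \<nu> ((E - B) \<union> (B - E))"
        using that BN E by (intro order_trans[OF \<nu>.finite_measure_mono measure_Un_le]) auto
      show ?thesis using 1 2 by linarith
    qed
    have "measure \<alpha> ((E - B) \<union> (B - E)) + measure \<beta> ((E - B) \<union> (B - E)) < e"
      using B(2) m\<gamma>[of "(E - B) \<union> (B - E)"] E BN by auto
    then show ?thesis
      using diff[OF \<alpha>.finite_measure_axioms sets(1)] diff[OF \<beta>.finite_measure_axioms sets(2)] Bc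
      by (simp only: abs_le_iff) linarith
  qed
  then have "\<bar>measure \<alpha> E - measure \<beta> E\<bar> \<le> c" if "E \<in> sets \<alpha>" for E
    by (rule field_le_epsilon) (use that in \<open>simp only: sets(1)\<close>)
  then have "tv_norm_diff \<alpha> \<beta> \<le> ennreal (2 * c)"
    using sets by (intro tv_norm_diff_le \<alpha>.finite_measure_axioms \<beta>.finite_measure_axioms) auto
  then show ?thesis using c by (simp add: ennreal_mult')
qed

section \<open>Markov operators on functions\<close>

definition kernel_op :: "('a \<Rightarrow> 'b measure) \<Rightarrow> ('b \<Rightarrow> ennreal) \<Rightarrow> 'a \<Rightarrow> ennreal" where
  "kernel_op \<pi> f g = (\<integral>\<^sup>+h. f h \<partial>\<pi> g)"

lemma kernel_op_measurable:
  assumes "\<pi> \<in> M \<rightarrow>\<^sub>M prob_algebra N" "f \<in> borel_measurable N"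
  shows "kernel_op \<pi> f \<in> borel_measurable M"
  unfolding kernel_op_def
  by (rule measurable_compose[OF measurable_prob_algebraD[OF assms(1)] nn_integral_measurable_subprob_algebra[OF assms(2)]])

lemma prob_kernelD:
  assumes "\<pi> \<in> M \<rightarrow>\<^sub>M prob_algebra N" "g \<in> space M"
  shows "prob_space (\<pi> g)" "sets (\<pi> g) = sets N" "space (\<pi> g) = space N"
  using measurable_space[OF assms] sets_eq_imp_space_eq[of "\<pi> g" N] by (auto simp: space_prob_algebra)

lemma kernel_op_le_const:
  assumes \<pi>: "\<pi> \<in> M \<rightarrow>\<^sub>M prob_algebra N" and g: "g \<in> space M" and f: "\<And>h. h \<in> space N \<Longrightarrow> f h \<le> c"
  shows "kernel_op \<pi> f g \<le> c"
proof -
  interpret prob_space "\<pi> g" using prob_kernelD[OF \<pi> g] by simp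
  show ?thesis unfolding kernel_op_def
    by (rule nn_integral_le_const) (use f prob_kernelD[OF \<pi> g] in auto)
qed

definition geom_weight :: "nat \<Rightarrow> ennreal" where
  "geom_weight k = ennreal ((1 / 2) ^ Suc k)"

text \<open>The convex combination of the \<open>Q k\<close> with weights
  \<open>geom_weight k\<close>. The geometric distribution gives \<open>k\<close> the mass
  \<open>(1 / 2) ^ Suc k\<close>, and a \<open>bind\<close> over it is a measure from the
  outset.\<close>

definition geom_mixture :: "(nat \<Rightarrow> 'a \<Rightarrow> 'b measure) \<Rightarrow> 'a \<Rightarrow> 'b measure" where
  "geom_mixture Q g = bind (measure_pmf (geometric_pmf (1 / 2))) (\<lambda>k. Q k g)"

lemma pmf_geom_weight: "ennreal (pmf (geometric_pmf (1 / 2)) k) = geom_weight k"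
  by (simp add: geom_weight_def)

lemma suminf_geom_weight: "(\<Sum>k. geom_weight k) = 1"
proof -
  have "(\<lambda>k. (1 / 2 :: real) ^ Suc k) sums 1" by (rule power_half_series)
  then have "(\<Sum>k. ennreal ((1 / 2) ^ Suc k)) = ennreal 1" by (rule suminf_ennreal_eq[rotated]) simp
  then show ?thesis by (simp add: geom_weight_def)
qed

lemma sum_geom_weight: "(\<Sum>k<m. geom_weight k) = ennreal (1 - (1 / 2) ^ m)"
proof -
  have "(\<Sum>k<m. (1 / 2 :: real) ^ Suc k) = 1 - (1 / 2) ^ m" by (induction m) (auto simp: field_simps)
  then show ?thesis unfolding geom_weight_def by (subst sum_ennreal) auto
qed

lemma nn_integral_geom_mixture:
  assumes Q: "\<And>k. Q k \<in> M \<rightarrow>\<^sub>M prob_algebra N" and g: "g \<in> space M" and f: "f \<in> borel_measurable N"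
  shows "(\<integral>\<^sup>+h. f h \<partial>geom_mixture Q g) = (\<Sum>k. geom_weight k * (\<integral>\<^sup>+h. f h \<partial>Q k g))"
proof -
  have "(\<lambda>k. Q k g) \<in> measure_pmf (geometric_pmf (1 / 2)) \<rightarrow>\<^sub>M subprob_algebra N"
    using measurable_space[OF measurable_prob_algebraD[OF Q] g] by auto
  then have "(\<integral>\<^sup>+h. f h \<partial>geom_mixture Q g) = (\<integral>\<^sup>+k. (\<integral>\<^sup>+h. f h \<partial>Q k g) \<partial>measure_pmf (geometric_pmf (1 / 2)))"
    unfolding geom_mixture_def by (rule nn_integral_bind[OF f])
  also have "\<dots> = (\<integral>\<^sup>+k. geom_weight k * (\<integral>\<^sup>+h. f h \<partial>Q k g) \<partial>count_space UNIV)"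
    unfolding nn_integral_measure_pmf pmf_geom_weight ..
  finally show ?thesis by (simp add: nn_integral_count_space_nat)
qed

lemma sets_geom_mixture:
  assumes Q: "\<And>k. Q k \<in> M \<rightarrow>\<^sub>M prob_algebra N" and g: "g \<in> space M"
  shows "sets (geom_mixture Q g) = sets N"
  unfolding geom_mixture_def by (rule sets_bind) (use prob_kernelD[OF Q g] in auto)

lemma emeasure_geom_mixture:
  assumes Q: "\<And>k. Q k \<in> M \<rightarrow>\<^sub>M prob_algebra N" and g: "g \<in> space M" and A: "A \<in> sets N"
  shows "emeasure (geom_mixture Q g) A = (\<Sum>k. geom_weight k * emeasure (Q k g) A)"
  using nn_integral_geom_mixture[OF Q g, of "indicator A"] A sets_geom_mixture[OF Q g] prob_kernelD(2)[OF Q g]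
  by simp

lemma geom_mixture_measurable:
  assumes Q: "\<And>k. Q k \<in> M \<rightarrow>\<^sub>M prob_algebra N"
  shows "geom_mixture Q \<in> M \<rightarrow>\<^sub>M prob_algebra N"
proof (rule measurable_prob_algebraI)
  show prob: "prob_space (geom_mixture Q g)" if g: "g \<in> space M" for g
  proof
    have "space (geom_mixture Q g) = space N" using sets_eq_imp_space_eq[OF sets_geom_mixture[OF Q g]] .
    moreover have "emeasure (Q k g) (space N) = 1" for k
      using prob_space.emeasure_space_1[OF prob_kernelD(1)[OF Q g]] prob_kernelD(3)[OF Q g] by simp
    ultimately show "emeasure (geom_mixture Q g) (space (geom_mixture Q g)) = 1"
      by (simp add: emeasure_geom_mixture[OF Q g] suminf_geom_weight)
  qed
  show "geom_mixture Q \<in> M \<rightarrow>\<^sub>M subprob_algebra N"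
  proof (rule measurable_subprob_algebra)
    fix A assume A: "A \<in> sets N"
    have [measurable]: "(\<lambda>g. emeasure (Q k g) A) \<in> borel_measurable M" for k
      by (rule measurable_compose[OF measurable_prob_algebraD[OF Q] measurable_emeasure_subprob_algebra[OF A]])
    have "(\<lambda>g. \<Sum>k. geom_weight k * emeasure (Q k g) A) \<in> borel_measurable M" by measurable
    then show "(\<lambda>g. emeasure (geom_mixture Q g) A) \<in> borel_measurable M"
      by (rule measurable_cong[THEN iffD1, rotated]) (simp add: emeasure_geom_mixture[OF Q _ A])
  qed (use prob sets_geom_mixture[OF Q] in \<open>auto intro: prob_space_imp_subprob_space\<close>)
qed

section \<open>Asymptotic invariance of powers of a mixture\<close>

text \<open>What the mixture argument uses of a groupoid. \<open>e g\<close> will be the unit at the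
  target of \<open>g\<close>, and \<open>d k g\<close> a measurable bound for the variation distance
  of \<open>Q k g\<close> and \<open>Q k (e g)\<close>, expressed by duality against test functions.
  \<open>Q_fibre\<close> says that a step stays in its fibre. \<open>Q_null\<close> carries the
  absolute continuity: a property valid almost everywhere is also valid almost surely for
  \<open>Q k g\<close> and \<open>Q k (e g)\<close>, for almost every \<open>g\<close>. The limit at
  \<open>e g\<close> is a separate assumption because \<open>e\<close> may map into a null
  set.\<close>

locale asymptotically_invariant_kernels =
  fixes M \<mu> :: "'a measure" and e :: "'a \<Rightarrow> 'a" and Q :: "nat \<Rightarrow> 'a \<Rightarrow> 'a measure"
    and d :: "nat \<Rightarrow> 'a \<Rightarrow> ennreal"
  assumes finite_\<mu>: "finite_measure \<mu>" and sets_\<mu>: "sets \<mu> = sets M"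
    and e_measurable: "e \<in> M \<rightarrow>\<^sub>M M" and e_e: "g \<in> space M \<Longrightarrow> e (e g) = e g"
    and Q: "Q k \<in> M \<rightarrow>\<^sub>M prob_algebra M"
    and Q_fibre: "g \<in> space M \<Longrightarrow> AE h in Q k g. e h = e g"
    and Q_null: "A \<in> null_sets \<mu> \<Longrightarrow> AE g in \<mu>. emeasure (Q k g) A = 0 \<and> emeasure (Q k (e g)) A = 0"
    and d_measurable: "d k \<in> borel_measurable M" and d_le: "g \<in> space M \<Longrightarrow> d k g \<le> 2"
    and d_upper: "g \<in> space M \<Longrightarrow> u \<in> borel_measurable M \<Longrightarrow> (\<And>h. h \<in> space M \<Longrightarrow> u h \<le> 1) \<Longrightarrow>
       kernel_op (Q k) u g \<le> kernel_op (Q k) u (e g) + d k g"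
    and d_lower: "g \<in> space M \<Longrightarrow> u \<in> borel_measurable M \<Longrightarrow> (\<And>h. h \<in> space M \<Longrightarrow> u h \<le> 1) \<Longrightarrow>
       kernel_op (Q k) u (e g) \<le> kernel_op (Q k) u g + d k g"
    and d_lim: "AE g in \<mu>. (\<lambda>k. d k g) \<longlonglongrightarrow> 0" "AE g in \<mu>. (\<lambda>k. d k (e g)) \<longlonglongrightarrow> 0"
begin

lemma e_space: "g \<in> space M \<Longrightarrow> e g \<in> space M"
  using measurable_space[OF e_measurable] .

lemma space_\<mu>: "space \<mu> = space M"
  using sets_eq_imp_space_eq[OF sets_\<mu>] .

lemma borel_\<mu>: "borel_measurable \<mu> = borel_measurable M"
  by (rule measurable_cong_sets[OF sets_\<mu> refl])

text \<open>\<open>A\<close> of the overview as an operator on functions. It depends on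
  \<open>\<sigma>\<close> only through the values below \<open>m\<close>.\<close>

definition head :: "(nat \<Rightarrow> nat) \<Rightarrow> nat \<Rightarrow> ('a \<Rightarrow> ennreal) \<Rightarrow> 'a \<Rightarrow> ennreal" where
  "head \<sigma> m f g = (\<Sum>k<m. geom_weight k * kernel_op (Q (\<sigma> k)) f g)"

text \<open>A bound for the defect of \<open>B\<close>, the part of the mixture from index
  \<open>m\<close> on.\<close>

definition tail_defect :: "(nat \<Rightarrow> nat) \<Rightarrow> nat \<Rightarrow> 'a \<Rightarrow> ennreal" where
  "tail_defect \<sigma> m g = (\<Sum>k. geom_weight (k + m) * d (\<sigma> (k + m)) g)"

text \<open>This is \<open>1 - (1 / 2) ^ m\<close> for every \<open>\<sigma>\<close>. Being below 1,
  it makes the powers of the head decay at a rate known before \<open>\<sigma>\<close> is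
  chosen.\<close>

definition head_mass :: "nat \<Rightarrow> ennreal" where
  "head_mass m = (\<Sum>k<m. geom_weight k)"

lemma head_measurable:
  assumes "f \<in> borel_measurable M" shows "head \<sigma> m f \<in> borel_measurable M"
proof -
  have [measurable]: "kernel_op (Q k) f \<in> borel_measurable M" for k using Q assms by (rule kernel_op_measurable)
  show ?thesis unfolding head_def by measurable
qed

lemma head_power_measurable:
  assumes "f \<in> borel_measurable M" shows "(head \<sigma> m ^^ i) f \<in> borel_measurable M"
  by (induction i) (auto intro: assms head_measurable)

lemma tail_defect_measurable: "tail_defect \<sigma> m \<in> borel_measurable M"
proof -
  note d_measurable[measurable]
  show ?thesis unfolding tail_defect_def by measurable
qed

lemma head_cong:
  assumes "g \<in> space M" "\<And>h. h \<in> space M \<Longrightarrow> f h = f' h" shows "head \<sigma> m f g = head \<sigma> m f' g"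
  unfolding head_def kernel_op_def
  by (intro sum.cong refl arg_cong2[where f="(*)"] nn_integral_cong) (use assms prob_kernelD(3)[OF Q] in auto)

lemma head_const:
  assumes "g \<in> space M" shows "head \<sigma> m (\<lambda>_. c) g = head_mass m * c"
proof -
  have "kernel_op (Q k) (\<lambda>_. c) g = c" for k
    using prob_space.emeasure_space_1[OF prob_kernelD(1)[OF Q assms]] by (simp add: kernel_op_def)
  then show ?thesis by (simp add: head_def head_mass_def sum_distrib_right)
qed

lemma head_add:
  assumes "g \<in> space M" "f \<in> borel_measurable M" "f' \<in> borel_measurable M"
  shows "head \<sigma> m (\<lambda>h. f h + f' h) g = head \<sigma> m f g + head \<sigma> m f' g"
proof -
  have "f \<in> borel_measurable (Q k g)" "f' \<in> borel_measurable (Q k g)" for k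
    using assms(2,3) measurable_cong_sets[OF prob_kernelD(2)[OF Q assms(1)] refl] by auto
  then show ?thesis
    by (simp add: head_def kernel_op_def nn_integral_add distrib_left sum.distrib)
qed

lemma head_sum:
  assumes "g \<in> space M" "\<And>i. f i \<in> borel_measurable M"
  shows "head \<sigma> m (\<lambda>h. \<Sum>i<n. f i h) g = (\<Sum>i<(n::nat). head \<sigma> m (f i) g)"
proof (induction n)
  case 0
  show ?case using head_const[OF assms(1), of \<sigma> m 0] by simp
next
  case (Suc n)
  then show ?case using assms by (simp add: head_add)
qed

lemma head_suminf:
  assumes "g \<in> space M" "\<And>i. f i \<in> borel_measurable M"
  shows "head \<sigma> m (\<lambda>h. \<Sum>i. c i * f i h) g = (\<Sum>i. c i * head \<sigma> m (f i) g)"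
proof -
  have [measurable]: "f i \<in> borel_measurable (Q k g)" for i k
    using assms(2) measurable_cong_sets[OF prob_kernelD(2)[OF Q assms(1)] refl] by auto
  have "kernel_op (Q k) (\<lambda>h. \<Sum>i. c i * f i h) g = (\<Sum>i. c i * kernel_op (Q k) (f i) g)" for k
    unfolding kernel_op_def by (subst nn_integral_suminf) (auto simp: nn_integral_cmult)
  then have "head \<sigma> m (\<lambda>h. \<Sum>i. c i * f i h) g
      = (\<Sum>k<m. \<Sum>i. geom_weight k * (c i * kernel_op (Q (\<sigma> k)) (f i) g))"
    by (simp add: head_def ennreal_suminf_cmult)
  also have "\<dots> = (\<Sum>i. \<Sum>k<m. geom_weight k * (c i * kernel_op (Q (\<sigma> k)) (f i) g))"
    by (intro suminf_sum[symmetric]) auto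
  finally show ?thesis by (simp add: head_def sum_distrib_left mult_ac)
qed

text \<open>Separates the contributions of the indices from \<open>m\<close> on, so that each can be
  made small through the choice of a single value of \<open>\<sigma>\<close>.\<close>

lemma head_power_tail_defect:
  assumes "g \<in> space M"
  shows "(head \<sigma> m ^^ i) (tail_defect \<sigma> m) g
    = (\<Sum>k. geom_weight (k + m) * (head \<sigma> m ^^ i) (d (\<sigma> (k + m))) g)"
  using assms
proof (induction i arbitrary: g)
  case (Suc i)
  have "(head \<sigma> m ^^ Suc i) (tail_defect \<sigma> m) g
      = head \<sigma> m (\<lambda>g. \<Sum>k. geom_weight (k + m) * (head \<sigma> m ^^ i) (d (\<sigma> (k + m))) g) g"
    using Suc by (auto intro: head_cong)
  also have "\<dots> = (\<Sum>k. geom_weight (k + m) * head \<sigma> m ((head \<sigma> m ^^ i) (d (\<sigma> (k + m)))) g)"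
    by (intro head_suminf Suc head_power_measurable d_measurable)
  finally show ?case by simp
qed (simp add: tail_defect_def)

text \<open>Bounds the distance from a function of \<open>e g\<close> to the \<open>n\<close>-th
  power of the mixture applied to a test function: \<open>head_mass m ^ n\<close> for the paths
  without \<open>B\<close>, and one summand for each position \<open>i\<close> of the first
  \<open>B\<close>.\<close>

definition deviation :: "(nat \<Rightarrow> nat) \<Rightarrow> nat \<Rightarrow> nat \<Rightarrow> 'a \<Rightarrow> ennreal" where
  "deviation \<sigma> m n g = head_mass m ^ n + (\<Sum>i<n. (head \<sigma> m ^^ i) (tail_defect \<sigma> m) g)"

lemma deviation_measurable: "deviation \<sigma> m n \<in> borel_measurable M"
proof -
  note head_power_measurable[OF tail_defect_measurable, measurable]
  show ?thesis unfolding deviation_def by measurable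
qed

text \<open>The recursion behind the induction below: one more \<open>A\<close> in front of
  everything, plus the paths that begin with \<open>B\<close>.\<close>

lemma deviation_Suc:
  assumes "g \<in> space M"
  shows "deviation \<sigma> m (Suc n) g = head \<sigma> m (deviation \<sigma> m n) g + tail_defect \<sigma> m g"
proof -
  have "head \<sigma> m (deviation \<sigma> m n) g = head_mass m * head_mass m ^ n
      + (\<Sum>i<n. head \<sigma> m ((head \<sigma> m ^^ i) (tail_defect \<sigma> m)) g)"
    unfolding deviation_def[abs_def] using assms
    by (subst head_add)
      (auto intro!: borel_measurable_sum head_power_measurable tail_defect_measurable simp: head_const head_sum head_power_measurable tail_defect_measurable)
  then show ?thesis
    unfolding deviation_def[of \<sigma> m "Suc n"] sum.lessThan_Suc_shift by (simp add: add_ac)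
qed

lemma mixture_measurable: "geom_mixture (\<lambda>k. Q (\<sigma> k)) \<in> M \<rightarrow>\<^sub>M prob_algebra M"
  by (rule geom_mixture_measurable) (rule Q)

abbreviation mixture_op :: "(nat \<Rightarrow> nat) \<Rightarrow> ('a \<Rightarrow> ennreal) \<Rightarrow> 'a \<Rightarrow> ennreal" where
  "mixture_op \<sigma> \<equiv> kernel_op (geom_mixture (\<lambda>k. Q (\<sigma> k)))"

lemma mixture_op_split:
  assumes "g \<in> space M" "f \<in> borel_measurable M"
  shows "mixture_op \<sigma> f g = head \<sigma> m f g + (\<Sum>k. geom_weight (k + m) * kernel_op (Q (\<sigma> (k + m))) f g)"
proof -
  have "mixture_op \<sigma> f g = (\<Sum>k. geom_weight k * kernel_op (Q (\<sigma> k)) f g)"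
    unfolding kernel_op_def by (rule nn_integral_geom_mixture[OF Q assms])
  also have "\<dots> = (\<Sum>k. geom_weight (k + m) * kernel_op (Q (\<sigma> (k + m))) f g)
      + (\<Sum>k<m. geom_weight k * kernel_op (Q (\<sigma> k)) f g)"
    by (rule suminf_offset) auto
  finally show ?thesis by (simp add: head_def add.commute)
qed

lemma mixture_op_power:
  assumes "u \<in> borel_measurable M" "\<And>h. h \<in> space M \<Longrightarrow> u h \<le> 1"
  shows "(mixture_op \<sigma> ^^ n) u \<in> borel_measurable M" "g \<in> space M \<Longrightarrow> (mixture_op \<sigma> ^^ n) u g \<le> 1"
proof -
  have "(mixture_op \<sigma> ^^ n) u \<in> borel_measurable M \<and> (\<forall>g\<in>space M. (mixture_op \<sigma> ^^ n) u g \<le> 1)"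
    by (induction n)
      (auto intro: assms kernel_op_measurable[OF mixture_measurable] kernel_op_le_const[OF mixture_measurable])
  then show "(mixture_op \<sigma> ^^ n) u \<in> borel_measurable M" "g \<in> space M \<Longrightarrow> (mixture_op \<sigma> ^^ n) u g \<le> 1" by auto
qed

lemma tail_defect_bound:
  fixes \<sigma> :: "nat \<Rightarrow> nat" and m :: nat
  assumes v: "v \<in> borel_measurable M" "\<And>h. h \<in> space M \<Longrightarrow> v h \<le> 1" and g: "g \<in> space M"
  defines "B \<equiv> \<lambda>g. \<Sum>k. geom_weight (k + m) * kernel_op (Q (\<sigma> (k + m))) v g"
  shows "B g \<le> B (e g) + tail_defect \<sigma> m g" "B (e g) \<le> B g + tail_defect \<sigma> m g"
proof -
  show "B g \<le> B (e g) + tail_defect \<sigma> m g"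
    unfolding B_def tail_defect_def
    by (subst suminf_add, simp_all, intro suminf_le)
      (auto simp: distrib_left[symmetric] intro!: mult_left_mono d_upper g v)
  show "B (e g) \<le> B g + tail_defect \<sigma> m g"
    unfolding B_def tail_defect_def
    by (subst suminf_add, simp_all, intro suminf_le)
      (auto simp: distrib_left[symmetric] intro!: mult_left_mono d_lower g v)
qed

text \<open>Under \<open>Q k g\<close> almost every \<open>h\<close> satisfies
  \<open>e h = e g\<close>, so the head sees a function of \<open>e h\<close> as a constant and
  merely multiplies it by \<open>head_mass m\<close>.\<close>

lemma head_bound:
  assumes g: "g \<in> space M" and w: "w \<in> borel_measurable M" and v: "v \<in> borel_measurable M"
    and b: "\<And>h. h \<in> space M \<Longrightarrow> v h \<le> c (e h) + w h" "\<And>h. h \<in> space M \<Longrightarrow> c (e h) \<le> v h + w h"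
  shows "head \<sigma> m v g \<le> head_mass m * c (e g) + head \<sigma> m w g"
    "head_mass m * c (e g) \<le> head \<sigma> m v g + head \<sigma> m w g"
proof -
  have ae: "AE h in Q k g. h \<in> space M \<and> e h = e g" for k
    using Q_fibre[OF g, of k] prob_kernelD(3)[OF Q g, of k] AE_space[of "Q k g"] by auto
  have ae1: "AE h in Q k g. v h \<le> c (e g) + w h" for k
    using ae[of k] by eventually_elim (use b(1) in metis)
  have ae2: "AE h in Q k g. c (e g) \<le> v h + w h" for k
    using ae[of k] by eventually_elim (use b(2) in metis)
  have "head \<sigma> m v g \<le> head \<sigma> m (\<lambda>h. c (e g) + w h) g"
    unfolding head_def kernel_op_def
    by (intro sum_mono mult_left_mono nn_integral_mono_AE ae1) auto
  then show "head \<sigma> m v g \<le> head_mass m * c (e g) + head \<sigma> m w g"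
    using g w by (simp add: head_add head_const)
  have "head \<sigma> m (\<lambda>_. c (e g)) g \<le> head \<sigma> m (\<lambda>h. v h + w h) g"
    unfolding head_def kernel_op_def
    by (intro sum_mono mult_left_mono nn_integral_mono_AE ae2) auto
  then show "head_mass m * c (e g) \<le> head \<sigma> m v g + head \<sigma> m w g"
    using g w v by (simp add: head_add head_const)
qed

text \<open>With \<open>v\<close> the previous power applied to \<open>u\<close>, the next one is
  \<open>A v + B v\<close>. \<open>A\<close> maps functions of \<open>e\<close> to functions of
  \<open>e\<close>, and \<open>B v\<close> is such a function up to \<open>tail_defect\<close>. The
  function \<open>c\<close> may depend on \<open>u\<close>, but the error does not.\<close>

lemma mixture_power_near_constant:
  assumes u: "u \<in> borel_measurable M" "\<And>h. h \<in> space M \<Longrightarrow> u h \<le> 1"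
  shows "\<exists>c. \<forall>g\<in>space M. (mixture_op \<sigma> ^^ n) u g \<le> c (e g) + deviation \<sigma> m n g \<and>
    c (e g) \<le> (mixture_op \<sigma> ^^ n) u g + deviation \<sigma> m n g"
proof (induction n)
  case 0
  \<comment> \<open>\<open>deviation\<close> has the value 1 for zero steps, so the constant 0 is
    close enough to any test function.\<close>
  show ?case using u(2) by (intro exI[of _ "\<lambda>_. 0"]) (simp add: deviation_def)
next
  case (Suc n)
  define v where "v = (mixture_op \<sigma> ^^ n) u"
  from Suc obtain c where c: "\<And>g. g \<in> space M \<Longrightarrow> v g \<le> c (e g) + deviation \<sigma> m n g"
      "\<And>g. g \<in> space M \<Longrightarrow> c (e g) \<le> v g + deviation \<sigma> m n g" unfolding v_def by blast
  have v: "v \<in> borel_measurable M" "\<And>h. h \<in> space M \<Longrightarrow> v h \<le> 1"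
    unfolding v_def using mixture_op_power[OF u] by auto
  define B where "B g = (\<Sum>k. geom_weight (k + m) * kernel_op (Q (\<sigma> (k + m))) v g)" for g
  have B: "B g \<le> B (e g) + tail_defect \<sigma> m g" "B (e g) \<le> B g + tail_defect \<sigma> m g" if "g \<in> space M" for g
    unfolding B_def using tail_defect_bound[OF v that] by auto
  have split: "(mixture_op \<sigma> ^^ Suc n) u g = head \<sigma> m v g + B g" if "g \<in> space M" for g
    using mixture_op_split[OF that v(1)] by (simp add: v_def B_def)
  show ?case
  \<comment> \<open>The argument \<open>x\<close> stands for \<open>e g\<close>: the head multiplies
    \<open>c\<close> by its mass, and \<open>B\<close> is replaced by its value at the unit.\<close>
  proof (intro exI[of _ "\<lambda>x. head_mass m * c x + B x"] ballI conjI)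
    fix g assume g: "g \<in> space M"
    note head = head_bound[OF g deviation_measurable v(1) c, where \<sigma>=\<sigma> and m=m]
    show "(mixture_op \<sigma> ^^ Suc n) u g \<le> head_mass m * c (e g) + B (e g) + deviation \<sigma> m (Suc n) g"
      using add_mono[OF head(1) B(1)[OF g]] unfolding split[OF g] deviation_Suc[OF g] by (simp add: add_ac)
    show "head_mass m * c (e g) + B (e g) \<le> (mixture_op \<sigma> ^^ Suc n) u g + deviation \<sigma> m (Suc n) g"
      using add_mono[OF head(2) B(2)[OF g]] unfolding split[OF g] deviation_Suc[OF g] by (simp add: add_ac)
  qed
qed

text \<open>Only the first \<open>N\<close> steps matter: the remaining \<open>n - N\<close> turn
  \<open>u\<close> into another test function bounded by 1. The values at \<open>g\<close> and at
  \<open>e g\<close> are both compared with \<open>c (e g)\<close>, as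
  \<open>e (e g) = e g\<close>.\<close>

lemma mixture_power_defect:
  assumes u: "u \<in> borel_measurable M" "\<And>h. h \<in> space M \<Longrightarrow> u h \<le> 1" and g: "g \<in> space M" and n: "N \<le> n"
  shows "(mixture_op \<sigma> ^^ n) u g \<le> (mixture_op \<sigma> ^^ n) u (e g) + (deviation \<sigma> m N g + deviation \<sigma> m N (e g))"
    "(mixture_op \<sigma> ^^ n) u (e g) \<le> (mixture_op \<sigma> ^^ n) u g + (deviation \<sigma> m N g + deviation \<sigma> m N (e g))"
proof -
  define v where "v = (mixture_op \<sigma> ^^ (n - N)) u"
  have v: "v \<in> borel_measurable M" "\<And>h. h \<in> space M \<Longrightarrow> v h \<le> 1"
    unfolding v_def using mixture_op_power[OF u] by auto
  have eq: "(mixture_op \<sigma> ^^ n) u = (mixture_op \<sigma> ^^ N) v"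
    unfolding v_def using n by (metis comp_apply funpow_add le_add_diff_inverse)
  obtain c where c: "\<And>g. g \<in> space M \<Longrightarrow> (mixture_op \<sigma> ^^ N) v g \<le> c (e g) + deviation \<sigma> m N g"
      "\<And>g. g \<in> space M \<Longrightarrow> c (e g) \<le> (mixture_op \<sigma> ^^ N) v g + deviation \<sigma> m N g"
    using mixture_power_near_constant[OF v] by blast
  note eg = e_space[OF g]
  show "(mixture_op \<sigma> ^^ n) u g \<le> (mixture_op \<sigma> ^^ n) u (e g) + (deviation \<sigma> m N g + deviation \<sigma> m N (e g))"
    unfolding eq using order_trans[OF c(1)[OF g] add_right_mono[OF c(2)[OF eg, unfolded e_e[OF g]]]]
    by (simp add: add_ac)
  show "(mixture_op \<sigma> ^^ n) u (e g) \<le> (mixture_op \<sigma> ^^ n) u g + (deviation \<sigma> m N g + deviation \<sigma> m N (e g))"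
    unfolding eq using order_trans[OF c(1)[OF eg, unfolded e_e[OF g]] add_right_mono[OF c(2)[OF g]]]
    by (simp add: add_ac)
qed

section \<open>Dominated convergence and the choice of the subsequence\<close>

definition vanishing :: "(nat \<Rightarrow> 'a \<Rightarrow> ennreal) \<Rightarrow> bool" where
  "vanishing F \<longleftrightarrow> (\<forall>n. F n \<in> borel_measurable M \<and> (\<forall>g\<in>space M. F n g \<le> 2)) \<and>
     (AE g in \<mu>. (\<lambda>n. F n g) \<longlonglongrightarrow> 0) \<and> (AE g in \<mu>. (\<lambda>n. F n (e g)) \<longlonglongrightarrow> 0)"

lemma head_mass_le_1: "head_mass m \<le> 1"
  unfolding head_mass_def sum_geom_weight by (rule ennreal_le_1[THEN iffD2]) simp

text \<open>Dominated convergence for the probability measures \<open>Q k g\<close> and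
  \<open>Q k (e g)\<close>. By \<open>Q_null\<close>, for almost every \<open>g\<close> the set
  where \<open>F\<close> fails to converge is null for all of them at once.\<close>

lemma vanishing_head:
  assumes F: "vanishing F" shows "vanishing (\<lambda>n. head \<sigma> m (F n))"
proof -
  have meas: "F n \<in> borel_measurable M" and le: "h \<in> space M \<Longrightarrow> F n h \<le> 2" for n h
    using F unfolding vanishing_def by auto
  obtain A where A: "A \<in> null_sets \<mu>" "{h\<in>space M. \<not> (\<lambda>n. F n h) \<longlonglongrightarrow> 0} \<subseteq> A"
    using F unfolding vanishing_def eventually_ae_filter space_\<mu> by auto
  have conv: "(\<lambda>n. kernel_op (Q k) (F n) g) \<longlonglongrightarrow> 0" if "emeasure (Q k g) A = 0" and g: "g \<in> space M" for k g
  proof -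
    note Qg = prob_kernelD[OF Q[of k] g]
    have [measurable]: "F n \<in> borel_measurable (Q k g)" for n
      using meas measurable_cong_sets[OF Qg(2) refl] by auto
    have "A \<in> null_sets (Q k g)" using that A(1) Qg sets_\<mu> by (auto simp: null_sets_def)
    then have "AE h in Q k g. h \<notin> A" by (rule AE_not_in)
    then have ae: "AE h in Q k g. (\<lambda>n. F n h) \<longlonglongrightarrow> 0"
      using AE_space by eventually_elim (use A(2) Qg(3) in auto)
    have "(\<lambda>n. \<integral>\<^sup>+h. F n h \<partial>Q k g) \<longlonglongrightarrow> (\<integral>\<^sup>+h. 0 \<partial>Q k g)"
      using prob_space.emeasure_space_1[OF Qg(1)] le Qg(3) ae
      by (intro nn_integral_dominated_convergence[where w="\<lambda>_. 2"]) (auto simp: ennreal_mult_less_top)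
    then show ?thesis by (simp add: kernel_op_def)
  qed
  have conv_head: "(\<lambda>n. head \<sigma> m (F n) g) \<longlonglongrightarrow> 0" if "\<And>k. emeasure (Q k g) A = 0" "g \<in> space M" for g
  proof -
    have "(\<lambda>n. \<Sum>k<m. geom_weight k * kernel_op (Q (\<sigma> k)) (F n) g) \<longlonglongrightarrow> (\<Sum>k<m. geom_weight k * 0)"
      using conv that by (intro tendsto_sum ennreal_tendsto_cmult) (auto simp: geom_weight_def)
    then show ?thesis by (simp add: head_def)
  qed
  have null: "AE g in \<mu>. \<forall>k. emeasure (Q k g) A = 0 \<and> emeasure (Q k (e g)) A = 0"
    using Q_null[OF A(1)] by (subst AE_all_countable) auto
  have "AE g in \<mu>. (\<lambda>n. head \<sigma> m (F n) g) \<longlonglongrightarrow> 0" "AE g in \<mu>. (\<lambda>n. head \<sigma> m (F n) (e g)) \<longlonglongrightarrow> 0"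
    using null AE_space[of \<mu>] by (eventually_elim, use conv_head e_space space_\<mu> in auto)+
  moreover have "head \<sigma> m (F n) g \<le> 2" if g: "g \<in> space M" for n g
  proof -
    have "head \<sigma> m (F n) g \<le> head \<sigma> m (\<lambda>_. 2) g"
      unfolding head_def kernel_op_def using le prob_kernelD(3)[OF Q g]
      by (intro sum_mono mult_left_mono nn_integral_mono) auto
    also have "\<dots> \<le> 1 * 2" unfolding head_const[OF g] by (intro mult_right_mono head_mass_le_1) auto
    finally show ?thesis by simp
  qed
  ultimately show ?thesis unfolding vanishing_def using head_measurable[OF meas] by auto
qed

lemma vanishing_head_power:
  assumes "vanishing F" shows "vanishing (\<lambda>n. (head \<sigma> m ^^ i) (F n))"
  by (induction i) (auto intro: assms vanishing_head)

lemma vanishing_d: "vanishing d"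
  unfolding vanishing_def using d_measurable d_le d_lim by auto

text \<open>The price of using \<open>Q r\<close> at a position from \<open>m\<close> on: its mean
  defect after \<open>i < N\<close> applications of the head, at \<open>g\<close> and at
  \<open>e g\<close>.\<close>

definition cost :: "(nat \<Rightarrow> nat) \<Rightarrow> nat \<Rightarrow> nat \<Rightarrow> nat \<Rightarrow> ennreal" where
  "cost \<sigma> m N r = (\<Sum>i<N. \<integral>\<^sup>+g. (head \<sigma> m ^^ i) (d r) g + (head \<sigma> m ^^ i) (d r) (e g) \<partial>\<mu>)"

lemma cost_tendsto: "cost \<sigma> m N \<longlonglongrightarrow> 0"
proof -
  interpret finite_measure \<mu> by (rule finite_\<mu>)
  have "(\<lambda>r. \<integral>\<^sup>+g. (head \<sigma> m ^^ i) (d r) g + (head \<sigma> m ^^ i) (d r) (e g) \<partial>\<mu>) \<longlonglongrightarrow> (\<integral>\<^sup>+g. 0 \<partial>\<mu>)" for i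
  proof (rule nn_integral_dominated_convergence[where w="\<lambda>_. 4"])
    have v: "vanishing (\<lambda>r. (head \<sigma> m ^^ i) (d r))" by (rule vanishing_head_power[OF vanishing_d])
    have m: "(head \<sigma> m ^^ i) (d r) \<in> borel_measurable M" for r
      by (rule head_power_measurable[OF d_measurable])
    show "(\<lambda>g. (head \<sigma> m ^^ i) (d r) g + (head \<sigma> m ^^ i) (d r) (e g)) \<in> borel_measurable \<mu>" for r
      unfolding borel_\<mu> by (intro borel_measurable_add m measurable_compose[OF e_measurable m])
    have le: "(head \<sigma> m ^^ i) (d r) h \<le> 2" if "h \<in> space M" for r h using v that unfolding vanishing_def by auto
    show "AE g in \<mu>. (head \<sigma> m ^^ i) (d r) g + (head \<sigma> m ^^ i) (d r) (e g) \<le> 4" for r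
      using add_mono[OF le le[OF e_space]] space_\<mu> by (auto intro!: AE_I2)
    show "AE g in \<mu>. (\<lambda>r. (head \<sigma> m ^^ i) (d r) g + (head \<sigma> m ^^ i) (d r) (e g)) \<longlonglongrightarrow> 0"
    proof -
      have "AE g in \<mu>. (\<lambda>r. (head \<sigma> m ^^ i) (d r) g) \<longlonglongrightarrow> 0" "AE g in \<mu>. (\<lambda>r. (head \<sigma> m ^^ i) (d r) (e g)) \<longlonglongrightarrow> 0"
        using v unfolding vanishing_def by auto
      then show ?thesis by eventually_elim (drule (1) tendsto_add, simp)
    qed
  qed (auto simp: less_top[symmetric] ennreal_mult_eq_top_iff)
  then have "(\<lambda>r. \<Sum>i<N. \<integral>\<^sup>+g. (head \<sigma> m ^^ i) (d r) g + (head \<sigma> m ^^ i) (d r) (e g) \<partial>\<mu>) \<longlonglongrightarrow> (\<Sum>i<N. 0)"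
    by (intro tendsto_sum) auto
  then show ?thesis by (simp add: cost_def[abs_def])
qed

lemma head_eq_if_agree_below:
  assumes "\<And>k. k < m \<Longrightarrow> \<sigma> k = \<sigma>' k" shows "head \<sigma> m = head \<sigma>' m"
  using assms by (intro ext) (auto simp: head_def)

text \<open>The conditions on \<open>\<sigma> k\<close> involve \<open>\<sigma>\<close> otherwise
  only below \<open>m \<le> k\<close>, hence only values already chosen. They are finitely many, and
  each is met by all large \<open>r\<close>, so \<open>\<sigma>\<close> can be built by
  recursion.\<close>

lemma obtain_subsequence:
  obtains \<sigma> where "\<And>k m. m \<le> k \<Longrightarrow> cost \<sigma> m (N m) (\<sigma> k) \<le> ennreal (1 / real (Suc k))"
proof -
  have "\<exists>\<sigma>. \<forall>k. \<forall>m\<le>k. cost \<sigma> m (N m) (\<sigma> k) \<le> ennreal (1 / real (Suc k))"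
  proof (rule dependent_wellorder_choice)
    fix r :: nat and \<sigma> \<sigma>' :: "nat \<Rightarrow> nat" and k
    assume "\<And>j. j < k \<Longrightarrow> \<sigma> j = \<sigma>' j"
    then have "head \<sigma> m = head \<sigma>' m" if "m \<le> k" for m using that by (intro head_eq_if_agree_below) auto
    then show "(\<forall>m\<le>k. cost \<sigma> m (N m) r \<le> ennreal (1 / real (Suc k))) = (\<forall>m\<le>k. cost \<sigma>' m (N m) r \<le> ennreal (1 / real (Suc k)))"
      by (simp add: cost_def)
  next
    fix k and \<sigma> :: "nat \<Rightarrow> nat"
    have "\<forall>\<^sub>F r in sequentially. cost \<sigma> m (N m) r < ennreal (1 / real (Suc k))" for m
      by (rule order_tendstoD(2)[OF cost_tendsto]) simp
    then have "\<forall>\<^sub>F r in sequentially. \<forall>m\<in>{..k}. cost \<sigma> m (N m) r < ennreal (1 / real (Suc k))"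
      by (intro eventually_ball_finite) auto
    then obtain r where "\<forall>m\<in>{..k}. cost \<sigma> m (N m) r < ennreal (1 / real (Suc k))"
      by (auto dest: eventually_happens)
    then show "\<exists>r. \<forall>m\<le>k. cost \<sigma> m (N m) r \<le> ennreal (1 / real (Suc k))" by (auto intro: less_imp_le)
  qed
  then show thesis using that by blast
qed

text \<open>The 2 in the constant comes from the two terms \<open>head_mass m ^ N m\<close>, at
  \<open>g\<close> and at \<open>e g\<close>. The 1 bounds the total weight of the tail, each index
  of which has cost at most \<open>1 / real (Suc m)\<close>.\<close>

lemma integral_deviation_le:
  assumes N: "head_mass m ^ N m \<le> ennreal (1 / real (Suc m))"
    and \<sigma>: "\<And>k. m \<le> k \<Longrightarrow> cost \<sigma> m (N m) (\<sigma> k) \<le> ennreal (1 / real (Suc k))"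
  shows "(\<integral>\<^sup>+g. deviation \<sigma> m (N m) g + deviation \<sigma> m (N m) (e g) \<partial>\<mu>)
    \<le> (2 * emeasure \<mu> (space \<mu>) + 1) * ennreal (1 / real (Suc m))"
proof -
  define f where "f i k g = (head \<sigma> m ^^ i) (d (\<sigma> (k + m))) g + (head \<sigma> m ^^ i) (d (\<sigma> (k + m))) (e g)" for i k g
  have hm: "(head \<sigma> m ^^ i) (d r) \<in> borel_measurable M" for i r
    by (rule head_power_measurable[OF d_measurable])
  have f[measurable]: "f i k \<in> borel_measurable \<mu>" for i k
    unfolding borel_\<mu> f_def by (intro borel_measurable_add hm measurable_compose[OF e_measurable hm])
  have dev: "deviation \<sigma> m (N m) g + deviation \<sigma> m (N m) (e g)
      = 2 * head_mass m ^ N m + (\<Sum>i<N m. \<Sum>k. geom_weight (k + m) * f i k g)" if "g \<in> space M" for g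
    unfolding deviation_def f_def using that e_space[OF that]
    by (simp add: head_power_tail_defect sum.distrib[symmetric] suminf_add[symmetric] distrib_left mult_2 add_ac)
  have "(\<integral>\<^sup>+g. deviation \<sigma> m (N m) g + deviation \<sigma> m (N m) (e g) \<partial>\<mu>)
      = (\<integral>\<^sup>+g. 2 * head_mass m ^ N m + (\<Sum>i<N m. \<Sum>k. geom_weight (k + m) * f i k g) \<partial>\<mu>)"
    by (intro nn_integral_cong dev) (simp add: space_\<mu>)
  also have "\<dots> = 2 * head_mass m ^ N m * emeasure \<mu> (space \<mu>)
      + (\<Sum>i<N m. \<Sum>k. geom_weight (k + m) * (\<integral>\<^sup>+g. f i k g \<partial>\<mu>))"
    by (subst nn_integral_add) (auto simp: nn_integral_sum nn_integral_suminf nn_integral_cmult)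
  also have "(\<Sum>i<N m. \<Sum>k. geom_weight (k + m) * (\<integral>\<^sup>+g. f i k g \<partial>\<mu>))
      = (\<Sum>k. \<Sum>i<N m. geom_weight (k + m) * (\<integral>\<^sup>+g. f i k g \<partial>\<mu>))"
    by (intro suminf_sum[symmetric]) auto
  also have "\<dots> = (\<Sum>k. geom_weight (k + m) * cost \<sigma> m (N m) (\<sigma> (k + m)))"
    by (simp add: cost_def f_def sum_distrib_left)
  also have "\<dots> \<le> (\<Sum>k. geom_weight (k + m) * ennreal (1 / real (Suc m)))"
  proof (intro suminf_le mult_left_mono)
    fix k
    have "cost \<sigma> m (N m) (\<sigma> (k + m)) \<le> ennreal (1 / real (Suc (k + m)))" by (rule \<sigma>) simp
    also have "\<dots> \<le> ennreal (1 / real (Suc m))" by (intro ennreal_leI divide_left_mono) auto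
    finally show "cost \<sigma> m (N m) (\<sigma> (k + m)) \<le> ennreal (1 / real (Suc m))" .
  qed auto
  also have "\<dots> = (\<Sum>k. geom_weight (k + m)) * ennreal (1 / real (Suc m))" by (rule ennreal_suminf_multc)
  also have "(\<Sum>k. geom_weight (k + m)) \<le> (\<Sum>k. geom_weight (k + m)) + (\<Sum>k<m. geom_weight k)" by simp
  also have "\<dots> = 1" using suminf_offset[of geom_weight m] suminf_geom_weight by simp
  finally have "(\<integral>\<^sup>+g. deviation \<sigma> m (N m) g + deviation \<sigma> m (N m) (e g) \<partial>\<mu>)
      \<le> 2 * head_mass m ^ N m * emeasure \<mu> (space \<mu>) + 1 * ennreal (1 / real (Suc m))"
    by (simp add: add_left_mono mult_right_mono)
  also have "\<dots> \<le> 2 * ennreal (1 / real (Suc m)) * emeasure \<mu> (space \<mu>) + 1 * ennreal (1 / real (Suc m))"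
    by (intro add_mono mult_mono N) auto
  also have "\<dots> = (2 * emeasure \<mu> (space \<mu>) + 1) * ennreal (1 / real (Suc m))"
    unfolding distrib_right by (simp only: mult_ac)
  finally show ?thesis .
qed

text \<open>\<open>n0\<close> is uniform in \<open>u\<close>, so this is convergence in variation.
  The integrals of the bounds \<open>H m\<close> tend to 0, hence their infimum over
  \<open>m\<close> vanishes almost everywhere. An infimum is enough: a single \<open>m\<close> with
  \<open>H m g\<close> small controls all \<open>n \<ge> N m\<close>.\<close>

theorem mixture_asymptotically_invariant:
  "\<exists>\<sigma>. AE g in \<mu>. \<forall>\<epsilon>>0. \<exists>n0. \<forall>n\<ge>n0. \<forall>u\<in>borel_measurable M. (\<forall>h\<in>space M. u h \<le> 1) \<longrightarrow>
     (mixture_op \<sigma> ^^ n) u g \<le> (mixture_op \<sigma> ^^ n) u (e g) + \<epsilon> \<and>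
     (mixture_op \<sigma> ^^ n) u (e g) \<le> (mixture_op \<sigma> ^^ n) u g + \<epsilon>"
proof -
  interpret finite_measure \<mu> by (rule finite_\<mu>)
  \<comment> \<open>The number of steps is fixed before \<open>\<sigma>\<close>, since the mass of
    the head does not depend on it.\<close>
  have "\<exists>n. head_mass m ^ n \<le> ennreal (1 / real (Suc m))" for m
  proof -
    have "1 - (1 / 2) ^ m < (1 :: real)" "0 \<le> 1 - (1 / 2 :: real) ^ m" by (auto simp: power_le_one)
    then obtain n where "(1 - (1 / 2) ^ m) ^ n < 1 / real (Suc m)"
      using real_arch_pow_inv[of "1 / real (Suc m)" "1 - (1 / 2) ^ m"] by auto
    then show ?thesis
      unfolding head_mass_def sum_geom_weight using \<open>0 \<le> 1 - (1 / 2 :: real) ^ m\<close>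
      by (intro exI[of _ n]) (simp add: ennreal_power ennreal_leI del: of_nat_Suc)
  qed
  then obtain N where N: "\<And>m. head_mass m ^ N m \<le> ennreal (1 / real (Suc m))" by metis
  obtain \<sigma> where \<sigma>: "\<And>k m. m \<le> k \<Longrightarrow> cost \<sigma> m (N m) (\<sigma> k) \<le> ennreal (1 / real (Suc k))"
    using obtain_subsequence by blast
  define H where "H m g = deviation \<sigma> m (N m) g + deviation \<sigma> m (N m) (e g)" for m g
  have H[measurable]: "H m \<in> borel_measurable \<mu>" for m
    unfolding H_def borel_\<mu>
    by (intro borel_measurable_add deviation_measurable measurable_compose[OF e_measurable deviation_measurable])
  have "(\<integral>\<^sup>+g. (INF m. H m g) \<partial>\<mu>) \<le> (2 * emeasure \<mu> (space \<mu>) + 1) * ennreal (1 / real (Suc m))" for m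
  proof -
    have "(\<integral>\<^sup>+g. (INF m. H m g) \<partial>\<mu>) \<le> (\<integral>\<^sup>+g. H m g \<partial>\<mu>)" by (intro nn_integral_mono INF_lower) auto
    also have "\<dots> \<le> (2 * emeasure \<mu> (space \<mu>) + 1) * ennreal (1 / real (Suc m))"
      unfolding H_def by (rule integral_deviation_le[OF N \<sigma>])
    finally show ?thesis .
  qed
  moreover have "(\<lambda>m. (2 * emeasure \<mu> (space \<mu>) + 1) * ennreal (1 / real (Suc m))) \<longlonglongrightarrow> (2 * emeasure \<mu> (space \<mu>) + 1) * ennreal 0"
  proof (intro ennreal_tendsto_cmult tendsto_ennrealI)
    show "2 * emeasure \<mu> (space \<mu>) + 1 < top" by (simp add: less_top[symmetric] ennreal_mult_eq_top_iff)
    show "(\<lambda>m. 1 / real (Suc m)) \<longlonglongrightarrow> 0" using LIMSEQ_inverse_real_of_nat by (simp add: inverse_eq_divide)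
  qed
  ultimately have "(\<integral>\<^sup>+g. (INF m. H m g) \<partial>\<mu>) \<le> (2 * emeasure \<mu> (space \<mu>) + 1) * ennreal 0"
    by (intro LIMSEQ_le_const) auto
  then have "(\<integral>\<^sup>+g. (INF m. H m g) \<partial>\<mu>) = 0" by simp
  then have "AE g in \<mu>. (INF m. H m g) = 0" by (subst (asm) nn_integral_0_iff_AE) auto
  then have "AE g in \<mu>. \<forall>\<epsilon>>0. \<exists>n0. \<forall>n\<ge>n0. \<forall>u\<in>borel_measurable M. (\<forall>h\<in>space M. u h \<le> 1) \<longrightarrow>
     (mixture_op \<sigma> ^^ n) u g \<le> (mixture_op \<sigma> ^^ n) u (e g) + \<epsilon> \<and>
     (mixture_op \<sigma> ^^ n) u (e g) \<le> (mixture_op \<sigma> ^^ n) u g + \<epsilon>"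
    using AE_space
  proof eventually_elim
    case (elim g)
    then have g: "g \<in> space M" by (simp add: space_\<mu>)
    show ?case
    proof (intro allI impI)
      fix \<epsilon> :: ennreal assume "\<epsilon> > 0"
      then obtain m where m: "H m g < \<epsilon>" using elim(1) by (metis INF_less_iff)
      show "\<exists>n0. \<forall>n\<ge>n0. \<forall>u\<in>borel_measurable M. (\<forall>h\<in>space M. u h \<le> 1) \<longrightarrow>
         (mixture_op \<sigma> ^^ n) u g \<le> (mixture_op \<sigma> ^^ n) u (e g) + \<epsilon> \<and>
         (mixture_op \<sigma> ^^ n) u (e g) \<le> (mixture_op \<sigma> ^^ n) u g + \<epsilon>"
      proof (intro exI[of _ "N m"] allI impI ballI)
        fix n and u :: "'a \<Rightarrow> ennreal" assume n: "N m \<le> n" and u: "u \<in> borel_measurable M" "\<forall>h\<in>space M. u h \<le> 1"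
        have "u h \<le> 1" if "h \<in> space M" for h using u(2) that by blast
        note def = mixture_power_defect[OF u(1) this g n, of \<sigma> m, folded H_def]
        show "(mixture_op \<sigma> ^^ n) u g \<le> (mixture_op \<sigma> ^^ n) u (e g) + \<epsilon> \<and>
          (mixture_op \<sigma> ^^ n) u (e g) \<le> (mixture_op \<sigma> ^^ n) u g + \<epsilon>"
          using order_trans[OF def(1) add_left_mono] order_trans[OF def(2) add_left_mono] m by (auto intro: less_imp_le)
      qed
    qed
  qed
  then show ?thesis by blast
qed

end

section \<open>Measured groupoids\<close>

context measured_groupoid
begin

lemma space_obj_algebra: "space (obj_algebra G M) = Obj G"
  by (simp add: obj_algebra_def)

lemma fibred_l: "fibred_system G M l"
  and l_invariant: "g \<in> Mor G \<Longrightarrow> translate G M g (l (src G g)) = l (tgt G g)"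
  using haar by (auto simp: haar_system_def)

lemma fibred_systemD:
  assumes "fibred_system G M \<alpha>" "x \<in> Obj G"
  shows "sets (\<alpha> x) = sets M" "space (\<alpha> x) = Mor G" "AE g in \<alpha> x. g \<in> fibre G x"
  using assms sets_eq_imp_space_eq[of "\<alpha> x" M] space_M by (auto simp: fibred_system_def)

lemmas sets_l = fibred_systemD(1)[OF fibred_l]

lemma fibred_system_emeasure_measurable:
  assumes "fibred_system G M \<alpha>" "A \<in> sets M"
  shows "(\<lambda>x. emeasure (\<alpha> x) A) \<in> borel_measurable (obj_algebra G M)"
proof -
  have "(indicator A :: 'g \<Rightarrow> ennreal) \<in> borel_measurable M" using assms(2) by simp
  then have "(\<lambda>x. \<integral>\<^sup>+g. indicator A g \<partial>\<alpha> x) \<in> borel_measurable (obj_algebra G M)"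
    using assms(1) unfolding fibred_system_def by blast
  then show ?thesis
    by (rule measurable_cong[THEN iffD1, rotated])
      (use assms fibred_systemD(1)[OF assms(1)] in \<open>simp add: space_obj_algebra\<close>)
qed

lemma sets_star: "sets (star_measure M l \<kappa>) = sets M"
  by (simp add: star_measure_def)

lemma space_star: "space (star_measure M l \<kappa>) = Mor G"
  using sets_eq_imp_space_eq[OF sets_star] space_M by simp

lemma space_\<kappa>: "space \<kappa> = Obj G"
  using sets_eq_imp_space_eq[OF sets_\<kappa>] by (simp add: space_obj_algebra)

lemma emeasure_l_measurable:
  assumes "A \<in> sets M" shows "(\<lambda>x. emeasure (l x) A) \<in> borel_measurable \<kappa>"
  using fibred_system_emeasure_measurable[OF fibred_l assms] measurable_cong_sets[OF sets_\<kappa> refl] by blast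

lemma emeasure_star:
  assumes "A \<in> sets M"
  shows "emeasure (star_measure M l \<kappa>) A = (\<integral>\<^sup>+x. emeasure (l x) A \<partial>\<kappa>)"
proof (rule emeasure_measure_of[OF star_measure_def])
  show "countably_additive (sets (star_measure M l \<kappa>)) (\<lambda>A. \<integral>\<^sup>+x. emeasure (l x) A \<partial>\<kappa>)"
    unfolding sets_star
  proof (rule countably_additiveI)
    fix F :: "nat \<Rightarrow> 'g set"
    assume F: "range F \<subseteq> sets M" "disjoint_family F"
    have "(\<Sum>i. \<integral>\<^sup>+x. emeasure (l x) (F i) \<partial>\<kappa>) = (\<integral>\<^sup>+x. (\<Sum>i. emeasure (l x) (F i)) \<partial>\<kappa>)"
      using F by (intro nn_integral_suminf[symmetric] emeasure_l_measurable) auto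
    also have "\<dots> = (\<integral>\<^sup>+x. emeasure (l x) (\<Union>(range F)) \<partial>\<kappa>)"
      using F sets_l by (intro nn_integral_cong suminf_emeasure) (auto simp: space_\<kappa>)
    finally show "(\<Sum>i. \<integral>\<^sup>+x. emeasure (l x) (F i) \<partial>\<kappa>) = (\<integral>\<^sup>+x. emeasure (l x) (\<Union>(range F)) \<partial>\<kappa>)" .
  qed
qed (use assms sets.sets_into_space in \<open>auto simp: sets_star positive_def\<close>)

lemma AE_fibre_null:
  assumes "A \<in> null_sets (star_measure M l \<kappa>)"
  shows "AE x in \<kappa>. A \<in> null_sets (l x)"
proof -
  have A: "A \<in> sets M" using assms sets_star by auto
  then have "(\<integral>\<^sup>+x. emeasure (l x) A \<partial>\<kappa>) = 0" using assms emeasure_star by auto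
  then have "AE x in \<kappa>. emeasure (l x) A = 0"
    using emeasure_l_measurable[OF A] by (subst (asm) nn_integral_0_iff_AE) auto
  then show ?thesis using AE_space
    by eventually_elim (use A sets_l in \<open>auto simp: null_sets_def space_\<kappa>\<close>)
qed

text \<open>A set of morphisms with targets in a \<open>\<kappa>\<close>-null set \<open>N\<close>
  is charged only by those \<open>l x\<close> with \<open>x\<close> in \<open>N\<close>.\<close>

lemma AE_star_tgt:
  assumes "AE x in \<kappa>. P x"
  shows "AE g in star_measure M l \<kappa>. P (tgt G g)"
proof -
  obtain N where N: "N \<in> null_sets \<kappa>" "{x\<in>Obj G. \<not> P x} \<subseteq> N"
    using assms unfolding eventually_ae_filter space_\<kappa> by auto
  define A where "A = tgt G -` N \<inter> space M"
  have A: "A \<in> sets M" unfolding A_def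
    using N(1) sets_\<kappa> by (intro measurable_sets[OF tgt_measurable]) auto
  have null: "emeasure (l x) A = 0" if "x \<in> Obj G" "x \<notin> N" for x
  proof -
    have "AE g in l x. g \<notin> A"
      using fibred_systemD(3)[OF fibred_l that(1)] by eventually_elim (use that in \<open>auto simp: A_def fibre_def\<close>)
    then have "A \<in> null_sets (l x)" using A sets_l[OF that(1)] by (subst AE_iff_null_sets) auto
    then show ?thesis by auto
  qed
  have "AE x in \<kappa>. emeasure (l x) A = 0"
    using AE_not_in[OF N(1)] AE_space[of \<kappa>] by eventually_elim (auto simp: space_\<kappa> null)
  then have "(\<integral>\<^sup>+x. emeasure (l x) A \<partial>\<kappa>) = 0"
    using emeasure_l_measurable[OF A] by (subst nn_integral_0_iff_AE)
  then have "A \<in> null_sets (star_measure M l \<kappa>)" using A emeasure_star[OF A] sets_star by auto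
  then have "AE g in star_measure M l \<kappa>. g \<notin> A" by (rule AE_not_in)
  then show ?thesis using AE_space
    by eventually_elim (use N(2) tgt_Obj in \<open>auto simp: A_def space_star space_M\<close>)
qed

section \<open>Measurability of fibres and of composable pairs\<close>

text \<open>\<open>rokhlin_l\<close> gives one family per fibre, but a defect measurable in
  \<open>g\<close> calls for a family common to all fibres. \<open>rokhlin_star\<close> provides it,
  as the underlying space of that measure is all of \<open>Mor G\<close>.\<close>

definition separating_family :: "'g set set" where
  "separating_family = (SOME S. countable S \<and> S \<subseteq> sets M \<and>
     (\<forall>x\<in>Mor G. \<forall>y\<in>Mor G. x \<noteq> y \<longrightarrow> (\<exists>A\<in>S. (x \<in> A) \<noteq> (y \<in> A))))"

lemma separating_family:
  "countable separating_family" "separating_family \<subseteq> sets M"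
  "x \<in> Mor G \<Longrightarrow> y \<in> Mor G \<Longrightarrow> x \<noteq> y \<Longrightarrow> \<exists>A\<in>separating_family. (x \<in> A) \<noteq> (y \<in> A)"
proof -
  have "\<exists>S. countable S \<and> S \<subseteq> sets M \<and> (\<forall>x\<in>Mor G. \<forall>y\<in>Mor G. x \<noteq> y \<longrightarrow> (\<exists>A\<in>S. (x \<in> A) \<noteq> (y \<in> A)))"
    using rokhlin_star unfolding lebesgue_rokhlin_def sets_star space_star by (elim conjE)
  from someI_ex[OF this] show "countable separating_family" "separating_family \<subseteq> sets M"
    "x \<in> Mor G \<Longrightarrow> y \<in> Mor G \<Longrightarrow> x \<noteq> y \<Longrightarrow> \<exists>A\<in>separating_family. (x \<in> A) \<noteq> (y \<in> A)"
    unfolding separating_family_def[symmetric] by blast+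
qed

lemma obj_eq_iff:
  assumes "x \<in> Obj G" "y \<in> Obj G"
  shows "x = y \<longleftrightarrow> (\<forall>A\<in>separating_family. unit G x \<in> A \<longleftrightarrow> unit G y \<in> A)"
proof
  assume "\<forall>A\<in>separating_family. unit G x \<in> A \<longleftrightarrow> unit G y \<in> A"
  then have "unit G x = unit G y" using separating_family(3)[OF unit_Mor unit_Mor, OF assms] by blast
  then show "x = y" using src_unit assms by metis
qed simp

text \<open>Objects are determined by their units, which a countable family separates, so equality
  of objects is a countable conjunction of measurable conditions.\<close>

lemma sets_obj_eq:
  assumes f: "f \<in> N \<rightarrow>\<^sub>M obj_algebra G M" and g: "g \<in> N \<rightarrow>\<^sub>M obj_algebra G M"
  shows "{p\<in>space N. f p = g p} \<in> sets N"
proof -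
  have [measurable]: "(\<lambda>p. unit G (f p)) \<in> N \<rightarrow>\<^sub>M M" "(\<lambda>p. unit G (g p)) \<in> N \<rightarrow>\<^sub>M M"
    by (rule measurable_compose[OF f unit_measurable] measurable_compose[OF g unit_measurable])+
  have "(\<Union>A\<in>separating_family. {p\<in>space N. (unit G (f p) \<in> A) \<noteq> (unit G (g p) \<in> A)}) \<in> sets N"
  proof (rule sets.countable_UN'[OF separating_family(1)], rule image_subsetI)
    fix A assume "A \<in> separating_family"
    then have [measurable]: "A \<in> sets M" using separating_family(2) by auto
    show "{p\<in>space N. (unit G (f p) \<in> A) \<noteq> (unit G (g p) \<in> A)} \<in> sets N" by measurable
  qed
  then have "space N - (\<Union>A\<in>separating_family. {p\<in>space N. (unit G (f p) \<in> A) \<noteq> (unit G (g p) \<in> A)}) \<in> sets N"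
    by (rule sets.compl_sets)
  also have "space N - (\<Union>A\<in>separating_family. {p\<in>space N. (unit G (f p) \<in> A) \<noteq> (unit G (g p) \<in> A)})
      = {p\<in>space N. \<forall>A\<in>separating_family. unit G (f p) \<in> A \<longleftrightarrow> unit G (g p) \<in> A}" by auto
  finally have "{p\<in>space N. \<forall>A\<in>separating_family. unit G (f p) \<in> A \<longleftrightarrow> unit G (g p) \<in> A} \<in> sets N" .
  moreover have "f p \<in> Obj G" "g p \<in> Obj G" if "p \<in> space N" for p
    using measurable_space[OF f that] measurable_space[OF g that] by (auto simp: space_obj_algebra)
  ultimately show ?thesis
    by (simp add: obj_eq_iff cong: conj_cong)
qed

lemma fibre_sets:
  assumes "x \<in> Obj G" shows "fibre G x \<in> sets M"
proof -
  have "{g\<in>space M. tgt G g = x} \<in> sets M"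
    by (rule sets_obj_eq[OF tgt_measurable]) (use assms in \<open>simp add: space_obj_algebra\<close>)
  then show ?thesis by (simp add: fibre_def space_M)
qed

lemma composable_sets: "composable G \<in> sets (M \<Otimes>\<^sub>M M)"
proof -
  have "{p\<in>space (M \<Otimes>\<^sub>M M). src G (fst p) = tgt G (snd p)} \<in> sets (M \<Otimes>\<^sub>M M)"
    by (rule sets_obj_eq[OF measurable_compose[OF measurable_fst src_measurable]
        measurable_compose[OF measurable_snd tgt_measurable]])
  also have "{p\<in>space (M \<Otimes>\<^sub>M M). src G (fst p) = tgt G (snd p)} = composable G"
    by (auto simp: composable_def space_pair_measure space_M)
  finally show ?thesis .
qed

lemma composableI: "g \<in> Mor G \<Longrightarrow> h \<in> fibre G (src G g) \<Longrightarrow> (g, h) \<in> composable G"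
  by (auto simp: composable_def fibre_def)

lemma mult_fibre: "g \<in> Mor G \<Longrightarrow> h \<in> fibre G (src G g) \<Longrightarrow> mult G g h \<in> fibre G (tgt G g)"
  using composableI[of g h] mult_Mor tgt_mult by (auto simp: fibre_def)

lemma mult_measurable_right:
  assumes "g \<in> Mor G" shows "mult G g \<in> restrict_space M (fibre G (src G g)) \<rightarrow>\<^sub>M M"
proof -
  have "(\<lambda>h. (g, h)) \<in> restrict_space M (fibre G (src G g)) \<rightarrow>\<^sub>M restrict_space (M \<Otimes>\<^sub>M M) (composable G)"
  proof (rule measurable_restrict_space2)
    show "(\<lambda>h. (g, h)) \<in> space (restrict_space M (fibre G (src G g))) \<rightarrow> composable G"
      using composableI[OF assms] by (auto simp: space_restrict_space)
    show "(\<lambda>h. (g, h)) \<in> restrict_space M (fibre G (src G g)) \<rightarrow>\<^sub>M M \<Otimes>\<^sub>M M"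
      using assms by (intro measurable_Pair measurable_const measurable_restrict_space1) (auto simp: space_M)
  qed
  from measurable_compose[OF this mult_measurable] show ?thesis by simp
qed

section \<open>Translation of measures\<close>

lemma sets_translate [simp]: "sets (translate G M g \<alpha>) = sets M"
  by (simp add: translate_def)

lemma mult_measurable_right':
  assumes "g \<in> Mor G" "sets \<alpha> = sets M"
  shows "mult G g \<in> restrict_space \<alpha> (fibre G (src G g)) \<rightarrow>\<^sub>M M"
  using mult_measurable_right[OF assms(1)]
    measurable_cong_sets[OF sets_restrict_space_cong[OF assms(2), of "fibre G (src G g)"] refl, of M] by simp

lemma translate_vimage_sets:
  assumes "g \<in> Mor G" "A \<in> sets M"
  shows "{h \<in> fibre G (src G g). mult G g h \<in> A} \<in> sets M"
proof -
  have F: "fibre G (src G g) \<in> sets M" "fibre G (src G g) \<subseteq> space M"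
    using fibre_sets[OF src_Obj[OF assms(1)]] by (auto simp: fibre_def space_M)
  have "mult G g -` A \<inter> fibre G (src G g) \<in> sets (restrict_space M (fibre G (src G g)))"
    using measurable_sets[OF mult_measurable_right[OF assms(1)] assms(2)] F by (simp add: space_restrict_space Int_absorb2)
  then have "mult G g -` A \<inter> fibre G (src G g) \<in> sets M"
    using F by (subst (asm) sets_restrict_space_iff) (auto simp: Int_absorb2)
  also have "mult G g -` A \<inter> fibre G (src G g) = {h \<in> fibre G (src G g). mult G g h \<in> A}" by auto
  finally show ?thesis .
qed

lemma emeasure_translate:
  assumes g: "g \<in> Mor G" and \<alpha>: "sets \<alpha> = sets M" and A: "A \<in> sets M"
  shows "emeasure (translate G M g \<alpha>) A = emeasure \<alpha> {h \<in> fibre G (src G g). mult G g h \<in> A}"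
proof -
  have sp: "space \<alpha> = Mor G" using sets_eq_imp_space_eq[OF \<alpha>] space_M by simp
  have F: "fibre G (src G g) \<in> sets \<alpha>" "fibre G (src G g) \<subseteq> space \<alpha>"
    using fibre_sets[OF src_Obj[OF g]] \<alpha> sp by (auto simp: fibre_def)
  have "emeasure (translate G M g \<alpha>) A
      = emeasure (restrict_space \<alpha> (fibre G (src G g))) (mult G g -` A \<inter> fibre G (src G g))"
    unfolding translate_def using F
    by (subst emeasure_distr[OF mult_measurable_right'[OF g \<alpha>] A]) (simp add: space_restrict_space Int_absorb2)
  also have "\<dots> = emeasure \<alpha> (mult G g -` A \<inter> fibre G (src G g))"
    using F by (intro emeasure_restrict_space) (auto simp: Int_absorb2)
  also have "mult G g -` A \<inter> fibre G (src G g) = {h \<in> fibre G (src G g). mult G g h \<in> A}" by auto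
  finally show ?thesis .
qed

lemma nn_integral_translate:
  assumes g: "g \<in> Mor G" and \<alpha>: "sets \<alpha> = sets M" and u: "u \<in> borel_measurable M"
  shows "(\<integral>\<^sup>+h. u h \<partial>translate G M g \<alpha>) = (\<integral>\<^sup>+h. u (mult G g h) * indicator (fibre G (src G g)) h \<partial>\<alpha>)"
proof -
  have sp: "space \<alpha> = Mor G" using sets_eq_imp_space_eq[OF \<alpha>] space_M by simp
  have F: "fibre G (src G g) \<in> sets \<alpha>" "fibre G (src G g) \<subseteq> space \<alpha>"
    using fibre_sets[OF src_Obj[OF g]] \<alpha> sp by (auto simp: fibre_def)
  show ?thesis unfolding translate_def
    using F u by (subst nn_integral_distr[OF mult_measurable_right'[OF g \<alpha>]])
      (simp_all add: nn_integral_restrict_space Int_absorb2)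
qed

text \<open>Left invariance of \<open>l\<close>: multiplication by \<open>g\<close> pulls a null set
  over \<open>tgt G g\<close> back to a null set over \<open>src G g\<close>.\<close>

lemma translate_absolutely_continuous:
  assumes g: "g \<in> Mor G" and \<alpha>: "sets \<alpha> = sets M" and ac: "absolutely_continuous (l (src G g)) \<alpha>"
  shows "absolutely_continuous (l (tgt G g)) (translate G M g \<alpha>)"
  unfolding absolutely_continuous_def
proof
  note sl = sets_l[OF src_Obj[OF g]]
  fix A assume A: "A \<in> null_sets (l (tgt G g))"
  then have AM: "A \<in> sets M" using sets_l[OF tgt_Obj[OF g]] by auto
  have "emeasure (translate G M g (l (src G g))) A = 0" using A l_invariant[OF g] by auto
  then have "{h \<in> fibre G (src G g). mult G g h \<in> A} \<in> null_sets (l (src G g))"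
    using emeasure_translate[OF g sl AM] translate_vimage_sets[OF g AM] sl by auto
  then have "emeasure \<alpha> {h \<in> fibre G (src G g). mult G g h \<in> A} = 0"
    using ac unfolding absolutely_continuous_def by auto
  then show "A \<in> null_sets (translate G M g \<alpha>)" using emeasure_translate[OF g \<alpha> AM] AM by auto
qed

lemma translate_mult:
  assumes gh: "(g, h) \<in> composable G" and \<alpha>: "sets \<alpha> = sets M"
  shows "translate G M (mult G g h) \<alpha> = translate G M g (translate G M h \<alpha>)"
proof (rule measure_eqI)
  have g: "g \<in> Mor G" and h: "h \<in> Mor G" and eq: "tgt G h = src G g" using gh by (auto simp: composable_def)
  fix A assume "A \<in> sets (translate G M (mult G g h) \<alpha>)"
  then have A: "A \<in> sets M" by simp
  have "{k \<in> fibre G (src G h). mult G h k \<in> {j \<in> fibre G (src G g). mult G g j \<in> A}}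
      = {k \<in> fibre G (src G h). mult G (mult G g h) k \<in> A}"
    using mult_fibre[OF h] mult_assoc[OF gh composableI[OF h]] eq by auto
  then show "emeasure (translate G M (mult G g h) \<alpha>) A = emeasure (translate G M g (translate G M h \<alpha>)) A"
    using emeasure_translate[OF mult_Mor[OF gh] \<alpha> A] src_mult[OF gh]
      emeasure_translate[OF g sets_translate A]
      emeasure_translate[OF h \<alpha> translate_vimage_sets[OF g A]] by simp
qed simp

lemma translate_unit:
  assumes x: "x \<in> Obj G" and \<alpha>: "sets \<alpha> = sets M" and ae: "AE g in \<alpha>. g \<in> fibre G x"
  shows "translate G M (unit G x) \<alpha> = \<alpha>"
proof (rule measure_eqI)
  fix A assume "A \<in> sets (translate G M (unit G x) \<alpha>)"
  then have A: "A \<in> sets M" by simp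
  have "{h \<in> fibre G x. mult G (unit G x) h \<in> A} = {h \<in> fibre G x. h \<in> A}"
    using mult_unit_left by (auto simp: fibre_def)
  then have "emeasure (translate G M (unit G x) \<alpha>) A = emeasure \<alpha> {h \<in> fibre G x. h \<in> A}"
    using emeasure_translate[OF unit_Mor[OF x] \<alpha> A] src_unit[OF x] by simp
  also have "\<dots> = emeasure \<alpha> A"
    using ae A \<alpha> fibre_sets[OF x] by (intro emeasure_eq_AE) (auto elim!: eventually_mono simp: Collect_conj_eq)
  finally show "emeasure (translate G M (unit G x) \<alpha>) A = emeasure \<alpha> A" .
qed (simp add: \<alpha>)

section \<open>Equivariant operators, fibred systems and convolution\<close>

lemma equivariant_operatorD:
  assumes "equivariant_operator G M \<pi>"
  shows "\<pi> \<in> M \<rightarrow>\<^sub>M prob_algebra M"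
    "g \<in> Mor G \<Longrightarrow> prob_space (\<pi> g)" "g \<in> Mor G \<Longrightarrow> sets (\<pi> g) = sets M" "g \<in> Mor G \<Longrightarrow> space (\<pi> g) = Mor G"
    "g \<in> Mor G \<Longrightarrow> AE h in \<pi> g. h \<in> fibre G (tgt G g)"
    "(g, h) \<in> composable G \<Longrightarrow> \<pi> (mult G g h) = translate G M g (\<pi> h)"
proof -
  show m: "\<pi> \<in> M \<rightarrow>\<^sub>M prob_algebra M" using assms by (simp add: equivariant_operator_def)
  show "(g, h) \<in> composable G \<Longrightarrow> \<pi> (mult G g h) = translate G M g (\<pi> h)"
    using assms by (auto simp: equivariant_operator_def)
  assume g: "g \<in> Mor G"
  show p: "prob_space (\<pi> g)" and s: "sets (\<pi> g) = sets M" and "space (\<pi> g) = Mor G"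
    using prob_kernelD[OF m, of g] g by (auto simp: space_M)
  have "fibre G (tgt G g) \<in> sets (\<pi> g)" using fibre_sets[OF tgt_Obj[OF g]] s by simp
  then show "AE h in \<pi> g. h \<in> fibre G (tgt G g)"
    using assms g by (intro prob_space.AE_in_set_eq_1[OF p, THEN iffD2]) (auto simp: equivariant_operator_def measure_def)
qed

lemma equivariant_operatorI:
  assumes m: "\<pi> \<in> M \<rightarrow>\<^sub>M prob_algebra M"
    and f: "\<And>g. g \<in> Mor G \<Longrightarrow> AE h in \<pi> g. h \<in> fibre G (tgt G g)"
    and t: "\<And>g h. (g, h) \<in> composable G \<Longrightarrow> \<pi> (mult G g h) = translate G M g (\<pi> h)"
  shows "equivariant_operator G M \<pi>"
proof -
  have "emeasure (\<pi> g) (fibre G (tgt G g)) = 1" if g: "g \<in> Mor G" for g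
  proof -
    have k: "prob_space (\<pi> g)" "sets (\<pi> g) = sets M" using prob_kernelD[OF m, of g] g by (auto simp: space_M)
    interpret prob_space "\<pi> g" by (rule k)
    show ?thesis using AE_in_set_eq_1[of "fibre G (tgt G g)"] f[OF g] k fibre_sets[OF tgt_Obj[OF g]]
      by (simp add: emeasure_eq_measure)
  qed
  then show ?thesis using m t by (auto simp: equivariant_operator_def)
qed

lemma composable_unit: "g \<in> Mor G \<Longrightarrow> (g, unit G (src G g)) \<in> composable G"
  by (auto simp: composable_def src_Obj unit_Mor tgt_unit)

text \<open>\<open>g\<close> is its own product with the unit at its source. This is what makes
  operators and systems correspond.\<close>

lemma equivariant_eq_translate:
  assumes "equivariant_operator G M \<pi>" "g \<in> Mor G"
  shows "\<pi> g = translate G M g (\<pi> (unit G (src G g)))"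
  using equivariant_operatorD(6)[OF assms(1) composable_unit[OF assms(2)]] mult_unit_right[OF assms(2)] by simp

lemma operator_of_system_of_operator:
  assumes "equivariant_operator G M \<pi>" "g \<in> Mor G"
  shows "operator_of_system G M (system_of_operator G \<pi>) g = \<pi> g"
  unfolding operator_of_system_def system_of_operator_def by (rule equivariant_eq_translate[OF assms, symmetric])

lemma ac_prob_system_of_operator:
  assumes \<pi>: "equivariant_operator G M \<pi>" and ac: "ac_operator G l \<pi>"
  shows "ac_prob_system G M l (system_of_operator G \<pi>)"
proof -
  note \<pi>D = equivariant_operatorD[OF \<pi>]
  have "(\<lambda>x. \<integral>\<^sup>+g. f g \<partial>\<pi> (unit G x)) \<in> borel_measurable (obj_algebra G M)" if "f \<in> borel_measurable M" for f
    using measurable_compose[OF unit_measurable kernel_op_measurable[OF \<pi>D(1) that]] by (simp add: kernel_op_def)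
  moreover have "AE g in \<pi> (unit G x). g \<in> fibre G x" "absolutely_continuous (l x) (\<pi> (unit G x))"
    if x: "x \<in> Obj G" for x
    using \<pi>D(5)[OF unit_Mor[OF x]] bspec[OF ac[unfolded ac_operator_def] unit_Mor[OF x]] tgt_unit[OF x] by simp_all
  ultimately show ?thesis
    using \<pi>D(2,3) unit_Mor unfolding ac_prob_system_def fibred_system_def system_of_operator_def by simp
qed

lemma prob_system_measurable:
  assumes "fibred_system G M \<theta>" "\<And>x. x \<in> Obj G \<Longrightarrow> prob_space (\<theta> x)"
  shows "\<theta> \<in> obj_algebra G M \<rightarrow>\<^sub>M prob_algebra M"
  using assms fibred_systemD[OF assms(1)] fibred_system_emeasure_measurable[OF assms(1)]
  by (intro measurable_prob_algebraI measurable_subprob_algebra)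
    (auto simp: space_obj_algebra intro: prob_space_imp_subprob_space)

lemma operator_of_ac_prob_system:
  assumes \<theta>: "ac_prob_system G M l \<theta>"
  shows "equivariant_operator G M (operator_of_system G M \<theta>)" "ac_operator G l (operator_of_system G M \<theta>)"
proof -
  have fib: "fibred_system G M \<theta>" and prob: "\<And>x. x \<in> Obj G \<Longrightarrow> prob_space (\<theta> x)"
    and ac: "\<And>x. x \<in> Obj G \<Longrightarrow> absolutely_continuous (l x) (\<theta> x)"
    using \<theta> by (auto simp: ac_prob_system_def)
  note \<theta>D = fibred_systemD[OF fib]
  show "ac_operator G l (operator_of_system G M \<theta>)"
    unfolding ac_operator_def operator_of_system_def
    by (intro ballI translate_absolutely_continuous \<theta>D ac src_Obj)
  have full: "emeasure (translate G M g (\<theta> (src G g))) {k\<in>space M. k \<in> fibre G (tgt G g)} = 1" if g: "g \<in> Mor G" for g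
  proof -
    interpret prob_space "\<theta> (src G g)" by (rule prob[OF src_Obj[OF g]])
    have F: "fibre G (tgt G g) \<in> sets M" "{k\<in>space M. k \<in> fibre G (tgt G g)} = fibre G (tgt G g)"
      using fibre_sets[OF tgt_Obj[OF g]] by (auto simp: fibre_def space_M)
    have "{h \<in> fibre G (src G g). mult G g h \<in> fibre G (tgt G g)} = fibre G (src G g)"
      using mult_fibre[OF g] by auto
    then show ?thesis
      using AE_in_set_eq_1[of "fibre G (src G g)"] \<theta>D[OF src_Obj[OF g]] fibre_sets[OF src_Obj[OF g]]
        emeasure_translate[OF g \<theta>D(1)[OF src_Obj[OF g]] F(1)] F(2)
      by (simp add: emeasure_eq_measure)
  qed
  have prob_t: "prob_space (translate G M g (\<theta> (src G g)))" if g: "g \<in> Mor G" for g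
  proof
    interpret prob_space "\<theta> (src G g)" by (rule prob[OF src_Obj[OF g]])
    have "{h \<in> fibre G (src G g). mult G g h \<in> space M} = fibre G (src G g)"
      using mult_fibre[OF g] by (auto simp: fibre_def space_M)
    then show "emeasure (translate G M g (\<theta> (src G g))) (space (translate G M g (\<theta> (src G g)))) = 1"
      using AE_in_set_eq_1[of "fibre G (src G g)"] \<theta>D[OF src_Obj[OF g]] fibre_sets[OF src_Obj[OF g]]
        emeasure_translate[OF g \<theta>D(1)[OF src_Obj[OF g]] sets.top]
      by (simp add: emeasure_eq_measure translate_def)
  qed
  show "equivariant_operator G M (operator_of_system G M \<theta>)"
  proof (rule equivariant_operatorI)
    show "operator_of_system G M \<theta> \<in> M \<rightarrow>\<^sub>M prob_algebra M"
    proof (rule measurable_prob_algebraI)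
      show "operator_of_system G M \<theta> \<in> M \<rightarrow>\<^sub>M subprob_algebra M"
      proof (rule measurable_subprob_algebra)
        fix A assume A: "A \<in> sets M"
        \<comment> \<open>The slice at \<open>g\<close> of the set of composable pairs with product
          in \<open>A\<close> is the set whose \<open>\<theta> (src G g)\<close>-measure is that of
          \<open>A\<close> under the operator. Measurability in \<open>g\<close> thus comes from
          joint measurability of the product.\<close>
        have "(\<lambda>(g, h). mult G g h) -` A \<inter> composable G \<in> sets (restrict_space (M \<Otimes>\<^sub>M M) (composable G))"
          using measurable_sets[OF mult_measurable A] sets.sets_into_space[OF composable_sets]
          by (simp add: space_restrict_space Int_absorb2)
        then have "(\<lambda>(g, h). mult G g h) -` A \<inter> composable G \<in> sets (M \<Otimes>\<^sub>M M)"
          using composable_sets sets.sets_into_space[OF composable_sets]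
          by (subst (asm) sets_restrict_space_iff) (auto simp: Int_absorb2)
        also have "(\<lambda>(g, h). mult G g h) -` A \<inter> composable G
            = (SIGMA g:space M. {h \<in> fibre G (src G g). mult G g h \<in> A})"
          by (auto simp: composable_def fibre_def space_M)
        finally have "(\<lambda>g. emeasure (\<theta> (src G g)) {h \<in> fibre G (src G g). mult G g h \<in> A}) \<in> borel_measurable M"
          by (rule emeasure_measurable_subprob_algebra2)
            (rule measurable_compose[OF src_measurable measurable_prob_algebraD[OF prob_system_measurable[OF fib prob]]])
        then show "(\<lambda>g. emeasure (operator_of_system G M \<theta> g) A) \<in> borel_measurable M"
          by (rule measurable_cong[THEN iffD1, rotated])
            (simp add: operator_of_system_def emeasure_translate \<theta>D src_Obj A space_M)
      qed (auto simp: operator_of_system_def space_M intro: prob_space_imp_subprob_space prob_t)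
    qed (auto simp: operator_of_system_def space_M intro: prob_t)
    show "AE h in operator_of_system G M \<theta> g. h \<in> fibre G (tgt G g)" if g: "g \<in> Mor G" for g
      unfolding operator_of_system_def
      using full[OF g] fibre_sets[OF tgt_Obj[OF g]]
      by (intro prob_space.AE_in_set_eq_1[OF prob_t[OF g], THEN iffD2])
        (auto simp: measure_def fibre_def space_M)
    show "operator_of_system G M \<theta> (mult G g h) = translate G M g (operator_of_system G M \<theta> h)"
      if "(g, h) \<in> composable G" for g h
      using translate_mult[OF that] \<theta>D(1)[OF src_Obj] that src_mult[OF that]
      by (auto simp: operator_of_system_def composable_def)
  qed
qed

lemma operator_of_system_unit:
  assumes "ac_prob_system G M l \<theta>" "x \<in> Obj G"
  shows "operator_of_system G M \<theta> (unit G x) = \<theta> x"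
  using assms fibred_systemD[of \<theta>, OF _ assms(2)] translate_unit[OF assms(2), of "\<theta> x"] src_unit[OF assms(2)]
  by (simp add: operator_of_system_def ac_prob_system_def)

lemma equivariant_return: "equivariant_operator G M (return M)"
proof (rule equivariant_operatorI)
  show "AE h in return M g. h \<in> fibre G (tgt G g)" if "g \<in> Mor G" for g
  proof -
    note fibre_sets[OF tgt_Obj[OF that], measurable]
    have "Measurable.pred M (\<lambda>h. h \<in> fibre G (tgt G g))" by measurable
    then show ?thesis using that by (subst AE_return) (auto simp: space_M fibre_def)
  qed
  show "return M (mult G g h) = translate G M g (return M h)" if gh: "(g, h) \<in> composable G" for g h
  proof (rule measure_eqI)
    have g: "g \<in> Mor G" and h: "h \<in> fibre G (src G g)" using gh by (auto simp: composable_def fibre_def)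
    fix A assume "A \<in> sets (return M (mult G g h))"
    then have A: "A \<in> sets M" by simp
    show "emeasure (return M (mult G g h)) A = emeasure (translate G M g (return M h)) A"
      using emeasure_translate[OF g _ A, of "return M h"] translate_vimage_sets[OF g A] A h
      by (simp add: indicator_def)
  qed simp
qed (rule measurable_return_prob_space)

lemma operator_prod_measurable:
  assumes "\<pi> \<in> M \<rightarrow>\<^sub>M prob_algebra M" "\<rho> \<in> M \<rightarrow>\<^sub>M prob_algebra M"
  shows "operator_prod \<pi> \<rho> \<in> M \<rightarrow>\<^sub>M prob_algebra M"
  using measurable_bind_prob_space[OF assms] by (simp add: operator_prod_def[abs_def])

lemma emeasure_operator_prod:
  assumes "\<pi> \<in> M \<rightarrow>\<^sub>M prob_algebra M" "\<rho> \<in> M \<rightarrow>\<^sub>M prob_algebra M" "g \<in> Mor G" "A \<in> sets M"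
  shows "emeasure (operator_prod \<pi> \<rho> g) A = (\<integral>\<^sup>+h. emeasure (\<rho> h) A \<partial>\<pi> g)"
  unfolding operator_prod_def
  by (rule emeasure_bind_prob_algebra[OF _ assms(2,4)]) (use measurable_space[OF assms(1)] assms(3) in \<open>simp add: space_M\<close>)

text \<open>The product at \<open>g\<close> averages \<open>\<rho> h\<close> over \<open>h\<close>
  in the target fibre of \<open>g\<close>, and all these measures are absolutely continuous with
  respect to the same \<open>l (tgt G g)\<close>.\<close>

lemma ac_operator_prod:
  assumes \<pi>: "equivariant_operator G M \<pi>" and \<rho>: "equivariant_operator G M \<rho>" and ac: "ac_operator G l \<rho>"
  shows "ac_operator G l (operator_prod \<pi> \<rho>)"
  unfolding ac_operator_def absolutely_continuous_def
proof (intro ballI subsetI)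
  note \<pi>D = equivariant_operatorD[OF \<pi>] and \<rho>D = equivariant_operatorD[OF \<rho>]
  fix g A assume g: "g \<in> Mor G" and A: "A \<in> null_sets (l (tgt G g))"
  then have AM: "A \<in> sets M" using sets_l[OF tgt_Obj[OF g]] by auto
  have "AE h in \<pi> g. emeasure (\<rho> h) A = 0"
    using \<pi>D(5)[OF g]
  proof eventually_elim
    case (elim h)
    then have "h \<in> Mor G" "tgt G h = tgt G g" by (auto simp: fibre_def)
    then have "A \<in> null_sets (\<rho> h)"
      using ac A unfolding ac_operator_def absolutely_continuous_def by (metis subsetD)
    then show ?case by auto
  qed
  then have "emeasure (operator_prod \<pi> \<rho> g) A = 0"
    unfolding emeasure_operator_prod[OF \<pi>D(1) \<rho>D(1) g AM]
    by (subst nn_integral_cong_AE[where v="\<lambda>_. 0"]) auto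
  moreover have "sets (operator_prod \<pi> \<rho> g) = sets M"
    using prob_kernelD(2)[OF operator_prod_measurable[OF \<pi>D(1) \<rho>D(1)]] g by (simp add: space_M)
  ultimately show "A \<in> null_sets (operator_prod \<pi> \<rho> g)" using AM by auto
qed

lemma equivariant_operator_prod:
  assumes \<pi>: "equivariant_operator G M \<pi>" and \<rho>: "equivariant_operator G M \<rho>"
  shows "equivariant_operator G M (operator_prod \<pi> \<rho>)"
proof (rule equivariant_operatorI)
  note \<pi>D = equivariant_operatorD[OF \<pi>] and \<rho>D = equivariant_operatorD[OF \<rho>]
  show m: "operator_prod \<pi> \<rho> \<in> M \<rightarrow>\<^sub>M prob_algebra M" by (rule operator_prod_measurable[OF \<pi>D(1) \<rho>D(1)])
  have sets_prod: "sets (operator_prod \<pi> \<rho> g) = sets M" if "g \<in> Mor G" for g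
    using prob_kernelD(2)[OF m] that by (simp add: space_M)
  show "AE h in operator_prod \<pi> \<rho> g. h \<in> fibre G (tgt G g)" if g: "g \<in> Mor G" for g
  proof (rule AE_I')
    have C: "space M - fibre G (tgt G g) \<in> sets M" using fibre_sets[OF tgt_Obj[OF g]] by auto
    have "AE h in \<pi> g. emeasure (\<rho> h) (space M - fibre G (tgt G g)) = 0"
      using \<pi>D(5)[OF g]
    proof eventually_elim
      case (elim h)
      then have h: "h \<in> Mor G" "tgt G h = tgt G g" by (auto simp: fibre_def)
      have "space M - fibre G (tgt G g) \<in> null_sets (\<rho> h)"
        using \<rho>D(5)[OF h(1)] C \<rho>D(3)[OF h(1)] h(2)
        by (subst AE_iff_null_sets) (auto elim!: eventually_mono)
      then show ?case by auto
    qed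
    then have "emeasure (operator_prod \<pi> \<rho> g) (space M - fibre G (tgt G g)) = 0"
      unfolding emeasure_operator_prod[OF \<pi>D(1) \<rho>D(1) g C]
      by (subst nn_integral_cong_AE[where v="\<lambda>_. 0"]) auto
    then show "space M - fibre G (tgt G g) \<in> null_sets (operator_prod \<pi> \<rho> g)"
      using C sets_prod[OF g] by auto
    show "{h \<in> space (operator_prod \<pi> \<rho> g). h \<notin> fibre G (tgt G g)} \<subseteq> space M - fibre G (tgt G g)"
      using sets_eq_imp_space_eq[OF sets_prod[OF g]] by auto
  qed
  show "operator_prod \<pi> \<rho> (mult G g h) = translate G M g (operator_prod \<pi> \<rho> h)"
    if gh: "(g, h) \<in> composable G" for g h
  proof (rule measure_eqI)
    have g: "g \<in> Mor G" and h: "h \<in> Mor G" and eq: "tgt G h = src G g" using gh by (auto simp: composable_def)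
    note ghM = mult_Mor[OF gh]
    show "sets (operator_prod \<pi> \<rho> (mult G g h)) = sets (translate G M g (operator_prod \<pi> \<rho> h))"
      using sets_prod[OF ghM] by simp
    fix A assume "A \<in> sets (operator_prod \<pi> \<rho> (mult G g h))"
    then have A: "A \<in> sets M" using sets_prod[OF ghM] by simp
    have \<rho>A: "(\<lambda>k. emeasure (\<rho> k) A) \<in> borel_measurable M"
      by (rule measurable_compose[OF measurable_prob_algebraD[OF \<rho>D(1)] measurable_emeasure_subprob_algebra[OF A]])
    have "emeasure (operator_prod \<pi> \<rho> (mult G g h)) A = (\<integral>\<^sup>+k. emeasure (\<rho> k) A \<partial>translate G M g (\<pi> h))"
      using emeasure_operator_prod[OF \<pi>D(1) \<rho>D(1) ghM A] \<pi>D(6)[OF gh] by simp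
    also have "\<dots> = (\<integral>\<^sup>+k. emeasure (\<rho> (mult G g k)) A * indicator (fibre G (src G g)) k \<partial>\<pi> h)"
      by (rule nn_integral_translate[OF g \<pi>D(3)[OF h] \<rho>A])
    also have "\<dots> = (\<integral>\<^sup>+k. emeasure (\<rho> k) {j \<in> fibre G (src G g). mult G g j \<in> A} \<partial>\<pi> h)"
    proof (rule nn_integral_cong_AE)
      \<comment> \<open>\<open>\<pi> h\<close> is carried by the fibre over
        \<open>tgt G h = src G g\<close>, where the indicator is 1 and equivariance of
        \<open>\<rho>\<close> applies.\<close>
      show "AE k in \<pi> h. emeasure (\<rho> (mult G g k)) A * indicator (fibre G (src G g)) k
          = emeasure (\<rho> k) {j \<in> fibre G (src G g). mult G g j \<in> A}"
        using \<pi>D(5)[OF h]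
      proof eventually_elim
        case (elim k)
        then have k: "k \<in> Mor G" "k \<in> fibre G (src G g)" using eq by (auto simp: fibre_def)
        then show ?case
          using \<rho>D(6)[OF composableI[OF g k(2)]] emeasure_translate[OF g \<rho>D(3)[OF k(1)] A] by simp
      qed
    qed
    also have "\<dots> = emeasure (operator_prod \<pi> \<rho> h) {j \<in> fibre G (src G g). mult G g j \<in> A}"
      by (rule emeasure_operator_prod[OF \<pi>D(1) \<rho>D(1) h translate_vimage_sets[OF g A], symmetric])
    also have "\<dots> = emeasure (translate G M g (operator_prod \<pi> \<rho> h)) A"
      by (rule emeasure_translate[OF g sets_prod[OF h] A, symmetric])
    finally show "emeasure (operator_prod \<pi> \<rho> (mult G g h)) A = emeasure (translate G M g (operator_prod \<pi> \<rho> h)) A" .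
  qed
qed

lemma equivariant_operator_power:
  assumes "equivariant_operator G M \<pi>" shows "equivariant_operator G M (operator_power M \<pi> n)"
  by (induction n) (simp_all add: equivariant_return equivariant_operator_prod assms)

text \<open>Exponents start at 1: the zeroth power \<open>return M\<close> consists of point masses,
  which in general are not absolutely continuous.\<close>

lemma ac_operator_power:
  assumes "equivariant_operator G M \<pi>" "ac_operator G l \<pi>" shows "ac_operator G l (operator_power M \<pi> (Suc n))"
  using ac_operator_prod[OF equivariant_operator_power[OF assms(1)] assms] by simp

text \<open>An operator recovered from its system agrees with the original on \<open>Mor G\<close>,
  and powers at morphisms see no other arguments.\<close>

lemma operator_power_cong:
  assumes "\<pi> \<in> M \<rightarrow>\<^sub>M prob_algebra M" and eq: "\<And>g. g \<in> Mor G \<Longrightarrow> \<rho> g = \<pi> g" and g: "g \<in> Mor G"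
  shows "operator_power M \<rho> n g = operator_power M \<pi> n g"
  using g
proof (induction n)
  case (Suc n)
  have "operator_power M \<pi> n \<in> M \<rightarrow>\<^sub>M prob_algebra M"
    by (induction n) (auto intro: operator_prod_measurable assms(1))
  then have "space (operator_power M \<pi> n g) = Mor G" using prob_kernelD(3)[of _ M M g] Suc.prems by (simp add: space_M)
  then show ?case using Suc eq by (simp add: operator_prod_def cong: bind_cong_simp)
qed simp

text \<open>Powers of an equivariant operator are equivariant, hence determined by their values at
  units. So equality at units for one exponent gives equality of operators, which in turn gives
  equality at units for the next.\<close>

lemma convolution_power_eq_operator_power:
  assumes \<theta>: "ac_prob_system G M l \<theta>"
  shows "x \<in> Obj G \<Longrightarrow> convolution_power G M \<theta> n x = operator_power M (operator_of_system G M \<theta>) n (unit G x)"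
    "g \<in> Mor G \<Longrightarrow> operator_of_system G M (convolution_power G M \<theta> n) g
       = operator_power M (operator_of_system G M \<theta>) n g"
proof -
  let ?\<pi> = "operator_of_system G M \<theta>"
  have eqv: "equivariant_operator G M (operator_power M ?\<pi> n)" for n
    by (rule equivariant_operator_power[OF operator_of_ac_prob_system(1)[OF \<theta>]])
  have step: "operator_of_system G M (convolution_power G M \<theta> n) g = operator_power M ?\<pi> n g"
    if "\<And>x. x \<in> Obj G \<Longrightarrow> convolution_power G M \<theta> n x = operator_power M ?\<pi> n (unit G x)" "g \<in> Mor G" for n g
    using equivariant_eq_translate[OF eqv that(2)] that(1)[OF src_Obj[OF that(2)]] by (simp add: operator_of_system_def)
  have conv: "x \<in> Obj G \<Longrightarrow> convolution_power G M \<theta> n x = operator_power M ?\<pi> n (unit G x)" for n x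
  proof (induction n arbitrary: x)
    case (Suc n)
    then show ?case using step[OF Suc.IH unit_Mor]
      by (simp add: convolution_def system_of_operator_def operator_prod_def)
  qed simp
  show "x \<in> Obj G \<Longrightarrow> convolution_power G M \<theta> n x = operator_power M ?\<pi> n (unit G x)" by (rule conv)
  show "g \<in> Mor G \<Longrightarrow> operator_of_system G M (convolution_power G M \<theta> n) g = operator_power M ?\<pi> n g"
    by (rule step[OF conv])
qed

lemma ac_prob_system_cong:
  assumes "ac_prob_system G M l \<theta>" "\<And>x. x \<in> Obj G \<Longrightarrow> \<theta>' x = \<theta> x"
  shows "ac_prob_system G M l \<theta>'"
proof -
  have "(\<lambda>x. \<integral>\<^sup>+g. f g \<partial>\<theta>' x) \<in> borel_measurable (obj_algebra G M)
      \<longleftrightarrow> (\<lambda>x. \<integral>\<^sup>+g. f g \<partial>\<theta> x) \<in> borel_measurable (obj_algebra G M)" for f :: "'g \<Rightarrow> ennreal"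
    by (rule measurable_cong) (simp add: assms(2) space_obj_algebra)
  moreover have "AE g in \<theta>' x. g \<in> fibre G x" if "x \<in> Obj G" for x
    unfolding assms(2)[OF that] using assms(1) that by (simp add: ac_prob_system_def fibred_system_def)
  ultimately show ?thesis using assms(1) unfolding ac_prob_system_def fibred_system_def by (auto simp: assms(2))
qed

lemma ac_prob_system_convolution_power:
  assumes \<theta>: "ac_prob_system G M l \<theta>"
  shows "ac_prob_system G M l (convolution_power G M \<theta> (Suc n))"
proof -
  note \<pi> = operator_of_ac_prob_system[OF \<theta>]
  have "ac_prob_system G M l (system_of_operator G (operator_power M (operator_of_system G M \<theta>) (Suc n)))"
    by (intro ac_prob_system_of_operator equivariant_operator_power ac_operator_power \<pi>)
  then show ?thesis
    by (rule ac_prob_system_cong)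
      (simp only: convolution_power_eq_operator_power(1)[OF \<theta>] system_of_operator_def)
qed

end

section \<open>Integrals against operator powers, and two convergence criteria\<close>

text \<open>Operators act on measures from the right and on functions from the left, so the last
  factor of the power is the first to act on \<open>f\<close>.\<close>

lemma nn_integral_operator_power:
  assumes \<pi>: "\<pi> \<in> M \<rightarrow>\<^sub>M prob_algebra M" and f: "f \<in> borel_measurable M" and g: "g \<in> space M"
  shows "(\<integral>\<^sup>+h. f h \<partial>operator_power M \<pi> n g) = (kernel_op \<pi> ^^ n) f g"
  using f
proof (induction n arbitrary: f)
  case 0
  then show ?case using g by (simp add: nn_integral_return)
next
  case (Suc n)
  have "operator_power M \<pi> n \<in> M \<rightarrow>\<^sub>M prob_algebra M"
    by (induction n) (auto simp: operator_prod_def[abs_def] intro: measurable_bind_prob_space \<pi>)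
  then have "\<pi> \<in> operator_power M \<pi> n g \<rightarrow>\<^sub>M subprob_algebra M"
    using measurable_prob_algebraD[OF \<pi>] prob_kernelD(2)[OF _ g] by (metis measurable_cong_sets)
  then have "(\<integral>\<^sup>+h. f h \<partial>operator_power M \<pi> (Suc n) g) = (\<integral>\<^sup>+h. kernel_op \<pi> f h \<partial>operator_power M \<pi> n g)"
    by (simp add: operator_prod_def kernel_op_def nn_integral_bind[OF Suc.prems])
  also have "\<dots> = (kernel_op \<pi> ^^ n) (kernel_op \<pi> f) g"
    by (rule Suc.IH[OF kernel_op_measurable[OF \<pi> Suc.prems]])
  finally show ?case by (simp add: funpow_swap1)
qed

text \<open>The bound by 1 makes the functions real valued and integrable, which reduces the claim
  to the subsequence theorem for convergence in L1.\<close>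

lemma nn_integral_tendsto_0_AE_subseq:
  fixes f :: "nat \<Rightarrow> 'a \<Rightarrow> ennreal"
  assumes fin: "finite_measure m" and f: "\<And>n. f n \<in> borel_measurable m" and le: "\<And>n x. f n x \<le> 1"
    and lim: "(\<lambda>n. \<integral>\<^sup>+x. f n x \<partial>m) \<longlonglongrightarrow> 0"
  obtains r :: "nat \<Rightarrow> nat" where "AE x in m. (\<lambda>n. f (r n) x) \<longlonglongrightarrow> 0"
proof -
  interpret finite_measure m by fact
  define u where "u n x = enn2real (f n x)" for n x
  have u: "ennreal (u n x) = f n x" for n x
    unfolding u_def using le[of n x] by (intro ennreal_enn2real) (auto simp: less_top[symmetric] top_unique)
  have u_nonneg: "0 \<le> u n x" for n x by (simp add: u_def)
  have u_le: "norm (u n x) \<le> 1" for n x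
    using le[of n x] by (simp add: u_def enn2real_leI)
  have um[measurable]: "u n \<in> borel_measurable m" for n unfolding u_def using f by measurable
  have int: "integrable m (u n)" for n
    by (rule integrable_const_bound[of _ 1]) (use u_le in auto)
  have "(\<integral>x. norm (u n x) \<partial>m) = enn2real (\<integral>\<^sup>+x. f n x \<partial>m)" for n
    by (subst integral_eq_nn_integral) (auto simp: u u_nonneg)
  moreover have "(\<lambda>n. enn2real (\<integral>\<^sup>+x. f n x \<partial>m)) \<longlonglongrightarrow> 0"
    using lim by (intro tendsto_enn2real) auto
  ultimately have "(\<lambda>n. \<integral>x. norm (u n x) \<partial>m) \<longlonglongrightarrow> 0" by simp
  then obtain r :: "nat \<Rightarrow> nat" where "AE x in m. (\<lambda>n. u (r n) x) \<longlonglongrightarrow> 0"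
    using tendsto_L1_AE_subseq[of m u, OF int] by blast
  then have "AE x in m. (\<lambda>n. f (r n) x) \<longlonglongrightarrow> 0"
    by eventually_elim (use tendsto_ennrealI[of _ 0] in \<open>fastforce simp: u\<close>)
  then show thesis by (rule that)
qed

lemma ennreal_tendsto_0I:
  fixes f :: "nat \<Rightarrow> ennreal"
  assumes "\<And>\<epsilon>. \<epsilon> > 0 \<Longrightarrow> \<exists>n0. \<forall>n\<ge>n0. f n \<le> ennreal \<epsilon>"
  shows "f \<longlonglongrightarrow> 0"
proof (rule order_tendstoI)
  fix a :: ennreal assume "0 < a"
  then obtain y where y: "0 < y" "y < a" using dense by blast
  then obtain r where r: "y = ennreal r" "r \<ge> 0" by (cases y) (auto simp: top_unique)
  then have "r > 0" using y(1) by simp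
  then obtain n0 where "\<forall>n\<ge>n0. f n \<le> ennreal r" using assms by blast
  then show "\<forall>\<^sub>F n in sequentially. f n < a"
    using y r by (intro eventually_sequentiallyI[of n0]) (auto intro: le_less_trans)
qed simp

section \<open>The measurable defect\<close>

context measured_groupoid
begin

text \<open>The target of \<open>g\<close>, identified with its unit morphism. It plays the role of
  \<open>e\<close> in the abstract argument.\<close>

definition base :: "'g \<Rightarrow> 'g" where
  "base g = unit G (tgt G g)"

lemma base_measurable: "base \<in> M \<rightarrow>\<^sub>M M"
  unfolding base_def[abs_def] by (rule measurable_compose[OF tgt_measurable unit_measurable])

lemma base_Mor: "g \<in> Mor G \<Longrightarrow> base g \<in> Mor G"
  and tgt_base: "g \<in> Mor G \<Longrightarrow> tgt G (base g) = tgt G g"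
  and base_base: "g \<in> Mor G \<Longrightarrow> base (base g) = base g"
  by (simp_all add: base_def unit_Mor tgt_unit tgt_Obj)

definition test_sets :: "'g set set" where
  "test_sets = boolean_combinations (Mor G) separating_family"

lemma test_sets: "countable test_sets" "test_sets \<subseteq> sets M" "test_sets \<noteq> {}"
  unfolding test_sets_def
  using countable_boolean_combinations[OF separating_family(1)]
    boolean_combinations_sets[OF separating_family(2)] empty_boolean_combinations[of "Mor G" separating_family]
  by (auto simp: space_M)

text \<open>Up to a factor of two this is the total variation distance of \<open>\<pi> g\<close> and \<open>\<pi> (base g)\<close>; unlike
  the latter it is visibly measurable in \<open>g\<close>.\<close>

definition defect :: "('g \<Rightarrow> 'g measure) \<Rightarrow> 'g \<Rightarrow> ennreal" where
  "defect \<pi> g = (SUP A\<in>test_sets. ennreal \<bar>measure (\<pi> g) A - measure (\<pi> (base g)) A\<bar>)"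

lemma defect_measurable:
  assumes "\<pi> \<in> M \<rightarrow>\<^sub>M prob_algebra M" shows "defect \<pi> \<in> borel_measurable M"
  unfolding defect_def[abs_def]
proof (rule borel_measurable_SUP[OF test_sets(1)])
  fix A assume "A \<in> test_sets"
  then have A: "A \<in> sets M" using test_sets(2) by auto
  have [measurable]: "(\<lambda>g. measure (\<pi> g) A) \<in> borel_measurable M"
    by (rule measurable_compose[OF assms measurable_measure_prob_algebra[OF A]])
  have [measurable]: "(\<lambda>g. measure (\<pi> (base g)) A) \<in> borel_measurable M"
    by (rule measurable_compose[OF base_measurable]) measurable
  show "(\<lambda>g. ennreal \<bar>measure (\<pi> g) A - measure (\<pi> (base g)) A\<bar>) \<in> borel_measurable M" by measurable
qed

lemma defect_base: "g \<in> Mor G \<Longrightarrow> defect \<pi> (base g) = 0"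
  using test_sets(3) by (simp add: defect_def base_base)

lemma defect_le_tv_norm_diff:
  assumes "equivariant_operator G M \<pi>" "g \<in> Mor G"
  shows "defect \<pi> g \<le> tv_norm_diff (\<pi> g) (\<pi> (base g))"
  unfolding defect_def
  using test_sets(2) equivariant_operatorD(3)[OF assms] by (intro SUP_least tv_norm_diff_ge) auto

text \<open>Both measures are absolutely continuous with respect to \<open>l (tgt G g)\<close>,
  which is Lebesgue--Rokhlin, and the common family separates the points of this space as
  well.\<close>

lemma tv_norm_diff_le_defect:
  assumes \<pi>: "equivariant_operator G M \<pi>" and ac: "ac_operator G l \<pi>" and g: "g \<in> Mor G"
  shows "tv_norm_diff (\<pi> g) (\<pi> (base g)) \<le> 2 * defect \<pi> g"
proof -
  note \<pi>D = equivariant_operatorD[OF \<pi>] and bg = base_Mor[OF g] and x = tgt_Obj[OF g]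
  have "absolutely_continuous (l (tgt G g)) (\<pi> g)" "absolutely_continuous (l (tgt G g)) (\<pi> (base g))"
    using ac g bg tgt_base[OF g] unfolding ac_operator_def by metis+
  then show ?thesis
    using tv_norm_diff_le_boolean_combinations[OF rokhlin_l[OF x] \<pi>D(2)[OF g] \<pi>D(2)[OF bg], of separating_family]
      \<pi>D(3)[OF g] \<pi>D(3)[OF bg] sets_l[OF x] fibred_systemD(2)[OF fibred_l x] separating_family
    unfolding defect_def test_sets_def by simp
qed

text \<open>The norm lies between the defect and twice the defect, so both tend to 0
  together.\<close>

lemma asymp_invariant_operators_iff_defect:
  assumes \<pi>: "\<And>n. equivariant_operator G M (P n)" and ac: "\<And>n. ac_operator G l (P n)"
  shows "asymp_invariant_operators G M l \<kappa> P \<longleftrightarrow>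
    (AE g in star_measure M l \<kappa>. (\<lambda>n. defect (P n) g) \<longlonglongrightarrow> 0)"
  unfolding asymp_invariant_operators_def
proof (rule AE_cong)
  fix g assume "g \<in> space (star_measure M l \<kappa>)"
  then have g: "g \<in> Mor G" by (simp add: space_star)
  have bind: "bind (return M h) (P n) = P n h" if "h \<in> Mor G" for n h
    using that by (intro bind_return[of _ M M] measurable_prob_algebraD equivariant_operatorD(1)[OF \<pi>]) (simp add: space_M)
  have "((\<lambda>n. tv_norm_diff (P n g) (P n (base g))) \<longlonglongrightarrow> 0) \<longleftrightarrow> (\<lambda>n. defect (P n) g) \<longlonglongrightarrow> 0"
  proof
    assume "(\<lambda>n. tv_norm_diff (P n g) (P n (base g))) \<longlonglongrightarrow> 0"
    then show "(\<lambda>n. defect (P n) g) \<longlonglongrightarrow> 0"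
      by (rule tendsto_sandwich[OF _ _ tendsto_const, rotated 2])
        (auto intro: always_eventually defect_le_tv_norm_diff[OF \<pi> g])
  next
    assume "(\<lambda>n. defect (P n) g) \<longlonglongrightarrow> 0"
    then have "(\<lambda>n. 2 * defect (P n) g) \<longlonglongrightarrow> 2 * 0" by (intro ennreal_tendsto_cmult) auto
    then have "(\<lambda>n. 2 * defect (P n) g) \<longlonglongrightarrow> 0" by simp
    then show "(\<lambda>n. tv_norm_diff (P n g) (P n (base g))) \<longlonglongrightarrow> 0"
      by (rule tendsto_sandwich[OF _ _ tendsto_const, rotated 2])
        (auto intro: always_eventually tv_norm_diff_le_defect[OF \<pi> ac g])
  qed
  then show "((\<lambda>n. tv_norm_diff (bind (return M g) (P n)) (bind (return M (unit G (tgt G g))) (P n))) \<longlonglongrightarrow> 0)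
      \<longleftrightarrow> (\<lambda>n. defect (P n) g) \<longlonglongrightarrow> 0"
    using bind[OF g] bind[OF base_Mor[OF g]] by (simp add: base_def)
qed

lemma tv_norm_diff_system:
  assumes "ac_prob_system G M l \<theta>" "g \<in> Mor G"
  shows "tv_norm_diff (translate G M g (\<theta> (src G g))) (\<theta> (tgt G g))
    = tv_norm_diff (operator_of_system G M \<theta> g) (operator_of_system G M \<theta> (base g))"
  using operator_of_system_unit[OF assms(1) tgt_Obj[OF assms(2)]] by (simp add: operator_of_system_def base_def)

lemma asymp_invariant_systems_iff_operators:
  assumes \<theta>: "\<And>n. ac_prob_system G M l (\<theta> n)"
  shows "asymp_invariant_systems G M l \<kappa> \<theta> \<longleftrightarrow>
    asymp_invariant_operators G M l \<kappa> (\<lambda>n. operator_of_system G M (\<theta> n))"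
  unfolding asymp_invariant_systems_def asymp_invariant_operators_def
proof (rule AE_cong)
  fix g assume "g \<in> space (star_measure M l \<kappa>)"
  then have g: "g \<in> Mor G" by (simp add: space_star)
  have bind: "bind (return M h) (operator_of_system G M (\<theta> n)) = operator_of_system G M (\<theta> n) h" if "h \<in> Mor G" for n h
    using that
    by (intro bind_return[of _ M M] measurable_prob_algebraD equivariant_operatorD(1) operator_of_ac_prob_system \<theta>)
      (simp add: space_M)
  show "((\<lambda>n. tv_norm_diff (translate G M g (\<theta> n (src G g))) (\<theta> n (tgt G g))) \<longlonglongrightarrow> 0)
    \<longleftrightarrow> (\<lambda>n. tv_norm_diff (bind (return M g) (operator_of_system G M (\<theta> n)))
          (bind (return M (unit G (tgt G g))) (operator_of_system G M (\<theta> n)))) \<longlonglongrightarrow> 0"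
    using bind[OF g] bind[OF base_Mor[OF g]] tv_norm_diff_system[OF \<theta> g] by (simp add: base_def)
qed

lemma defect_le_1:
  assumes "equivariant_operator G M \<pi>" "g \<in> Mor G" shows "defect \<pi> g \<le> 1"
  unfolding defect_def
proof (rule SUP_least)
  interpret p: prob_space "\<pi> g" by (rule equivariant_operatorD(2)[OF assms])
  interpret b: prob_space "\<pi> (base g)" by (rule equivariant_operatorD(2)[OF assms(1) base_Mor[OF assms(2)]])
  fix A
  have "\<bar>measure (\<pi> g) A - measure (\<pi> (base g)) A\<bar> \<le> 1"
    using p.prob_le_1[of A] b.prob_le_1[of A] measure_nonneg[of "\<pi> g" A] measure_nonneg[of "\<pi> (base g)" A] by linarith
  then show "ennreal \<bar>measure (\<pi> g) A - measure (\<pi> (base g)) A\<bar> \<le> 1" by simp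
qed

section \<open>Amenability and pointwise asymptotic invariance\<close>

text \<open>Weighting by a positive integrable function keeps the null sets. The result is finite,
  as the abstract argument asks, and after normalisation it can be inserted into the definition of
  amenability.\<close>

lemma finite_measure_equivalent_star:
  obtains \<mu> where "finite_measure \<mu>" "sets \<mu> = sets M" "space \<mu> = Mor G"
    "null_sets \<mu> = null_sets (star_measure M l \<kappa>)" "\<And>P. (AE g in \<mu>. P g) \<longleftrightarrow> (AE g in star_measure M l \<kappa>. P g)"
proof -
  interpret sigma_finite_measure "star_measure M l \<kappa>"
    using rokhlin_star by (simp add: lebesgue_rokhlin_def)
  obtain h where h: "h \<in> borel_measurable (star_measure M l \<kappa>)" "integral\<^sup>N (star_measure M l \<kappa>) h \<noteq> \<infinity>"
      "\<And>x. x \<in> space (star_measure M l \<kappa>) \<Longrightarrow> 0 < h x"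
    using Ex_finite_integrable_function by blast
  define \<mu> where "\<mu> = density (star_measure M l \<kappa>) h"
  have AE: "(AE g in \<mu>. P g) \<longleftrightarrow> (AE g in star_measure M l \<kappa>. P g)" for P
    unfolding \<mu>_def AE_density[OF h(1)] by (rule AE_cong) (use h(3) in auto)
  have sets: "sets \<mu> = sets (star_measure M l \<kappa>)" by (simp add: \<mu>_def)
  have "A \<in> null_sets \<mu> \<longleftrightarrow> A \<in> null_sets (star_measure M l \<kappa>)" for A
    using AE_iff_null_sets[of A \<mu>] AE_iff_null_sets[of A "star_measure M l \<kappa>"] AE[of "\<lambda>g. g \<notin> A"] sets
    by (metis null_setsD2)
  moreover have "finite_measure \<mu>"
    by (rule finite_measureI) (use h(1,2) in \<open>simp add: \<mu>_def emeasure_density cong: nn_integral_cong\<close>)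
  ultimately show thesis using that[of \<mu>] AE sets sets_star space_star by (auto simp: \<mu>_def)
qed

text \<open>Dominated convergence is applied to the measurable defect, which is at most 1; the
  variation norm enters only through monotonicity of the integral.\<close>

lemma amenable_if_asymp_invariant:
  assumes \<theta>: "\<And>n. ac_prob_system G M l (\<theta> n)" and inv: "asymp_invariant_systems G M l \<kappa> \<theta>"
  shows "amenable G M l \<kappa>"
  unfolding amenable_def
proof (intro exI[of _ \<theta>] conjI allI impI \<theta>)
  fix m assume m: "prob_space m \<and> sets m = sets M \<and> absolutely_continuous (star_measure M l \<kappa>) m"
  then interpret prob_space m by simp
  have sm: "sets m = sets M" and space_m: "space m = Mor G"
    using m sets_eq_imp_space_eq[of m M] space_M by auto
  define \<pi> where "\<pi> n = operator_of_system G M (\<theta> n)" for n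
  have \<pi>: "equivariant_operator G M (\<pi> n)" and ac: "ac_operator G l (\<pi> n)" for n
    unfolding \<pi>_def using operator_of_ac_prob_system[OF \<theta>] by auto
  have "AE g in star_measure M l \<kappa>. (\<lambda>n. defect (\<pi> n) g) \<longlonglongrightarrow> 0"
    using inv unfolding asymp_invariant_systems_iff_operators[OF \<theta>] \<pi>_def[symmetric]
      asymp_invariant_operators_iff_defect[of \<pi>, OF \<pi> ac] .
  then have ae: "AE g in m. (\<lambda>n. defect (\<pi> n) g) \<longlonglongrightarrow> 0"
    using m sets_star by (intro absolutely_continuous_AE[of m "star_measure M l \<kappa>"]) auto
  have dm: "defect (\<pi> n) \<in> borel_measurable m" for n
    using defect_measurable[OF equivariant_operatorD(1)[OF \<pi>]] measurable_cong_sets[OF sm refl] by blast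
  have lim: "(\<lambda>n. \<integral>\<^sup>+g. defect (\<pi> n) g \<partial>m) \<longlonglongrightarrow> (\<integral>\<^sup>+g. 0 \<partial>m)"
    using dm ae defect_le_1[OF \<pi>]
    by (intro nn_integral_dominated_convergence[where w="\<lambda>_. 1"]) (use emeasure_space_1 in \<open>auto simp: space_m\<close>)
  have "(\<lambda>n. 2 * (\<integral>\<^sup>+g. defect (\<pi> n) g \<partial>m)) \<longlonglongrightarrow> 2 * 0"
    using lim by (intro ennreal_tendsto_cmult) auto
  then have lim2: "(\<lambda>n. 2 * (\<integral>\<^sup>+g. defect (\<pi> n) g \<partial>m)) \<longlonglongrightarrow> 0" by simp
  have le: "(\<integral>\<^sup>+g. tv_norm_diff (translate G M g (\<theta> n (src G g))) (\<theta> n (tgt G g)) \<partial>m)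
      \<le> 2 * (\<integral>\<^sup>+g. defect (\<pi> n) g \<partial>m)" for n
  proof -
    have "(\<integral>\<^sup>+g. tv_norm_diff (translate G M g (\<theta> n (src G g))) (\<theta> n (tgt G g)) \<partial>m)
        \<le> (\<integral>\<^sup>+g. 2 * defect (\<pi> n) g \<partial>m)"
      using tv_norm_diff_system[OF \<theta>] tv_norm_diff_le_defect[OF \<pi> ac]
      by (intro nn_integral_mono) (simp add: space_m \<pi>_def)
    then show ?thesis using dm by (simp add: nn_integral_cmult)
  qed
  show "(\<lambda>n. \<integral>\<^sup>+g. tv_norm_diff (translate G M g (\<theta> n (src G g))) (\<theta> n (tgt G g)) \<partial>m) \<longlonglongrightarrow> 0"
    by (rule tendsto_sandwich[OF _ _ tendsto_const lim2]) (auto intro: always_eventually le)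
qed

text \<open>A single probability measure with the same null sets as the star measure suffices:
  convergence of the defect in mean becomes convergence almost everywhere along a
  subsequence.\<close>

lemma amenable_imp_asymp_invariant:
  assumes "amenable G M l \<kappa>"
  obtains \<theta> where "\<And>n. ac_prob_system G M l (\<theta> n)" "asymp_invariant_systems G M l \<kappa> \<theta>"
proof -
  obtain \<theta> where \<theta>: "\<And>n. ac_prob_system G M l (\<theta> n)"
    and lim: "\<And>m. prob_space m \<Longrightarrow> sets m = sets M \<Longrightarrow> absolutely_continuous (star_measure M l \<kappa>) m \<Longrightarrow>
      (\<lambda>n. \<integral>\<^sup>+g. tv_norm_diff (translate G M g (\<theta> n (src G g))) (\<theta> n (tgt G g)) \<partial>m) \<longlonglongrightarrow> 0"
    using assms unfolding amenable_def by blast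
  define \<pi> where "\<pi> n = operator_of_system G M (\<theta> n)" for n
  have \<pi>: "equivariant_operator G M (\<pi> n)" and ac: "ac_operator G l (\<pi> n)" for n
    unfolding \<pi>_def using operator_of_ac_prob_system[OF \<theta>] by auto
  obtain \<mu> where \<mu>: "finite_measure \<mu>" "sets \<mu> = sets M" "space \<mu> = Mor G"
    "null_sets \<mu> = null_sets (star_measure M l \<kappa>)" "\<And>P. (AE g in \<mu>. P g) \<longleftrightarrow> (AE g in star_measure M l \<kappa>. P g)"
    by (rule finite_measure_equivalent_star) (rule that)
  interpret \<mu>: finite_measure \<mu> by fact
  have dm: "defect (\<pi> n) \<in> borel_measurable M" for n
    by (rule defect_measurable[OF equivariant_operatorD(1)[OF \<pi>]])
  have "\<exists>r. AE g in star_measure M l \<kappa>. (\<lambda>n. defect (\<pi> (r n)) g) \<longlonglongrightarrow> 0"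
  \<comment> \<open>A zero measure cannot be normalised, but then every property holds almost
    everywhere.\<close>
  proof (cases "emeasure \<mu> (space \<mu>) = 0")
    case True
    then have "space \<mu> \<in> null_sets \<mu>" by auto
    then have "AE g in \<mu>. g \<notin> space \<mu>" by (rule AE_not_in)
    then have "AE g in \<mu>. False" using AE_space by eventually_elim auto
    then show ?thesis unfolding \<mu>(5) by (auto elim: eventually_mono)
  next
    case False
    define c where "c = emeasure \<mu> (space \<mu>)"
    have c: "c \<noteq> 0" "c < top" using False by (auto simp: c_def less_top[symmetric])
    define m where "m = density \<mu> (\<lambda>_. inverse c)"
    have m: "prob_space m"
    proof
      show "emeasure m (space m) = 1"
        using c ennreal_divide_self[of c]
        by (simp add: m_def emeasure_density c_def[symmetric] divide_ennreal_def mult.commute)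
    qed
    have inv_pos: "inverse c > 0" using c by (simp add: zero_less_iff_neq_zero ennreal_inverse_eq_0_iff)
    have AE_m: "(AE g in m. P g) \<longleftrightarrow> (AE g in star_measure M l \<kappa>. P g)" for P
      unfolding m_def \<mu>(5)[symmetric] using inv_pos by (subst AE_density) auto
    have sm: "sets m = sets M" and space_m: "space m = Mor G" using \<mu> by (auto simp: m_def)
    have ac_m: "absolutely_continuous (star_measure M l \<kappa>) m"
      unfolding absolutely_continuous_def
    proof
      fix A assume A: "A \<in> null_sets (star_measure M l \<kappa>)"
      then show "A \<in> null_sets m"
        using AE_iff_null_sets[of A m] AE_m[of "\<lambda>g. g \<notin> A"] AE_not_in[OF A] sm sets_star by auto
    qed
    have "(\<lambda>n. \<integral>\<^sup>+g. defect (\<pi> n) g \<partial>m) \<longlonglongrightarrow> 0"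
    proof (rule tendsto_sandwich[OF _ _ tendsto_const lim[OF m sm ac_m]])
      show "\<forall>\<^sub>F n in sequentially. (\<integral>\<^sup>+g. defect (\<pi> n) g \<partial>m)
          \<le> (\<integral>\<^sup>+g. tv_norm_diff (translate G M g (\<theta> n (src G g))) (\<theta> n (tgt G g)) \<partial>m)"
        using defect_le_tv_norm_diff[OF \<pi>] tv_norm_diff_system[OF \<theta>]
        by (intro always_eventually allI nn_integral_mono) (simp add: space_m \<pi>_def)
    qed simp
    \<comment> \<open>The bound by 1 is known for the defect on \<open>Mor G\<close> only, whereas
      the subsequence lemma asks for it on the whole type; \<open>min 1\<close> bridges
      this.\<close>
    moreover have "(\<integral>\<^sup>+g. min 1 (defect (\<pi> n) g) \<partial>m) = (\<integral>\<^sup>+g. defect (\<pi> n) g \<partial>m)" for n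
      using defect_le_1[OF \<pi>] by (intro nn_integral_cong) (simp add: space_m min_absorb2)
    ultimately have lim': "(\<lambda>n. \<integral>\<^sup>+g. min 1 (defect (\<pi> n) g) \<partial>m) \<longlonglongrightarrow> 0" by simp
    have dm': "(\<lambda>g. min 1 (defect (\<pi> n) g)) \<in> borel_measurable m" for n
      using dm measurable_cong_sets[OF sm refl] by (intro borel_measurable_min) auto
    obtain r :: "nat \<Rightarrow> nat" where r: "AE g in m. (\<lambda>n. min 1 (defect (\<pi> (r n)) g)) \<longlonglongrightarrow> 0"
      by (rule nn_integral_tendsto_0_AE_subseq[OF prob_space.finite_measure[OF m] dm' _ lim']) (simp, rule that)
    have "AE g in m. (\<lambda>n. defect (\<pi> (r n)) g) \<longlonglongrightarrow> 0"
      using r AE_space by eventually_elim (use defect_le_1[OF \<pi>] in \<open>simp add: space_m min_absorb2\<close>)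
    then show ?thesis unfolding AE_m by blast
  qed
  then obtain r where r: "AE g in star_measure M l \<kappa>. (\<lambda>n. defect (\<pi> (r n)) g) \<longlonglongrightarrow> 0" by blast
  have "asymp_invariant_systems G M l \<kappa> (\<lambda>n. \<theta> (r n))"
    using r asymp_invariant_operators_iff_defect[of "\<lambda>n. \<pi> (r n)", OF \<pi> ac]
      asymp_invariant_systems_iff_operators[of "\<lambda>n. \<theta> (r n)", OF \<theta>] by (simp add: \<pi>_def)
  then show thesis by (rule that[of "\<lambda>n. \<theta> (r n)", OF \<theta>])
qed

section \<open>Mixtures of equivariant operators and their powers\<close>

lemma equivariant_geom_mixture:
  assumes Q: "\<And>k. equivariant_operator G M (Q k)"
  shows "equivariant_operator G M (geom_mixture Q)"
proof (rule equivariant_operatorI)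
  note QD = equivariant_operatorD[OF Q]
  show m: "geom_mixture Q \<in> M \<rightarrow>\<^sub>M prob_algebra M" by (rule geom_mixture_measurable[OF QD(1)])
  have sets: "sets (geom_mixture Q g) = sets M" if "g \<in> Mor G" for g
    using that by (intro sets_geom_mixture[OF QD(1)]) (simp add: space_M)
  have em: "emeasure (geom_mixture Q g) A = (\<Sum>k. geom_weight k * emeasure (Q k g) A)" if "g \<in> Mor G" "A \<in> sets M" for g A
    using that by (intro emeasure_geom_mixture[OF QD(1)]) (simp_all add: space_M)
  show "AE h in geom_mixture Q g. h \<in> fibre G (tgt G g)" if g: "g \<in> Mor G" for g
  proof (rule AE_I')
    have C: "space M - fibre G (tgt G g) \<in> sets M" using fibre_sets[OF tgt_Obj[OF g]] by auto
    have "space M - fibre G (tgt G g) \<in> null_sets (Q k g)" for k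
      using QD(5)[OF g, of k] C QD(3)[OF g] by (subst AE_iff_null_sets) (auto elim!: eventually_mono)
    then have "emeasure (geom_mixture Q g) (space M - fibre G (tgt G g)) = 0"
      using em[OF g C] by (simp add: null_setsD1)
    then show "space M - fibre G (tgt G g) \<in> null_sets (geom_mixture Q g)" using C sets[OF g] by auto
    show "{h \<in> space (geom_mixture Q g). h \<notin> fibre G (tgt G g)} \<subseteq> space M - fibre G (tgt G g)"
      using sets_eq_imp_space_eq[OF sets[OF g]] by auto
  qed
  show "geom_mixture Q (mult G g h) = translate G M g (geom_mixture Q h)" if gh: "(g, h) \<in> composable G" for g h
  proof (rule measure_eqI)
    have g: "g \<in> Mor G" and h: "h \<in> Mor G" using gh by (auto simp: composable_def)
    note ghM = mult_Mor[OF gh]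
    show "sets (geom_mixture Q (mult G g h)) = sets (translate G M g (geom_mixture Q h))" using sets[OF ghM] by simp
    fix A assume "A \<in> sets (geom_mixture Q (mult G g h))"
    then have A: "A \<in> sets M" using sets[OF ghM] by simp
    show "emeasure (geom_mixture Q (mult G g h)) A = emeasure (translate G M g (geom_mixture Q h)) A"
      unfolding em[OF ghM A] emeasure_translate[OF g sets[OF h] A] em[OF h translate_vimage_sets[OF g A]]
        QD(6)[OF gh] emeasure_translate[OF g QD(3)[OF h] A] ..
  qed
qed

lemma ac_geom_mixture:
  assumes Q: "\<And>k. equivariant_operator G M (Q k)" and ac: "\<And>k. ac_operator G l (Q k)"
  shows "ac_operator G l (geom_mixture Q)"
  unfolding ac_operator_def absolutely_continuous_def
proof (intro ballI subsetI)
  note QD = equivariant_operatorD[OF Q]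
  fix g A assume g: "g \<in> Mor G" and A: "A \<in> null_sets (l (tgt G g))"
  then have AM: "A \<in> sets M" and gM: "g \<in> space M" using sets_l[OF tgt_Obj[OF g]] by (auto simp: space_M)
  have "A \<in> null_sets (Q k g)" for k
    using ac g A unfolding ac_operator_def absolutely_continuous_def by blast
  then have "emeasure (geom_mixture Q g) A = 0"
    using emeasure_geom_mixture[OF QD(1) gM AM] by (simp add: null_setsD1)
  then show "A \<in> null_sets (geom_mixture Q g)" using AM sets_geom_mixture[OF QD(1) gM] by auto
qed

text \<open>The abstract argument with \<open>e = base\<close> and
  \<open>d k = 2 * defect (Q k)\<close>, a measurable bound for the variation distance. Testing its
  conclusion on indicators of \<open>test_sets\<close> gives the defect of the powers.\<close>

lemma obtain_asymp_invariant_powers: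
  assumes \<theta>: "\<And>n. ac_prob_system G M l (\<theta> n)" and inv: "asymp_invariant_systems G M l \<kappa> \<theta>"
  obtains \<pi> where "equivariant_operator G M \<pi>" "ac_operator G l \<pi>"
    "asymp_invariant_operators G M l \<kappa> (\<lambda>n. operator_power M \<pi> (Suc n))"
proof -
  define Q where "Q n = operator_of_system G M (\<theta> n)" for n
  have eqv: "equivariant_operator G M (Q n)" and ac: "ac_operator G l (Q n)" for n
    unfolding Q_def using operator_of_ac_prob_system[OF \<theta>] by auto
  note QD = equivariant_operatorD[OF eqv]
  have lim: "AE g in star_measure M l \<kappa>. (\<lambda>n. defect (Q n) g) \<longlonglongrightarrow> 0"
    using inv unfolding asymp_invariant_systems_iff_operators[OF \<theta>] Q_def[symmetric]
      asymp_invariant_operators_iff_defect[of Q, OF eqv ac] .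
  obtain \<mu> where \<mu>: "finite_measure \<mu>" "sets \<mu> = sets M" "space \<mu> = Mor G"
    "null_sets \<mu> = null_sets (star_measure M l \<kappa>)" "\<And>P. (AE g in \<mu>. P g) \<longleftrightarrow> (AE g in star_measure M l \<kappa>. P g)"
    by (rule finite_measure_equivalent_star) (rule that)
  interpret asymptotically_invariant_kernels M \<mu> base Q "\<lambda>n g. 2 * defect (Q n) g"
  proof (rule asymptotically_invariant_kernels.intro)
    show "finite_measure \<mu>" "sets \<mu> = sets M" by fact+
    show "base \<in> M \<rightarrow>\<^sub>M M" by (rule base_measurable)
    show "Q k \<in> M \<rightarrow>\<^sub>M prob_algebra M" for k by (rule QD(1))
    show "(\<lambda>g. 2 * defect (Q k) g) \<in> borel_measurable M" for k
      using defect_measurable[OF QD(1)] by measurable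
    show "AE g in \<mu>. emeasure (Q k g) A = 0 \<and> emeasure (Q k (base g)) A = 0" if A: "A \<in> null_sets \<mu>" for A k
    proof -
      \<comment> \<open>A null set of the star measure is null for almost every \<open>l x\<close>,
        hence for \<open>l (tgt G g)\<close> for almost every \<open>g\<close>, and this measure
        dominates both \<open>Q k g\<close> and \<open>Q k (base g)\<close>.\<close>
      have "AE g in star_measure M l \<kappa>. A \<in> null_sets (l (tgt G g))"
        using AE_star_tgt[OF AE_fibre_null] A unfolding \<mu>(4) by blast
      then have "AE g in star_measure M l \<kappa>. emeasure (Q k g) A = 0 \<and> emeasure (Q k (base g)) A = 0"
        using AE_space
      proof eventually_elim
        case (elim g)
        then have g: "g \<in> Mor G" by (simp add: space_star)
        have "A \<in> null_sets (Q k g)" "A \<in> null_sets (Q k (base g))"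
          using ac[of k] elim(1) g base_Mor[OF g] tgt_base[OF g]
          unfolding ac_operator_def absolutely_continuous_def by (metis subsetD)+
        then show ?case by auto
      qed
      then show ?thesis by (simp add: \<mu>(5))
    qed
    show "AE g in \<mu>. (\<lambda>k. 2 * defect (Q k) g) \<longlonglongrightarrow> 0"
      unfolding \<mu>(5) using lim
    proof eventually_elim
      case (elim g)
      then have "(\<lambda>k. 2 * defect (Q k) g) \<longlonglongrightarrow> 2 * 0" by (intro ennreal_tendsto_cmult) auto
      then show ?case by simp
    qed
    \<comment> \<open>The defect vanishes at every unit, so the limit holds even if the units form a
      null set.\<close>
    show "AE g in \<mu>. (\<lambda>k. 2 * defect (Q k) (base g)) \<longlonglongrightarrow> 0"
      by (rule AE_I2) (simp add: \<mu>(3) defect_base)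
    fix g assume "g \<in> space M"
    then have g: "g \<in> Mor G" by (simp add: space_M)
    note bg = base_Mor[OF g]
    show "base (base g) = base g" by (rule base_base[OF g])
    show "AE h in Q k g. base h = base g" for k
      using QD(5)[OF g] by eventually_elim (simp add: fibre_def base_def)
    show "2 * defect (Q k) g \<le> 2" for k
      using mult_left_mono[OF defect_le_1[OF eqv g], of 2] by simp
    fix u :: "'g \<Rightarrow> ennreal" and k
    assume u: "u \<in> borel_measurable M" "\<And>h. h \<in> space M \<Longrightarrow> u h \<le> 1"
    have fin: "finite_measure (Q k g)" "finite_measure (Q k (base g))"
      using QD(2)[OF g] QD(2)[OF bg] prob_space.finite_measure by auto
    have tv: "tv_norm_diff (Q k g) (Q k (base g)) \<le> 2 * defect (Q k) g" by (rule tv_norm_diff_le_defect[OF eqv ac g])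
    have "kernel_op (Q k) u g \<le> kernel_op (Q k) u (base g) + tv_norm_diff (Q k g) (Q k (base g))"
      unfolding kernel_op_def
      by (rule nn_integral_le_tv_norm_diff) (use fin QD(3,4)[OF g] QD(3)[OF bg] u(2) space_M in auto)
    then show "kernel_op (Q k) u g \<le> kernel_op (Q k) u (base g) + 2 * defect (Q k) g"
      by (rule order_trans) (rule add_left_mono[OF tv])
    have "kernel_op (Q k) u (base g) \<le> kernel_op (Q k) u g + tv_norm_diff (Q k (base g)) (Q k g)"
      unfolding kernel_op_def
      by (rule nn_integral_le_tv_norm_diff) (use fin QD(3)[OF g] QD(3,4)[OF bg] u(2) space_M in auto)
    also have "tv_norm_diff (Q k (base g)) (Q k g) = tv_norm_diff (Q k g) (Q k (base g))"
      by (rule tv_norm_diff_commute) (use QD(3)[OF g] QD(3)[OF bg] in simp)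
    finally show "kernel_op (Q k) u (base g) \<le> kernel_op (Q k) u g + 2 * defect (Q k) g"
      by (rule order_trans) (rule add_left_mono[OF tv])
  qed
  obtain \<sigma> where \<sigma>: "AE g in \<mu>. \<forall>\<epsilon>>0. \<exists>n0. \<forall>n\<ge>n0. \<forall>u\<in>borel_measurable M. (\<forall>h\<in>space M. u h \<le> 1) \<longrightarrow>
     (mixture_op \<sigma> ^^ n) u g \<le> (mixture_op \<sigma> ^^ n) u (base g) + \<epsilon> \<and>
     (mixture_op \<sigma> ^^ n) u (base g) \<le> (mixture_op \<sigma> ^^ n) u g + \<epsilon>"
    using mixture_asymptotically_invariant by blast
  define \<pi> where "\<pi> = geom_mixture (\<lambda>k. Q (\<sigma> k))"
  have \<pi>: "equivariant_operator G M \<pi>" and ac\<pi>: "ac_operator G l \<pi>"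
    unfolding \<pi>_def by (rule equivariant_geom_mixture[OF eqv], rule ac_geom_mixture[OF eqv ac])
  note pow = equivariant_operatorD[OF equivariant_operator_power[OF \<pi>]]
  have "AE g in star_measure M l \<kappa>. (\<lambda>n. defect (operator_power M \<pi> n) g) \<longlonglongrightarrow> 0"
    using \<sigma> AE_space[of "star_measure M l \<kappa>"] unfolding \<mu>(5)
  proof eventually_elim
    case (elim g)
    then have g: "g \<in> Mor G" by (simp add: space_star)
    note bg = base_Mor[OF g]
    show ?case
    proof (rule ennreal_tendsto_0I)
      fix \<epsilon> :: real assume \<epsilon>: "\<epsilon> > 0"
      then obtain n0 where n0: "\<And>n u. n0 \<le> n \<Longrightarrow> u \<in> borel_measurable M \<Longrightarrow> (\<forall>h\<in>space M. u h \<le> 1) \<Longrightarrow>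
         (mixture_op \<sigma> ^^ n) u g \<le> (mixture_op \<sigma> ^^ n) u (base g) + ennreal \<epsilon> \<and>
         (mixture_op \<sigma> ^^ n) u (base g) \<le> (mixture_op \<sigma> ^^ n) u g + ennreal \<epsilon>"
        using elim(1) by (metis ennreal_less_zero_iff)
      have "defect (operator_power M \<pi> n) g \<le> ennreal \<epsilon>" if n: "n0 \<le> n" for n
        unfolding defect_def
      proof (rule SUP_least, rule ennreal_leI)
        fix A assume "A \<in> test_sets"
        then have A: "A \<in> sets M" using test_sets(2) by auto
        interpret p: prob_space "operator_power M \<pi> n g" by (rule pow(2)[OF g])
        interpret b: prob_space "operator_power M \<pi> n (base g)" by (rule pow(2)[OF bg])
        have eq: "(mixture_op \<sigma> ^^ n) (indicator A) h = emeasure (operator_power M \<pi> n h) A" if h: "h \<in> Mor G" for h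
          using nn_integral_operator_power[OF equivariant_operatorD(1)[OF \<pi>], of "indicator A" h n] A h pow(3)[OF h]
          by (simp add: space_M \<pi>_def)
        have "emeasure (operator_power M \<pi> n g) A \<le> emeasure (operator_power M \<pi> n (base g)) A + ennreal \<epsilon> \<and>
          emeasure (operator_power M \<pi> n (base g)) A \<le> emeasure (operator_power M \<pi> n g) A + ennreal \<epsilon>"
          using n0[OF n, of "indicator A"] A eq[OF g] eq[OF bg] by (simp add: indicator_def)
        then show "\<bar>measure (operator_power M \<pi> n g) A - measure (operator_power M \<pi> n (base g)) A\<bar> \<le> \<epsilon>"
          using \<epsilon> by (auto simp: p.emeasure_eq_measure b.emeasure_eq_measure ennreal_plus[symmetric] simp del: ennreal_plus)
      qed
      then show "\<exists>n0. \<forall>n\<ge>n0. defect (operator_power M \<pi> n) g \<le> ennreal \<epsilon>" by blast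
    qed
  qed
  \<comment> \<open>The passage from the defect back to the norm uses absolute continuity, which the
    zeroth power may lack; hence the shift.\<close>
  then have "AE g in star_measure M l \<kappa>. (\<lambda>n. defect (operator_power M \<pi> (Suc n)) g) \<longlonglongrightarrow> 0"
    by eventually_elim (rule LIMSEQ_Suc)
  then have "asymp_invariant_operators G M l \<kappa> (\<lambda>n. operator_power M \<pi> (Suc n))"
    by (subst asymp_invariant_operators_iff_defect)
      (auto intro: equivariant_operator_power[OF \<pi>] ac_operator_power[OF \<pi> ac\<pi>] simp del: operator_power.simps)
  then show thesis by (rule that[OF \<pi> ac\<pi>])
qed

lemma asymp_invariant_operators_cong:
  assumes "\<And>n g. g \<in> Mor G \<Longrightarrow> P n g = P' n g"
  shows "asymp_invariant_operators G M l \<kappa> P \<longleftrightarrow> asymp_invariant_operators G M l \<kappa> P'"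
proof -
  have "bind (return M g) (P n) = bind (return M g) (P' n)" for g n
    by (rule bind_cong) (auto simp: assms space_M)
  then show ?thesis by (simp add: asymp_invariant_operators_def)
qed

end

theorem theorem31:
  fixes G :: "('o, 'g) groupoid_data"
    and M :: "'g measure" and l :: "'o \<Rightarrow> 'g measure" and \<kappa> :: "'o measure"
  assumes "measured_groupoid G M l \<kappa>"
  shows
    "(amenable G M l \<kappa> \<longleftrightarrow>
       (\<exists>\<theta> :: nat \<Rightarrow> 'o \<Rightarrow> 'g measure.
          (\<forall>n. ac_prob_system G M l (\<theta> n)) \<and> asymp_invariant_systems G M l \<kappa> \<theta>)) \<and>
     (\<forall>\<theta> :: nat \<Rightarrow> 'o \<Rightarrow> 'g measure. (\<forall>n. ac_prob_system G M l (\<theta> n)) \<longrightarrow>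
       (asymp_invariant_systems G M l \<kappa> \<theta> \<longleftrightarrow>
        asymp_invariant_operators G M l \<kappa> (\<lambda>n. operator_of_system G M (\<theta> n)))) \<and>
     (amenable G M l \<kappa> \<longleftrightarrow>
       (\<exists>\<theta> :: 'o \<Rightarrow> 'g measure. ac_prob_system G M l \<theta> \<and>
          asymp_invariant_systems G M l \<kappa> (\<lambda>n. convolution_power G M \<theta> (Suc n)))) \<and>
     (amenable G M l \<kappa> \<longleftrightarrow>
       (\<exists>\<pi> :: 'g \<Rightarrow> 'g measure. equivariant_operator G M \<pi> \<and> ac_operator G l \<pi> \<and>
          asymp_invariant_operators G M l \<kappa> (\<lambda>n. operator_power M \<pi> (Suc n))))"
proof -
  interpret measured_groupoid G M l \<kappa> by fact
  let ?ii = "\<exists>\<theta> :: nat \<Rightarrow> 'o \<Rightarrow> 'g measure.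
    (\<forall>n. ac_prob_system G M l (\<theta> n)) \<and> asymp_invariant_systems G M l \<kappa> \<theta>"
  let ?iii = "\<exists>\<theta> :: 'o \<Rightarrow> 'g measure. ac_prob_system G M l \<theta> \<and>
    asymp_invariant_systems G M l \<kappa> (\<lambda>n. convolution_power G M \<theta> (Suc n))"
  let ?iv = "\<exists>\<pi> :: 'g \<Rightarrow> 'g measure. equivariant_operator G M \<pi> \<and> ac_operator G l \<pi> \<and>
    asymp_invariant_operators G M l \<kappa> (\<lambda>n. operator_power M \<pi> (Suc n))"
  have i_ii: "amenable G M l \<kappa> \<longleftrightarrow> ?ii"
    using amenable_imp_asymp_invariant amenable_if_asymp_invariant by metis
  \<comment> \<open>The mixture is built from operators, so the operator form comes first. Systems
    follow by the correspondence, and convolution powers of one system are in particular a sequence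
    as in \<open>?ii\<close>, which closes the cycle.\<close>
  have ii_iv: "?iv" if "?ii"
    using that obtain_asymp_invariant_powers by metis
  have iv_iii: "?iii" if iv: "?iv"
  proof -
    obtain \<pi> where \<pi>: "equivariant_operator G M \<pi>" "ac_operator G l \<pi>"
      and inv: "asymp_invariant_operators G M l \<kappa> (\<lambda>n. operator_power M \<pi> (Suc n))"
      using iv by blast
    let ?\<theta> = "system_of_operator G \<pi>"
    have \<theta>: "ac_prob_system G M l ?\<theta>" by (rule ac_prob_system_of_operator[OF \<pi>])
    have "operator_of_system G M (convolution_power G M ?\<theta> n) g = operator_power M \<pi> n g" if g: "g \<in> Mor G" for n g
      using convolution_power_eq_operator_power(2)[OF \<theta> g]
        operator_power_cong[OF equivariant_operatorD(1)[OF \<pi>(1)] operator_of_system_of_operator[OF \<pi>(1)] g] by simp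
    then have "asymp_invariant_systems G M l \<kappa> (\<lambda>n. convolution_power G M ?\<theta> (Suc n))"
      using inv asymp_invariant_systems_iff_operators[OF ac_prob_system_convolution_power[OF \<theta>]]
        asymp_invariant_operators_cong[of "\<lambda>n. operator_of_system G M (convolution_power G M ?\<theta> (Suc n))"
          "\<lambda>n. operator_power M \<pi> (Suc n)"]
      by (simp del: operator_power.simps convolution_power.simps)
    then show ?thesis using \<theta> by blast
  qed
  have iii_ii: "?ii" if "?iii"
    using that ac_prob_system_convolution_power by metis
  show ?thesis
    using i_ii ii_iv iv_iii iii_ii asymp_invariant_systems_iff_operators by metis
qed

end
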